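(* Fix integers $s,t$ with $3\le s\le t-2$. There is a $\mathcal K_t$-free weighted graph $R$ with $d_{K_s}(R)=\pi_s(\mathcal K_t)$ satisfying: (A1) for any distinct $v,v'\in V(R)$, $w(v,v')\in\{\tfrac12,1\}$; (A2) there is a partition $V(R)=B_1\cup\dots\cup B_a$ into nonempty parts such that vertices in the same part have the same weight, and an edge between distinct vertices has weight $1/2$ if it lies within some $B_i$ and weight $1$ otherwise; moreover, with $b=|V(R)|$, we have $b\ge s$ and $a+b=t-1$; (A3) for all $i,j$, $|B_i|$ and $|B_j|$ differ by at most $1$; (A4) if $|B_i|\ge|B_j|$ for (possibly equal) $i,j\in[a]$, then $w(v_i)\le w(v_j)$ for all $v_i\in B_i$, $v_j\in B_j$; in particular if $|B_i|=|B_j|$ all vertices of $B_i\cup B_j$ have the same weight; (A5) either $a=1$ and $|B_1|=s$, or $a\ge2$ and $|B_i|\le s-1$ for all $i\in[a]$. Moreover, every $\mathcal K_t$-free weighted graph $R$ with $d_{K_s}(R)=\pi_s(\mathcal K_t)$ and with the minimum number of vertices among such graphs satisfies (A1)–(A5).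
   Context: A weighted graph $R=(V,w)$ is a finite set $V$ with $w:V\sqcup V^2\to[0,1]$ such that $\sum_{v}w(v)=1$, $w(v,v')=w(v',v)$, $w(v,v)=0$. $R_{>\alpha}$ is the spanning graph of pairs of weight $>\alpha$. $d_{K_s}(R)=\sum_{\sigma:[s]\to V}\prod_{i}w(\sigma(i))\prod_{1\le i<j\le s}w(\sigma(i),\sigma(j))$. $R$ is $\mathcal K_t$-free if there are no $S_2\subseteq S_1\subseteq V$ with $|S_1|,|S_2|\ge1$, $|S_1|+|S_2|=t$, $S_1$ a clique in $R_{>0}$ and $S_2$ a clique in $R_{>1/2}$. $\pi_s(\mathcal K_t)$ is the supremum of $d_{K_s}(R)$ over all $\mathcal K_t$-free weighted graphs $R$. *)

theory Defs
  imports Complex_Main "HOL-Library.FuncSet" "HOL-Library.Disjoint_Sets"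
begin

record 'a wgraph =
  verts :: "'a set"
  vweight :: "'a \<Rightarrow> real"
  eweight :: "'a \<Rightarrow> 'a \<Rightarrow> real"

definition weighted_graph :: "'a wgraph \<Rightarrow> bool" where
  "weighted_graph R \<longleftrightarrow>
     finite (verts R) \<and>
     (\<forall>v\<in>verts R. 0 \<le> vweight R v \<and> vweight R v \<le> 1) \<and>
     (\<forall>v\<in>verts R. \<forall>v'\<in>verts R. 0 \<le> eweight R v v' \<and> eweight R v v' \<le> 1) \<and>
     (\<Sum>v\<in>verts R. vweight R v) = 1 \<and>
     (\<forall>v\<in>verts R. \<forall>v'\<in>verts R. eweight R v v' = eweight R v' v) \<and>
     (\<forall>v\<in>verts R. eweight R v v = 0)"

definition adj_above :: "'a wgraph \<Rightarrow> real \<Rightarrow> 'a \<Rightarrow> 'a \<Rightarrow> bool" where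
  "adj_above R \<alpha> v v' \<longleftrightarrow>
     v \<in> verts R \<and> v' \<in> verts R \<and> v \<noteq> v' \<and> eweight R v v' > \<alpha>"

definition clique_above :: "'a wgraph \<Rightarrow> real \<Rightarrow> 'a set \<Rightarrow> bool" where
  "clique_above R \<alpha> S \<longleftrightarrow>
     S \<subseteq> verts R \<and> (\<forall>v\<in>S. \<forall>v'\<in>S. v \<noteq> v' \<longrightarrow> adj_above R \<alpha> v v')"

definition K_free :: "nat \<Rightarrow> 'a wgraph \<Rightarrow> bool" where
  "K_free t R \<longleftrightarrow>
     \<not> (\<exists>S\<^sub>1 S\<^sub>2. S\<^sub>2 \<subseteq> S\<^sub>1 \<and> S\<^sub>1 \<subseteq> verts R \<and> card S\<^sub>1 \<ge> 1 \<and> card S\<^sub>2 \<ge> 1 \<and>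
           card S\<^sub>1 + card S\<^sub>2 = t \<and> clique_above R 0 S\<^sub>1 \<and> clique_above R (1/2) S\<^sub>2)"

definition K_density :: "nat \<Rightarrow> 'a wgraph \<Rightarrow> real" where
  "K_density s R =
     (\<Sum>\<sigma> \<in> {1..s} \<rightarrow>\<^sub>E verts R.
        (\<Prod>i\<in>{1..s}. vweight R (\<sigma> i)) *
        (\<Prod>i\<in>{1..s}. \<Prod>j\<in>{i<..s}. eweight R (\<sigma> i) (\<sigma> j)))"

text \<open>
  Vertex sets are finite and the density and the freeness condition are invariant under
  isomorphism, so ranging over graphs with natural numbers as vertices loses nothing.
  The supremum is a genuine one for \<open>t \<noteq> 2\<close>: see \<open>K_densities_bdd_above\<close>
  and \<open>K_densities_nonempty\<close> below.
\<close>

definition pi_K :: "nat \<Rightarrow> nat \<Rightarrow> real" where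
  "pi_K s t = Sup {K_density s R | R :: nat wgraph. weighted_graph R \<and> K_free t R}"

definition extremal :: "nat \<Rightarrow> nat \<Rightarrow> 'a wgraph \<Rightarrow> bool" where
  "extremal s t R \<longleftrightarrow> weighted_graph R \<and> K_free t R \<and> K_density s R = pi_K s t"

definition min_extremal :: "nat \<Rightarrow> nat \<Rightarrow> 'a wgraph \<Rightarrow> bool" where
  "min_extremal s t R \<longleftrightarrow>
     extremal s t R \<and>
     (\<forall>R' :: nat wgraph. extremal s t R' \<longrightarrow> card (verts R) \<le> card (verts R'))"

definition condA1 :: "'a wgraph \<Rightarrow> bool" where
  "condA1 R \<longleftrightarrow>
     (\<forall>v\<in>verts R. \<forall>v'\<in>verts R. v \<noteq> v' \<longrightarrow> eweight R v v' \<in> {1/2, 1})"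

text \<open>The parts \<open>B\<^sub>1, \<dots>, B\<^sub>a\<close> are the members of the set \<open>\<B>\<close>, so \<open>a = card \<B>\<close>.\<close>

definition condA2 :: "nat \<Rightarrow> nat \<Rightarrow> 'a wgraph \<Rightarrow> 'a set set \<Rightarrow> bool" where
  "condA2 s t R \<B> \<longleftrightarrow>
     partition_on (verts R) \<B> \<and>
     (\<forall>B\<in>\<B>. \<forall>v\<in>B. \<forall>v'\<in>B. vweight R v = vweight R v') \<and>
     (\<forall>v\<in>verts R. \<forall>v'\<in>verts R. v \<noteq> v' \<longrightarrow>
        eweight R v v' = (if \<exists>B\<in>\<B>. v \<in> B \<and> v' \<in> B then 1/2 else 1)) \<and>
     card (verts R) \<ge> s \<and>
     card \<B> + card (verts R) = t - 1"

definition condA3 :: "'a set set \<Rightarrow> bool" where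
  "condA3 \<B> \<longleftrightarrow> (\<forall>B\<in>\<B>. \<forall>B'\<in>\<B>. \<bar>int (card B) - int (card B')\<bar> \<le> 1)"

definition condA4 :: "'a wgraph \<Rightarrow> 'a set set \<Rightarrow> bool" where
  "condA4 R \<B> \<longleftrightarrow>
     (\<forall>B\<in>\<B>. \<forall>B'\<in>\<B>. card B \<ge> card B' \<longrightarrow>
        (\<forall>v\<in>B. \<forall>v'\<in>B'. vweight R v \<le> vweight R v')) \<and>
     (\<forall>B\<in>\<B>. \<forall>B'\<in>\<B>. card B = card B' \<longrightarrow>
        (\<forall>v\<in>B \<union> B'. \<forall>v'\<in>B \<union> B'. vweight R v = vweight R v'))"

definition condA5 :: "nat \<Rightarrow> 'a set set \<Rightarrow> bool" where
  "condA5 s \<B> \<longleftrightarrow>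
     (card \<B> = 1 \<and> (\<forall>B\<in>\<B>. card B = s)) \<or>
     (card \<B> \<ge> 2 \<and> (\<forall>B\<in>\<B>. card B \<le> s - 1))"

definition A1_to_A5 :: "nat \<Rightarrow> nat \<Rightarrow> 'a wgraph \<Rightarrow> bool" where
  "A1_to_A5 s t R \<longleftrightarrow>
     condA1 R \<and>
     (\<exists>\<B>. condA2 s t R \<B> \<and> condA3 \<B> \<and> condA4 R \<B> \<and> condA5 s \<B>)"

lemma K_density_le_1:
  assumes "weighted_graph R"
  shows "K_density s R \<le> 1"
proof -
  have fin: "finite (verts R)"
    and w: "\<And>v. v \<in> verts R \<Longrightarrow> 0 \<le> vweight R v"
    and e: "\<And>v v'. v \<in> verts R \<Longrightarrow> v' \<in> verts R \<Longrightarrow> 0 \<le> eweight R v v' \<and> eweight R v v' \<le> 1"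
    and one: "(\<Sum>v\<in>verts R. vweight R v) = 1"
    using assms by (auto simp: weighted_graph_def)
  have "K_density s R \<le> (\<Sum>\<sigma> \<in> {1..s} \<rightarrow>\<^sub>E verts R. \<Prod>i\<in>{1..s}. vweight R (\<sigma> i))"
    unfolding K_density_def
  proof (rule sum_mono)
    fix \<sigma> assume "\<sigma> \<in> {1..s} \<rightarrow>\<^sub>E verts R"
    then have in_V: "\<sigma> i \<in> verts R" if "i \<in> {1..s}" for i
      using that by auto
    have inner: "0 \<le> (\<Prod>j\<in>{i<..s}. eweight R (\<sigma> i) (\<sigma> j)) \<and>
        (\<Prod>j\<in>{i<..s}. eweight R (\<sigma> i) (\<sigma> j)) \<le> 1" if "i \<in> {1..s}" for i
      using that by (intro conjI prod_nonneg prod_le_1) (auto simp: e in_V)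
    have "(\<Prod>i\<in>{1..s}. \<Prod>j\<in>{i<..s}. eweight R (\<sigma> i) (\<sigma> j)) \<le> 1"
      using inner by (intro prod_le_1) auto
    moreover have "0 \<le> (\<Prod>i\<in>{1..s}. vweight R (\<sigma> i))"
      by (intro prod_nonneg) (auto simp: w in_V)
    ultimately show "(\<Prod>i\<in>{1..s}. vweight R (\<sigma> i)) *
        (\<Prod>i\<in>{1..s}. \<Prod>j\<in>{i<..s}. eweight R (\<sigma> i) (\<sigma> j)) \<le> (\<Prod>i\<in>{1..s}. vweight R (\<sigma> i))"
      by (rule mult_left_le)
  qed
  also have "\<dots> = (\<Prod>i\<in>{1..s}. \<Sum>v\<in>verts R. vweight R v)"
    using fin by (subst prod_sum_PiE) auto
  finally show ?thesis
    by (simp add: one)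
qed

lemma K_densities_bdd_above:
  "bdd_above {K_density s R | R :: nat wgraph. weighted_graph R \<and> K_free t R}"
  by (rule bdd_aboveI[of _ 1]) (auto intro: K_density_le_1)

lemma K_densities_nonempty:
  assumes "t \<noteq> 2"
  shows "{K_density s R | R :: nat wgraph. weighted_graph R \<and> K_free t R} \<noteq> {}"
proof -
  let ?R = "\<lparr>verts = {0}, vweight = \<lambda>_. 1, eweight = \<lambda>_ _. 0\<rparr> :: nat wgraph"
  have "weighted_graph ?R"
    by (simp add: weighted_graph_def)
  moreover have "K_free t ?R"
    using assms by (auto simp: K_free_def subset_singleton_iff)
  ultimately show ?thesis
    by blast
qed

end

theory Submission
  imports Defs "HOL-Analysis.Analysis" "HOL-Combinatorics.Permutations"
begin

text \<open>
  The density is \<open>s!\<close> times a sum over \<open>s\<close>-subsets of vertices, hence for two vertices \<open>u\<close>, \<open>v\<close> it has the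
  form \<open>A + x\<^sub>u B\<^sub>u + x\<^sub>v B\<^sub>v + x\<^sub>u x\<^sub>v w(u,v) C\<close>. If \<open>w(u,v) = 0\<close> this is linear along \<open>x\<^sub>u + x\<^sub>v = const\<close>, so
  one of the two vertices can be removed; this bounds the number of vertices by \<open>t - 2\<close> and compactness
  gives an extremal graph. In an extremal graph with fewest vertices all weights are positive, edge
  weights can be rounded up to \<open>1/2\<close> or \<open>1\<close>, and optimality in \<open>x\<^sub>u\<close>, \<open>x\<^sub>v\<close> gives
  \<open>B\<^sub>u + x\<^sub>v w(u,v) C = B\<^sub>v + x\<^sub>u w(u,v) C\<close>. Everything else follows by comparison with three modified graphs:
  \<open>u\<close> is replaced by a clone of \<open>v\<close> (joined to \<open>v\<close> with weight \<open>1/2\<close>), \<open>u\<close> and \<open>v\<close> are merged into a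
  vertex with all edge weights \<open>1\<close>, or a vertex is split in two. Cloning in both directions and
  a sum of squares show that pairs of weight \<open>1/2\<close> are twins and form an equivalence relation.
  For the sizes of the parts, the \<open>(s-1)\<close>-sets in the merging inequality are turned into \<open>(s-2)\<close>-sets by
  double counting; all inequalities then become averages over the same measure on \<open>(s-2)\<close>-sets and
  contradict each other pointwise.
\<close>

text \<open>Freeness acts as a budget. Once all edge weights are positive, it says that the number
  of vertices plus the size of any nonempty clique above \<open>1/2\<close> stays below
  \<open>t\<close>. A clone costs nothing, since a pair of weight \<open>1/2\<close> lies in no such
  clique. Merging saves one vertex and enlarges cliques by at most one. Splitting costs one vertex,
  so it is possible exactly while a unit is left, which pins down \<open>a + b = t - 1\<close>. The
  obstacle is that the coefficients live on sets of two sizes: those of single vertices are sums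
  over \<open>(s-1)\<close>-sets, those of pairs over \<open>(s-2)\<close>-sets. Cloning therefore
  compares only products of edge weights over \<open>(s-2)\<close>-sets, not single edges, and
  transitivity of the relation "weight \<open>1/2\<close>" needs a second extremal graph. For two
  parts whose sizes differ by at least two, cloning bounds one average by \<open>\<theta>\<close>
  and merging another by \<open>\<xi>\<close>. The multiplier
  \<open>8 / ((1 + \<rho>) * \<rho>\<^sup>2)\<close> is the ratio \<open>\<theta> / \<xi>\<close>,
  so both contribute \<open>\<theta>\<close>, as in the equality case of AM-GM.\<close>

section \<open>Sums over subsets\<close>

text \<open>The square root is taken because every unordered pair occurs twice in the product.\<close>

definition cw :: "('a \<Rightarrow> real) \<Rightarrow> ('a \<Rightarrow> 'a \<Rightarrow> real) \<Rightarrow> 'a set \<Rightarrow> real" where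
  "cw x w T = (\<Prod>v\<in>T. x v) * (\<Prod>a\<in>T. \<Prod>b\<in>T - {a}. sqrt (w a b))"

text \<open>The factor \<open>g\<close> is an external field: it collects the edges to vertices
  already split off, so that peeling off vertices one by one stays within this family of
  sums.\<close>

definition ws :: "('a \<Rightarrow> real) \<Rightarrow> ('a \<Rightarrow> 'a \<Rightarrow> real) \<Rightarrow> 'a set \<Rightarrow> nat \<Rightarrow> ('a \<Rightarrow> real) \<Rightarrow> real" where
  "ws x w N k g = (\<Sum>T | T \<subseteq> N \<and> card T = k. cw x w T * (\<Prod>t\<in>T. g t))"

definition sym_nonneg :: "'a set \<Rightarrow> ('a \<Rightarrow> 'a \<Rightarrow> real) \<Rightarrow> bool" where
  "sym_nonneg N w \<longleftrightarrow> (\<forall>a\<in>N. \<forall>b\<in>N. 0 \<le> w a b \<and> w a b = w b a)"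

lemma sym_nonneg_subset: "sym_nonneg N w \<Longrightarrow> M \<subseteq> N \<Longrightarrow> sym_nonneg M w"
  unfolding sym_nonneg_def by blast

lemma cw_insert:
  assumes "finite T" "u \<notin> T" "sym_nonneg (insert u T) w"
  shows "cw x w (insert u T) = x u * cw x w T * (\<Prod>t\<in>T. w u t)"
proof -
  have "(\<Prod>a\<in>insert u T. \<Prod>b\<in>insert u T - {a}. sqrt (w a b))
      = (\<Prod>b\<in>T. sqrt (w u b)) * (\<Prod>a\<in>T. \<Prod>b\<in>insert u T - {a}. sqrt (w a b))"
    using assms(1,2) by simp
  also have "(\<Prod>a\<in>T. \<Prod>b\<in>insert u T - {a}. sqrt (w a b))
      = (\<Prod>a\<in>T. sqrt (w u a) * (\<Prod>b\<in>T - {a}. sqrt (w a b)))"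
  proof (rule prod.cong[OF refl])
    fix a assume a: "a \<in> T"
    have eq: "insert u T - {a} = insert u (T - {a})"
      using a assms(2) by blast
    have sym: "w a u = w u a"
      using assms(3) a unfolding sym_nonneg_def by blast
    show "(\<Prod>b\<in>insert u T - {a}. sqrt (w a b)) = sqrt (w u a) * (\<Prod>b\<in>T - {a}. sqrt (w a b))"
      unfolding eq sym[symmetric] using assms(1,2) by (intro prod.insert) auto
  qed
  also have "\<dots> = (\<Prod>a\<in>T. sqrt (w u a)) * (\<Prod>a\<in>T. \<Prod>b\<in>T - {a}. sqrt (w a b))"
    by (simp add: prod.distrib)
  finally have 1: "(\<Prod>a\<in>insert u T. \<Prod>b\<in>insert u T - {a}. sqrt (w a b))
      = ((\<Prod>t\<in>T. sqrt (w u t)) * (\<Prod>t\<in>T. sqrt (w u t))) * (\<Prod>a\<in>T. \<Prod>b\<in>T - {a}. sqrt (w a b))"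
    by simp
  have "(\<Prod>t\<in>T. sqrt (w u t)) * (\<Prod>t\<in>T. sqrt (w u t)) = (\<Prod>t\<in>T. w u t)"
    unfolding prod.distrib[symmetric]
  proof (rule prod.cong[OF refl])
    fix t assume "t \<in> T"
    hence "0 \<le> w u t" using assms(3) unfolding sym_nonneg_def by blast
    thus "sqrt (w u t) * sqrt (w u t) = w u t" by simp
  qed
  with 1 show ?thesis
    using assms(1,2) by (simp add: cw_def)
qed

lemma cw_cong:
  assumes "\<And>a. a \<in> T \<Longrightarrow> x a = x' a"
    and "\<And>a b. a \<in> T \<Longrightarrow> b \<in> T \<Longrightarrow> a \<noteq> b \<Longrightarrow> w a b = w' a b"
  shows "cw x w T = cw x' w' T"
  unfolding cw_def using assms by (intro arg_cong2[of _ _ _ _ "(*)"] prod.cong refl) auto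

lemma ws_cong:
  assumes "\<And>a. a \<in> N \<Longrightarrow> x a = x' a"
    and "\<And>a b. a \<in> N \<Longrightarrow> b \<in> N \<Longrightarrow> a \<noteq> b \<Longrightarrow> w a b = w' a b"
    and "\<And>a. a \<in> N \<Longrightarrow> g a = g' a"
  shows "ws x w N k g = ws x' w' N k g'"
  unfolding ws_def
proof (rule sum.cong[OF refl])
  fix T assume T: "T \<in> {T. T \<subseteq> N \<and> card T = k}"
  have "cw x w T = cw x' w' T"
    using T by (intro cw_cong assms) auto
  moreover have "prod g T = prod g' T"
    using T by (intro prod.cong refl assms) auto
  ultimately show "cw x w T * prod g T = cw x' w' T * prod g' T" by simp
qed

lemma cw_nonneg:
  assumes "\<And>a. a \<in> T \<Longrightarrow> 0 \<le> x a" "\<And>a b. a \<in> T \<Longrightarrow> b \<in> T \<Longrightarrow> a \<noteq> b \<Longrightarrow> 0 \<le> w a b"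
  shows "0 \<le> cw x w T"
  unfolding cw_def using assms by (intro mult_nonneg_nonneg prod_nonneg) auto

lemma cw_pos:
  assumes "\<And>a. a \<in> T \<Longrightarrow> 0 < x a" "\<And>a b. a \<in> T \<Longrightarrow> b \<in> T \<Longrightarrow> a \<noteq> b \<Longrightarrow> 0 < w a b"
  shows "0 < cw x w T"
  unfolding cw_def using assms by (intro mult_pos_pos prod_pos) auto

lemma ws_pos:
  assumes "finite N" "k \<le> card N"
    and "\<And>a. a \<in> N \<Longrightarrow> 0 < x a" "\<And>a b. a \<in> N \<Longrightarrow> b \<in> N \<Longrightarrow> a \<noteq> b \<Longrightarrow> 0 < w a b"
    and "\<And>a. a \<in> N \<Longrightarrow> 0 < g a"
  shows "0 < ws x w N k g"
proof -
  obtain T where "T \<subseteq> N" "card T = k"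
    using obtain_subset_with_card_n[OF assms(2)] by metis
  hence "{T. T \<subseteq> N \<and> card T = k} \<noteq> {}" by blast
  moreover have "0 < cw x w T * prod g T" if "T \<subseteq> N" for T
    using that by (intro mult_pos_pos cw_pos prod_pos assms) auto
  ultimately show ?thesis
    unfolding ws_def using assms(1) by (intro sum_pos) auto
qed

lemma ws_insert:
  assumes "finite N" "u \<notin> N" "sym_nonneg (insert u N) w"
  shows "ws x w (insert u N) (Suc k) g
       = ws x w N (Suc k) g + x u * g u * ws x w N k (\<lambda>t. g t * w u t)"
proof -
  let ?A = "{T. T \<subseteq> N \<and> card T = Suc k}" and ?B = "{T. T \<subseteq> N \<and> card T = k}"
  have fin: "finite T" if "T \<subseteq> N" for T
    using that assms(1) finite_subset by blast
  have "{T. T \<subseteq> insert u N \<and> card T = Suc k} = ?A \<union> insert u ` ?B"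
  proof (intro equalityI subsetI)
    fix T assume T: "T \<in> {T. T \<subseteq> insert u N \<and> card T = Suc k}"
    show "T \<in> ?A \<union> insert u ` ?B"
    proof (cases "u \<in> T")
      case True
      hence "T = insert u (T - {u})" "T - {u} \<in> ?B" using T by auto
      thus ?thesis by blast
    qed (use T in auto)
  next
    fix T assume "T \<in> ?A \<union> insert u ` ?B"
    thus "T \<in> {T. T \<subseteq> insert u N \<and> card T = Suc k}"
      using assms(2) fin by (auto simp: card_insert_if)
  qed
  hence "ws x w (insert u N) (Suc k) g
      = (\<Sum>T\<in>?A \<union> insert u ` ?B. cw x w T * prod g T)"
    by (simp add: ws_def)
  also have "\<dots> = ws x w N (Suc k) g + (\<Sum>T\<in>insert u ` ?B. cw x w T * prod g T)"
    unfolding ws_def using assms(1,2) by (intro sum.union_disjoint) auto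
  also have "(\<Sum>T\<in>insert u ` ?B. cw x w T * prod g T)
      = (\<Sum>T\<in>?B. cw x w (insert u T) * prod g (insert u T))"
  proof (rule sum.reindex[unfolded o_def], rule inj_onI)
    fix S T assume "S \<in> ?B" "T \<in> ?B" "insert u S = insert u T"
    thus "S = T" using assms(2) by (metis (mono_tags) Diff_insert_absorb mem_Collect_eq subsetD)
  qed
  also have "\<dots> = (\<Sum>T\<in>?B. x u * g u * (cw x w T * (\<Prod>t\<in>T. g t * w u t)))"
  proof (rule sum.cong[OF refl])
    fix T assume T: "T \<in> ?B"
    hence "cw x w (insert u T) = x u * cw x w T * (\<Prod>t\<in>T. w u t)"
      using assms fin by (intro cw_insert) (auto intro: sym_nonneg_subset)
    moreover have "prod g (insert u T) = g u * prod g T"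
      using T assms(2) fin by (intro prod.insert) auto
    ultimately show "cw x w (insert u T) * prod g (insert u T)
        = x u * g u * (cw x w T * (\<Prod>t\<in>T. g t * w u t))"
      by (simp add: prod.distrib)
  qed
  also have "\<dots> = x u * g u * ws x w N k (\<lambda>t. g t * w u t)"
    by (simp add: ws_def sum_distrib_left)
  finally show ?thesis .
qed

text \<open>Two peelings. All later comparisons change the graph only around one pair, so they
  reduce to comparing these four terms.\<close>

lemma ws_pair:
  assumes "finite N" "u \<notin> N" "v \<notin> N" "u \<noteq> v" "sym_nonneg (insert u (insert v N)) w" "2 \<le> s"
  shows "ws x w (insert u (insert v N)) s (\<lambda>_. 1) = ws x w N s (\<lambda>_. 1)
      + x u * ws x w N (s - 1) (w u) + x v * ws x w N (s - 1) (w v)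
      + x u * x v * w u v * ws x w N (s - 2) (\<lambda>t. w u t * w v t)"
proof -
  obtain k where s: "s = Suc (Suc k)"
    using assms(6) by (cases s; cases "s - 1") auto
  have 1: "sym_nonneg (insert v N) w"
    using assms(5) by (rule sym_nonneg_subset) auto
  have "ws x w (insert u (insert v N)) s (\<lambda>_. 1)
      = ws x w (insert v N) (Suc (Suc k)) (\<lambda>_. 1) + x u * ws x w (insert v N) (Suc k) (w u)"
    unfolding s using assms by (subst ws_insert) auto
  also have "ws x w (insert v N) (Suc (Suc k)) (\<lambda>_. 1) = ws x w N s (\<lambda>_. 1) + x v * ws x w N (Suc k) (w v)"
    unfolding s using assms 1 by (subst ws_insert) auto
  also have "ws x w (insert v N) (Suc k) (w u) = ws x w N (Suc k) (w u) + x v * w u v * ws x w N k (\<lambda>t. w u t * w v t)"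
    using assms 1 by (subst ws_insert) auto
  finally show ?thesis by (simp add: s algebra_simps)
qed

lemma ws_image:
  assumes "inj_on f N"
  shows "ws x w (f ` N) k g = ws (\<lambda>a. x (f a)) (\<lambda>a b. w (f a) (f b)) N k (\<lambda>a. g (f a))"
proof -
  have inj: "inj_on f T" if "T \<subseteq> N" for T using assms that inj_on_subset by blast
  have set_eq: "{T. T \<subseteq> f ` N \<and> card T = k} = (\<lambda>T. f ` T) ` {T. T \<subseteq> N \<and> card T = k}"
  proof (intro equalityI subsetI)
    fix T assume T: "T \<in> {T. T \<subseteq> f ` N \<and> card T = k}"
    then obtain S where "S \<subseteq> N" "T = f ` S" by (auto simp: subset_image_iff)
    thus "T \<in> (\<lambda>T. f ` T) ` {T. T \<subseteq> N \<and> card T = k}"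
      using T card_image[OF inj] by auto
  qed (use card_image[OF inj] in auto)
  have injT: "inj_on (\<lambda>T. f ` T) {T. T \<subseteq> N \<and> card T = k}"
    using inj_on_image_eq_iff[OF assms] by (auto intro!: inj_onI)
  have cw: "cw x w (f ` T) = cw (\<lambda>a. x (f a)) (\<lambda>a b. w (f a) (f b)) T" if T: "T \<subseteq> N" for T
  proof -
    have "(\<Prod>b\<in>f ` T - {f a}. sqrt (w (f a) b)) = (\<Prod>b\<in>T - {a}. sqrt (w (f a) (f b)))"
      if "a \<in> T" for a
    proof -
      have "f ` T - {f a} = f ` (T - {a})"
        using inj_on_image_set_diff[OF inj[OF T], of T "{a}"] that by auto
      thus ?thesis using inj[OF T] by (simp add: prod.reindex inj_on_diff)
    qed
    thus ?thesis unfolding cw_def using inj[OF T] by (simp add: prod.reindex)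
  qed
  show ?thesis
    unfolding ws_def set_eq
    by (subst sum.reindex[OF injT]) (auto intro!: sum.cong simp: cw prod.reindex[OF inj])
qed

section \<open>From maps to vertex subsets\<close>

lemma card_inj_PiE:
  assumes "finite T"
  shows "card {\<sigma> \<in> {1..card T} \<rightarrow>\<^sub>E T. inj_on \<sigma> {1..card T}} = fact (card T)"
proof -
  let ?I = "{1..card T}"
  obtain h where h: "bij_betw h ?I T"
    using ex_bij_betw_nat_finite_1[OF assms] by blast
  have "bij_betw (\<lambda>p. \<lambda>i\<in>?I. h (p i)) {p. p permutes ?I} {\<sigma> \<in> ?I \<rightarrow>\<^sub>E T. inj_on \<sigma> ?I}"
    unfolding bij_betw_def
  proof (intro conjI)
    show "inj_on (\<lambda>p. \<lambda>i\<in>?I. h (p i)) {p. p permutes ?I}"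
    proof (rule inj_onI)
      fix p q assume p: "p \<in> {p. p permutes ?I}" and q: "q \<in> {p. p permutes ?I}"
        and eq: "(\<lambda>i\<in>?I. h (p i)) = (\<lambda>i\<in>?I. h (q i))"
      show "p = q"
      proof
        fix i show "p i = q i"
        proof (cases "i \<in> ?I")
          case True
          hence "h (p i) = h (q i)" using fun_cong[OF eq, of i] by simp
          moreover have "p i \<in> ?I" "q i \<in> ?I"
            using True p q by (simp_all only: mem_Collect_eq permutes_in_image)
          ultimately show ?thesis by (rule inj_onD[OF bij_betw_imp_inj_on[OF h]])
        next
          case False
          hence "p i = i" "q i = i"
            using p q by (auto simp only: mem_Collect_eq intro!: permutes_not_in[of _ ?I])
          thus ?thesis by simp
        qed
      qed
    qed
    show "(\<lambda>p. \<lambda>i\<in>?I. h (p i)) ` {p. p permutes ?I} = {\<sigma> \<in> ?I \<rightarrow>\<^sub>E T. inj_on \<sigma> ?I}"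
    proof (intro equalityI subsetI)
      fix \<sigma> assume "\<sigma> \<in> (\<lambda>p. \<lambda>i\<in>?I. h (p i)) ` {p. p permutes ?I}"
      then obtain p where p: "p permutes ?I" and \<sigma>: "\<sigma> = (\<lambda>i\<in>?I. h (p i))" by blast
      have "inj_on (h \<circ> p) ?I"
        by (rule comp_inj_on[OF permutes_inj_on[OF p]])
          (simp only: permutes_image[OF p] bij_betw_imp_inj_on[OF h])
      hence "inj_on \<sigma> ?I" unfolding \<sigma> inj_on_restrict_eq comp_def .
      moreover have "h (p i) \<in> T" if "i \<in> ?I" for i
        by (rule bij_betw_apply[OF h]) (simp only: permutes_in_image[OF p] that)
      ultimately show "\<sigma> \<in> {\<sigma> \<in> ?I \<rightarrow>\<^sub>E T. inj_on \<sigma> ?I}" unfolding \<sigma> by auto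
    next
      fix \<sigma> assume \<sigma>: "\<sigma> \<in> {\<sigma> \<in> ?I \<rightarrow>\<^sub>E T. inj_on \<sigma> ?I}"
      define p where "p i = (if i \<in> ?I then inv_into ?I h (\<sigma> i) else i)" for i
      have im: "\<sigma> i \<in> h ` ?I" if "i \<in> ?I" for i
        using that \<sigma> unfolding bij_betw_imp_surj_on[OF h] by blast
      have "inj_on p ?I"
      proof (rule inj_onI)
        fix i j assume ij: "i \<in> ?I" "j \<in> ?I" "p i = p j"
        hence "inv_into ?I h (\<sigma> i) = inv_into ?I h (\<sigma> j)" by (simp only: p_def if_True)
        hence "\<sigma> i = \<sigma> j" using im ij(1,2) by (rule_tac inv_into_injective)
        thus "i = j" using \<sigma> ij(1,2) unfolding inj_on_def by blast
      qed
      moreover have "p ` ?I \<subseteq> ?I"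
      proof
        fix j assume "j \<in> p ` ?I"
        then obtain i where "i \<in> ?I" "j = inv_into ?I h (\<sigma> i)" by (auto simp: p_def)
        thus "j \<in> ?I" using inv_into_into[OF im] by blast
      qed
      ultimately have "bij_betw p ?I ?I"
        using endo_inj_surj[of ?I p] unfolding bij_betw_def by simp
      hence "p permutes ?I" by (rule bij_imp_permutes) (unfold p_def, rule if_not_P)
      moreover have "\<sigma> = (\<lambda>i\<in>?I. h (p i))"
      proof
        fix i show "\<sigma> i = (\<lambda>i\<in>?I. h (p i)) i"
          using \<sigma> im[of i] by (cases "i \<in> ?I") (auto simp: p_def f_inv_into_f PiE_def extensional_def)
      qed
      ultimately show "\<sigma> \<in> (\<lambda>p. \<lambda>i\<in>?I. h (p i)) ` {p. p permutes ?I}" by blast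
    qed
  qed
  thus ?thesis
    using bij_betw_same_card card_permutations[of ?I "card T"] by fastforce
qed

text \<open>The zero diagonal kills every map that is not injective. The injective maps are grouped
  by their image; each \<open>s\<close>-set is the image of \<open>s!\<close> of them, all with the
  same value.\<close>

lemma K_density_eq_ws:
  fixes R :: "'a wgraph"
  assumes "weighted_graph R"
  shows "K_density s R = fact s * ws (vweight R) (eweight R) (verts R) s (\<lambda>_. 1)"
proof -
  let ?V = "verts R" and ?x = "vweight R" and ?w = "eweight R"
  let ?I = "{1..s}"
  let ?F = "\<lambda>\<sigma>. (\<Prod>i\<in>?I. ?x (\<sigma> i)) * (\<Prod>i\<in>?I. \<Prod>j\<in>{i<..s}. ?w (\<sigma> i) (\<sigma> j))"
  let ?Ks = "{T. T \<subseteq> ?V \<and> card T = s}"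
  let ?J = "\<lambda>T. {\<sigma> \<in> ?I \<rightarrow>\<^sub>E T. inj_on \<sigma> ?I}"
  have fin: "finite ?V" and nn: "\<And>a b. a \<in> ?V \<Longrightarrow> b \<in> ?V \<Longrightarrow> 0 \<le> ?w a b"
    and sym: "\<And>a b. a \<in> ?V \<Longrightarrow> b \<in> ?V \<Longrightarrow> ?w a b = ?w b a" and diag: "\<And>a. a \<in> ?V \<Longrightarrow> ?w a a = 0"
    using assms by (auto simp: weighted_graph_def)
  have finT: "finite T" if "T \<in> ?Ks" for T using that fin finite_subset by auto
  have zero: "?F \<sigma> = 0" if "\<sigma> \<in> ?I \<rightarrow>\<^sub>E ?V" "\<not> inj_on \<sigma> ?I" for \<sigma>
  proof -
    obtain i j where ij: "i \<in> ?I" "j \<in> ?I" "i < j" "\<sigma> i = \<sigma> j"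
    proof -
      obtain i j where "i \<in> ?I" "j \<in> ?I" "\<sigma> i = \<sigma> j" "i \<noteq> j"
        using \<open>\<not> inj_on \<sigma> ?I\<close> unfolding inj_on_def by blast
      thus ?thesis using that[of i j] that[of j i] by (metis linorder_neqE_nat)
    qed
    have "\<sigma> j \<in> ?V" using ij(2) \<open>\<sigma> \<in> ?I \<rightarrow>\<^sub>E ?V\<close> by (rule PiE_mem[rotated])
    hence "?w (\<sigma> i) (\<sigma> j) = 0" using diag ij(4) by simp
    hence "(\<Prod>j\<in>{i<..s}. ?w (\<sigma> i) (\<sigma> j)) = 0"
      using ij by (intro prod_zero[of _ "\<lambda>j. ?w (\<sigma> i) (\<sigma> j)"] bexI[of _ j]) auto
    hence "(\<Prod>i\<in>?I. \<Prod>j\<in>{i<..s}. ?w (\<sigma> i) (\<sigma> j)) = 0"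
      using ij(1) by (intro prod_zero[of ?I] bexI[of _ i]) simp_all
    thus ?thesis by simp
  qed
  have img: "\<sigma> ` ?I = T" if "T \<in> ?Ks" "\<sigma> \<in> ?J T" for T \<sigma>
  proof (rule card_subset_eq[OF finT[OF that(1)]])
    show "\<sigma> ` ?I \<subseteq> T" using that(2) by auto
    have "inj_on \<sigma> ?I" using that(2) by blast
    hence "card (\<sigma> ` ?I) = s" by (simp add: card_image)
    thus "card (\<sigma> ` ?I) = card T" using that(1) by simp
  qed
  have val: "?F \<sigma> = cw ?x ?w T" if T: "T \<in> ?Ks" and \<sigma>: "\<sigma> \<in> ?J T" for T \<sigma>
  proof -
    have inj: "inj_on \<sigma> ?I" and im: "\<sigma> ` ?I = T" and inV: "\<And>i. i \<in> ?I \<Longrightarrow> \<sigma> i \<in> ?V"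
      using img[OF T \<sigma>] \<sigma> T by blast+
    let ?r = "\<lambda>i j. sqrt (?w (\<sigma> i) (\<sigma> j))"
    have "(\<Prod>a\<in>T. \<Prod>b\<in>T - {a}. sqrt (?w a b)) = (\<Prod>i\<in>?I. \<Prod>b\<in>T - {\<sigma> i}. sqrt (?w (\<sigma> i) b))"
      unfolding im[symmetric] using inj by (simp add: prod.reindex)
    also have "\<dots> = (\<Prod>i\<in>?I. \<Prod>j\<in>?I - {i}. ?r i j)"
    proof (rule prod.cong[OF refl])
      fix i assume i: "i \<in> ?I"
      have "T - {\<sigma> i} = \<sigma> ` (?I - {i})"
        unfolding im[symmetric] using inj i by (subst inj_on_image_set_diff[OF inj]) auto
      thus "(\<Prod>b\<in>T - {\<sigma> i}. sqrt (?w (\<sigma> i) b)) = (\<Prod>j\<in>?I - {i}. ?r i j)"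
        using inj by (simp add: prod.reindex inj_on_diff)
    qed
    also have "\<dots> = (\<Prod>i\<in>?I. (\<Prod>j\<in>{i<..s}. ?r i j) * (\<Prod>j\<in>{1..<i}. ?r i j))"
    proof (rule prod.cong[OF refl])
      fix i assume "i \<in> ?I"
      hence eq: "?I - {i} = {i<..s} \<union> {1..<i}" by auto
      show "(\<Prod>j\<in>?I - {i}. ?r i j) = (\<Prod>j\<in>{i<..s}. ?r i j) * (\<Prod>j\<in>{1..<i}. ?r i j)"
        unfolding eq by (rule prod.union_disjoint) auto
    qed
    also have "\<dots> = (\<Prod>i\<in>?I. \<Prod>j\<in>{i<..s}. ?r i j) * (\<Prod>i\<in>?I. \<Prod>j\<in>{1..<i}. ?r i j)"
      by (rule prod.distrib)
    \<comment> \<open>Exchanging the order of the product reflects the pairs with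
      \<open>j < i\<close> onto those with \<open>i < j\<close>, where two square roots meet and
      give the edge weight.\<close>
    also have "(\<Prod>i\<in>?I. \<Prod>j\<in>{1..<i}. ?r i j) = (\<Prod>j\<in>?I. \<Prod>i\<in>{j<..s}. ?r i j)"
    proof -
      have e1: "{1..<i} = {j \<in> ?I. j < i}" if "i \<in> ?I" for i using that by auto
      have e2: "{j<..s} = {i \<in> ?I. j < i}" if "j \<in> ?I" for j using that by auto
      have "(\<Prod>i\<in>?I. \<Prod>j\<in>{1..<i}. ?r i j) = (\<Prod>i\<in>?I. \<Prod>j | j \<in> ?I \<and> j < i. ?r i j)"
        using e1 by (intro prod.cong refl) auto
      also have "\<dots> = (\<Prod>j\<in>?I. \<Prod>i | i \<in> ?I \<and> j < i. ?r i j)"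
        by (intro prod.swap_restrict) auto
      also have "\<dots> = (\<Prod>j\<in>?I. \<Prod>i\<in>{j<..s}. ?r i j)"
        using e2 by (intro prod.cong refl) auto
      finally show ?thesis .
    qed
    also have "(\<Prod>i\<in>?I. \<Prod>j\<in>{i<..s}. ?r i j) * (\<Prod>j\<in>?I. \<Prod>i\<in>{j<..s}. ?r i j)
        = (\<Prod>i\<in>?I. \<Prod>j\<in>{i<..s}. ?r i j * ?r j i)"
      by (simp only: prod.distrib)
    also have "\<dots> = (\<Prod>i\<in>?I. \<Prod>j\<in>{i<..s}. ?w (\<sigma> i) (\<sigma> j))"
    proof (intro prod.cong refl)
      fix i j assume "i \<in> ?I" "j \<in> {i<..s}"
      hence "\<sigma> i \<in> ?V" "\<sigma> j \<in> ?V" using inV by auto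
      thus "?r i j * ?r j i = ?w (\<sigma> i) (\<sigma> j)"
        using sym[of "\<sigma> i" "\<sigma> j"] nn[of "\<sigma> i" "\<sigma> j"] by simp
    qed
    finally have "(\<Prod>a\<in>T. \<Prod>b\<in>T - {a}. sqrt (?w a b)) = (\<Prod>i\<in>?I. \<Prod>j\<in>{i<..s}. ?w (\<sigma> i) (\<sigma> j))" .
    moreover have "(\<Prod>v\<in>T. ?x v) = (\<Prod>i\<in>?I. ?x (\<sigma> i))"
      unfolding im[symmetric] using inj by (simp add: prod.reindex)
    ultimately show ?thesis by (simp add: cw_def)
  qed
  have cardJ: "card (?J T) = fact s" if "T \<in> ?Ks" for T
    using card_inj_PiE[OF finT[OF that]] that by simp
  define J where "J T = ?J T" for T :: "'a set"
  define F where "F = ?F"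
  have J_V: "{\<sigma> \<in> ?I \<rightarrow>\<^sub>E ?V. inj_on \<sigma> ?I} = (\<Union>T\<in>?Ks. J T)"
  proof (intro equalityI subsetI)
    fix \<sigma> assume "\<sigma> \<in> {\<sigma> \<in> ?I \<rightarrow>\<^sub>E ?V. inj_on \<sigma> ?I}"
    hence "\<sigma> ` ?I \<in> ?Ks" "\<sigma> \<in> J (\<sigma> ` ?I)"
      using card_image[of \<sigma> ?I] by (auto simp: PiE_def extensional_def J_def)
    thus "\<sigma> \<in> (\<Union>T\<in>?Ks. J T)" by blast
  qed (auto simp: PiE_iff J_def)
  have finP: "finite (?I \<rightarrow>\<^sub>E ?V)" using fin by (intro finite_PiE) auto
  have finK: "finite ?Ks" by (rule finite_subset[of _ "Pow ?V"]) (use fin in auto)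
  have finJ: "finite (J T)" if "T \<in> ?Ks" for T
    by (rule finite_subset[of _ "?I \<rightarrow>\<^sub>E T"])
      (use finT[OF that] in \<open>auto simp: J_def intro!: finite_PiE\<close>)
  have disj: "J T \<inter> J T' = {}" if "T \<in> ?Ks" "T' \<in> ?Ks" "T \<noteq> T'" for T T'
    using img[OF that(1)] img[OF that(2)] that(3) unfolding J_def by blast
  have "K_density s R = sum F (?I \<rightarrow>\<^sub>E ?V)"
    by (simp add: K_density_def F_def)
  also have "\<dots> = sum F (\<Union>T\<in>?Ks. J T)"
    unfolding J_V[symmetric]
  proof (rule sum.mono_neutral_right[OF finP])
    show "\<forall>\<sigma>\<in>(?I \<rightarrow>\<^sub>E ?V) - {\<sigma> \<in> ?I \<rightarrow>\<^sub>E ?V. inj_on \<sigma> ?I}. F \<sigma> = 0"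
      unfolding F_def using zero by blast
  qed blast
  also have "\<dots> = (\<Sum>T\<in>?Ks. sum F (J T))"
    using finK finJ disj by (intro sum.UNION_disjoint) blast+
  also have "\<dots> = (\<Sum>T\<in>?Ks. fact s * cw ?x ?w T)"
  proof (rule sum.cong[OF refl])
    fix T assume T: "T \<in> ?Ks"
    have "sum F (J T) = (\<Sum>\<sigma>\<in>J T. cw ?x ?w T)"
      unfolding F_def J_def using val[OF T] by (rule sum.cong[OF refl])
    thus "sum F (J T) = fact s * cw ?x ?w T"
      by (simp only: J_def sum_constant cardJ[OF T] of_nat_fact)
  qed
  finally show ?thesis by (simp only: ws_def sum_distrib_left prod.neutral_const mult_1_right)
qed

section \<open>Weighted graphs\<close>

abbreviation G :: "'a set \<Rightarrow> ('a \<Rightarrow> real) \<Rightarrow> ('a \<Rightarrow> 'a \<Rightarrow> real) \<Rightarrow> 'a wgraph" where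
  "G V x w \<equiv> \<lparr>verts = V, vweight = x, eweight = w\<rparr>"

lemma weighted_graphI:
  assumes "finite V" "\<And>v. v \<in> V \<Longrightarrow> 0 \<le> x v" "sum x V = 1"
    and "\<And>a b. a \<in> V \<Longrightarrow> b \<in> V \<Longrightarrow> a \<noteq> b \<Longrightarrow> 0 \<le> w a b \<and> w a b \<le> 1 \<and> w a b = w b a"
    and "\<And>a. a \<in> V \<Longrightarrow> w a a = 0"
  shows "weighted_graph (G V x w)"
proof -
  have x1: "x v \<le> 1" if "v \<in> V" for v
    using member_le_sum[of v V x] that assms(1,2,3) by auto
  have w: "0 \<le> w a b \<and> w a b \<le> 1 \<and> w a b = w b a" if "a \<in> V" "b \<in> V" for a b
    by (cases "a = b") (use that assms(4,5) in auto)
  show ?thesis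
    unfolding weighted_graph_def wgraph.simps
  proof (intro conjI ballI)
    fix a b assume "a \<in> V" "b \<in> V"
    from w[OF this] show "0 \<le> w a b" "w a b \<le> 1" "w a b = w b a" by blast+
  qed (use assms(1,2,3,5) x1 in auto)
qed

lemma
  assumes "weighted_graph (G V x w)"
  shows weighted_graph_finite: "finite V"
    and weighted_graph_nonneg: "v \<in> V \<Longrightarrow> 0 \<le> x v"
    and weighted_graph_sum: "sum x V = 1"
    and weighted_graph_sym_nonneg: "sym_nonneg V w"
    and weighted_graph_sym: "a \<in> V \<Longrightarrow> b \<in> V \<Longrightarrow> w a b = w b a"
    and weighted_graph_edge_nonneg: "a \<in> V \<Longrightarrow> b \<in> V \<Longrightarrow> 0 \<le> w a b"
    and weighted_graph_edge_le: "a \<in> V \<Longrightarrow> b \<in> V \<Longrightarrow> w a b \<le> 1"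
    and weighted_graph_diag: "a \<in> V \<Longrightarrow> w a a = 0"
  using assms unfolding weighted_graph_def wgraph.simps sym_nonneg_def by blast+

lemma weighted_graph_subset:
  assumes "weighted_graph (G V x w)" "W \<subseteq> V" "\<And>v. v \<in> W \<Longrightarrow> 0 \<le> y v" "sum y W = 1"
  shows "weighted_graph (G W y w)"
proof (rule weighted_graphI)
  show "finite W" using assms weighted_graph_finite finite_subset by blast
next
  fix a b assume "a \<in> W" "b \<in> W"
  hence "a \<in> V" "b \<in> V" using assms(2) by auto
  thus "0 \<le> w a b \<and> w a b \<le> 1 \<and> w a b = w b a"
    using weighted_graph_sym[OF assms(1)] weighted_graph_edge_nonneg[OF assms(1)]
      weighted_graph_edge_le[OF assms(1)] by blast
next
  fix a assume "a \<in> W"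
  thus "w a a = 0" using weighted_graph_diag[OF assms(1)] assms(2) by blast
qed (use assms in auto)

lemma K_density_ws:
  assumes "weighted_graph (G V x w)"
  shows "K_density s (G V x w) = fact s * ws x w V s (\<lambda>_. 1)"
  using K_density_eq_ws[OF assms] by simp

lemma ws_insert1:
  assumes "finite N" "u \<notin> N" "sym_nonneg (insert u N) w" "1 \<le> s"
  shows "ws x w (insert u N) s (\<lambda>_. 1) = ws x w N s (\<lambda>_. 1) + x u * ws x w N (s - 1) (w u)"
  using ws_insert[OF assms(1-3), of x "s - 1" "\<lambda>_. 1"] assms(4) by simp

lemma clique_above_subset:
  "clique_above R \<alpha> S \<Longrightarrow> T \<subseteq> S \<Longrightarrow> clique_above R \<alpha> T"
  by (auto simp: clique_above_def)

lemma clique_above_G: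
  "clique_above (G V x w) \<alpha> S \<longleftrightarrow> S \<subseteq> V \<and> (\<forall>a\<in>S. \<forall>b\<in>S. a \<noteq> b \<longrightarrow> \<alpha> < w a b)"
  by (auto simp: clique_above_def adj_above_def)

section \<open>Freeness as a bound on vertices plus clique size\<close>

lemma K_freeI:
  assumes "finite (verts R)"
    and "\<And>S. clique_above R (1/2) S \<Longrightarrow> S \<noteq> {} \<Longrightarrow> card (verts R) + card S < t"
  shows "K_free t R"
  unfolding K_free_def
proof (intro notI, elim exE conjE)
  fix S1 S2 assume S: "S1 \<subseteq> verts R" "1 \<le> card S2" "card S1 + card S2 = t" "clique_above R (1/2) S2"
  have "card S1 \<le> card (verts R)" using S(1) assms(1) by (rule card_mono[rotated])
  moreover have "S2 \<noteq> {}" using S(2) by auto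
  hence "card (verts R) + card S2 < t" using assms(2) S(4) by blast
  ultimately show False using S(3) by linarith
qed

lemma K_freeD:
  assumes "K_free t R" "S2 \<subseteq> S1" "S1 \<subseteq> verts R" "1 \<le> card S1" "1 \<le> card S2"
    "card S1 + card S2 = t" "clique_above R 0 S1" "clique_above R (1/2) S2"
  shows False
  using assms(1) unfolding K_free_def
  by (rule notE) (rule exI[of _ S1], rule exI[of _ S2], intro conjI assms(2-8))

text \<open>A pair of total size at least \<open>t\<close> could be shrunk to total size exactly
  \<open>t\<close>: either one vertex of \<open>S\<close> is paired with \<open>t - 1\<close>
  vertices, or all vertices are kept and \<open>S\<close> is shrunk. Together with
  \<open>K_freeI\<close> this makes freeness a numerical condition.\<close>

lemma K_free_clique_bound:
  assumes "finite (verts R)" "clique_above R 0 (verts R)" "K_free t R" "2 \<le> t"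
    and "clique_above R (1/2) S" "S \<noteq> {}"
  shows "card (verts R) + card S < t"
proof (rule ccontr)
  assume "\<not> ?thesis"
  hence ge: "t \<le> card (verts R) + card S" by simp
  have SV: "S \<subseteq> verts R" using assms(5) by (simp add: clique_above_def)
  have cl0: "clique_above R 0 T" if "T \<subseteq> verts R" for T
    using clique_above_subset[OF assms(2) that] .
  have no: False if "S2 \<subseteq> S1" "S1 \<subseteq> verts R" "card S1 \<ge> 1" "card S2 \<ge> 1"
    "card S1 + card S2 = t" "S2 \<subseteq> S" for S1 S2
    using K_freeD[OF assms(3) that(1-5) cl0[OF that(2)] clique_above_subset[OF assms(5) that(6)]] .
  show False
  proof (cases "t \<le> card (verts R) + 1")
    case True
    obtain a where a: "a \<in> S" using assms(6) by blast
    have "t - 2 \<le> card (verts R - {a})"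
      using True a SV assms(1) by (simp add: card_Diff_singleton_if subset_iff)
    then obtain T where T: "T \<subseteq> verts R - {a}" "card T = t - 2" "finite T"
      using obtain_subset_with_card_n by metis
    have "card (insert a T) = t - 1"
      using T assms(4) by (subst card_insert_disjoint) auto
    moreover have "insert a T \<subseteq> verts R" using T(1) a SV by blast
    moreover have "1 \<le> t - 1" using assms(4) by simp
    ultimately show False using no[of "{a}" "insert a T"] a assms(4) by simp
  next
    case False
    then obtain S2 where "S2 \<subseteq> S" "card S2 = t - card (verts R)"
      using ge obtain_subset_with_card_n[of "t - card (verts R)" S] by (metis le_diff_conv add.commute)
    moreover have "1 \<le> card (verts R)"
      using assms(1,6) SV by (simp add: Suc_le_eq card_gt_0_iff) blast
    ultimately show False using no[of S2 "verts R"] SV False by auto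
  qed
qed

lemma K_free_subset:
  assumes "K_free t (G V x w)" "W \<subseteq> V"
  shows "K_free t (G W y w)"
  unfolding K_free_def wgraph.simps
proof (intro notI, elim exE conjE)
  fix S1 S2 assume S: "S2 \<subseteq> S1" "S1 \<subseteq> W" "1 \<le> card S1" "1 \<le> card S2" "card S1 + card S2 = t"
    "clique_above (G W y w) 0 S1" "clique_above (G W y w) (1/2) S2"
  have "S1 \<subseteq> V" using S(2) assms(2) by (rule order_trans)
  moreover have "clique_above (G V x w) 0 S1" "clique_above (G V x w) (1/2) S2"
    using S(6,7) assms(2) by (auto simp: clique_above_G)
  ultimately show False
    using K_freeD[OF assms(1) S(1) _ S(3-5)] by simp
qed

section \<open>Blow-ups of vertices\<close>

text \<open>The map \<open>f\<close> sends a new vertex to the one it copies. The value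
  \<open>1/2\<close> is the largest that creates no edge above \<open>1/2\<close>. One form covers
  both cloning inside \<open>V\<close> and splitting a vertex.\<close>

definition blow :: "('b \<Rightarrow> 'a) \<Rightarrow> ('a \<Rightarrow> 'a \<Rightarrow> real) \<Rightarrow> 'b \<Rightarrow> 'b \<Rightarrow> real" where
  "blow f w a b = (if a = b then 0 else if f a = f b then 1/2 else w (f a) (f b))"

lemma weighted_graph_blow:
  assumes "weighted_graph (G V x w)" "finite V'" "f ` V' \<subseteq> V"
    and "\<And>v. v \<in> V' \<Longrightarrow> 0 \<le> x' v" "sum x' V' = 1"
  shows "weighted_graph (G V' x' (blow f w))"
proof (rule weighted_graphI)
  fix a b assume ab: "a \<in> V'" "b \<in> V'"
  hence "f a \<in> V" "f b \<in> V" using assms(3) by auto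
  hence "0 \<le> w (f a) (f b)" "w (f a) (f b) \<le> 1" "w (f a) (f b) = w (f b) (f a)"
    using weighted_graph_sym[OF assms(1)] weighted_graph_edge_nonneg[OF assms(1)]
      weighted_graph_edge_le[OF assms(1)] by blast+
  thus "0 \<le> blow f w a b \<and> blow f w a b \<le> 1 \<and> blow f w a b = blow f w b a"
    unfolding blow_def by (simp only: if_splits) auto
qed (use assms in \<open>auto simp: blow_def\<close>)

text \<open>A clique above \<open>1/2\<close> contains at most one copy of each vertex, so
  \<open>f\<close> maps it injectively onto a clique of the original graph.\<close>

lemma K_free_blow:
  assumes "finite V'" "f ` V' \<subseteq> V"
    and "\<And>S. clique_above (G V x w) (1/2) S \<Longrightarrow> S \<noteq> {} \<Longrightarrow> card V' + card S < t"
  shows "K_free t (G V' x' (blow f w))"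
proof (rule K_freeI; unfold wgraph.simps)
  fix S assume S: "clique_above (G V' x' (blow f w)) (1/2) S" "S \<noteq> {}"
  have gt: "1/2 < blow f w a b" if "a \<in> S" "b \<in> S" "a \<noteq> b" for a b
    using S(1) that unfolding clique_above_G by blast
  have ne: "f a \<noteq> f b \<and> 1/2 < w (f a) (f b)" if "a \<in> S" "b \<in> S" "a \<noteq> b" for a b
    using gt[OF that] that(3) unfolding blow_def by (auto split: if_splits)
  have inj: "inj_on f S" by (rule inj_onI) (use ne in blast)
  have "f ` S \<subseteq> V" using S(1) assms(2) unfolding clique_above_G by blast
  hence "clique_above (G V x w) (1/2) (f ` S)"
    unfolding clique_above_G using ne by blast
  hence "card V' + card (f ` S) < t" using assms(3) S(2) by blast
  thus "card V' + card S < t" by (simp add: card_image[OF inj])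
qed (rule assms)

section \<open>Change of vertex type\<close>

lemma weighted_graph_pullback:
  assumes "weighted_graph (G (f ` V) x w)" "inj_on f V" "finite V"
  shows "weighted_graph (G V (\<lambda>a. x (f a)) (\<lambda>a b. w (f a) (f b)))"
proof (rule weighted_graphI)
  show "(\<Sum>a\<in>V. x (f a)) = 1"
    using weighted_graph_sum[OF assms(1)] by (simp add: sum.reindex[OF assms(2)])
  show "0 \<le> x (f v)" if "v \<in> V" for v
    by (rule weighted_graph_nonneg[OF assms(1)]) (rule imageI[OF that])
  show "w (f v) (f v) = 0" if "v \<in> V" for v
    by (rule weighted_graph_diag[OF assms(1)]) (rule imageI[OF that])
  fix a b assume "a \<in> V" "b \<in> V"
  hence "f a \<in> f ` V" "f b \<in> f ` V" by auto
  thus "0 \<le> w (f a) (f b) \<and> w (f a) (f b) \<le> 1 \<and> w (f a) (f b) = w (f b) (f a)"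
    using weighted_graph_sym[OF assms(1)] weighted_graph_edge_nonneg[OF assms(1)]
      weighted_graph_edge_le[OF assms(1)] by blast
qed (rule assms)

lemma K_free_pullback:
  assumes "K_free t (G (f ` V) x w)" "inj_on f V"
  shows "K_free t (G V y (\<lambda>a b. w (f a) (f b)))"
  unfolding K_free_def wgraph.simps
proof (intro notI, elim exE conjE)
  let ?H = "G V y (\<lambda>a b. w (f a) (f b))"
  fix S1 S2 assume S: "S2 \<subseteq> S1" "S1 \<subseteq> V" "1 \<le> card S1" "1 \<le> card S2" "card S1 + card S2 = t"
    "clique_above ?H 0 S1" "clique_above ?H (1/2) S2"
  have inj: "inj_on f S1" "inj_on f S2"
    using S(1,2) by (blast intro: inj_on_subset[OF assms(2)])+
  have "clique_above (G (f ` V) x w) 0 (f ` S1)" "clique_above (G (f ` V) x w) (1/2) (f ` S2)"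
    using S(6,7) by (auto simp: clique_above_G)
  moreover have "card (f ` S1) = card S1" "card (f ` S2) = card S2"
    using inj by (simp_all add: card_image)
  moreover have "f ` S2 \<subseteq> f ` S1" "f ` S1 \<subseteq> f ` V" using S by blast+
  ultimately show False
    using K_freeD[OF assms(1), of "f ` S2" "f ` S1"] S(3-5) by simp
qed

lemma K_density_pullback:
  assumes "weighted_graph (G (f ` V) x w)" "inj_on f V" "finite V"
  shows "K_density s (G V (\<lambda>a. x (f a)) (\<lambda>a b. w (f a) (f b))) = K_density s (G (f ` V) x w)"
  using K_density_ws[OF assms(1)] K_density_ws[OF weighted_graph_pullback[OF assms]]
  by (simp add: ws_image[OF assms(2)])

text \<open>\<open>pi_K\<close> ranges over graphs on natural numbers, whereas the comparison graphs
  live on \<open>'a\<close> or \<open>'a option\<close>; such a copy lets them compete.\<close>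

lemma ex_nat_copy:
  fixes R :: "'a wgraph"
  assumes "weighted_graph R" "K_free t R"
  obtains R' :: "nat wgraph" where "verts R' = {..<card (verts R)}" "weighted_graph R'" "K_free t R'"
    "K_density s R' = K_density s R"
proof -
  obtain V x w where R: "R = G V x w" by (cases R) auto
  have fin: "finite V" using assms(1) weighted_graph_finite unfolding R by blast
  obtain f where "bij_betw f {0..<card V} V" using ex_bij_betw_nat_finite[OF fin] by blast
  hence inj: "inj_on f {..<card V}" and im: "V = f ` {..<card V}"
    by (auto simp: bij_betw_def atLeast0LessThan)
  let ?R = "G {..<card V} (\<lambda>a. x (f a)) (\<lambda>a b. w (f a) (f b))"
  have wg: "weighted_graph (G (f ` {..<card V}) x w)" and kf: "K_free t (G (f ` {..<card V}) x w)"
    using assms im unfolding R by simp_all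
  show ?thesis
  proof (rule that[of ?R])
    show "weighted_graph ?R" using weighted_graph_pullback[OF wg inj] by simp
    show "K_free t ?R" using K_free_pullback[OF kf inj] .
    show "K_density s ?R = K_density s R"
      using K_density_pullback[OF wg inj] im unfolding R by simp
  qed (simp add: R)
qed

lemma K_density_le_pi_K:
  assumes "weighted_graph R" "K_free t R"
  shows "K_density s R \<le> pi_K s t"
proof -
  obtain R' :: "nat wgraph" where R': "verts R' = {..<card (verts R)}" "weighted_graph R'"
      "K_free t R'" "K_density s R' = K_density s R"
    by (rule ex_nat_copy[OF assms, of s])
  have "K_density s R' \<le> pi_K s t"
    unfolding pi_K_def using R' by (intro cSup_upper K_densities_bdd_above) blast
  thus ?thesis using R' by simp
qed

lemma ex_nat_extremal:
  assumes "extremal s t R"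
  obtains R' :: "nat wgraph" where "extremal s t R'" "card (verts R') = card (verts R)"
proof -
  have R: "weighted_graph R" "K_free t R" "K_density s R = pi_K s t"
    using assms by (auto simp: extremal_def)
  obtain R' :: "nat wgraph" where "verts R' = {..<card (verts R)}" "weighted_graph R'" "K_free t R'"
    "K_density s R' = K_density s R"
    by (rule ex_nat_copy[OF R(1,2), of s])
  thus ?thesis using that[of R'] R(3) by (simp add: extremal_def)
qed

section \<open>Existence of extremal graphs\<close>

lemma graph_cong:
  assumes "weighted_graph (G V x w)" "\<And>a. a \<in> V \<Longrightarrow> x a = x' a"
    and "\<And>a b. a \<in> V \<Longrightarrow> b \<in> V \<Longrightarrow> w a b = w' a b"
  shows "weighted_graph (G V x' w')"
    and "K_density s (G V x' w') = K_density s (G V x w)"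
    and "K_free t (G V x w) \<Longrightarrow> K_free t (G V x' w')"
proof -
  show wg': "weighted_graph (G V x' w')"
  proof (rule weighted_graphI)
    show "sum x' V = 1"
      using weighted_graph_sum[OF assms(1)] sum.cong[OF refl assms(2), of V] by simp
    fix a b assume "a \<in> V" "b \<in> V"
    thus "0 \<le> w' a b \<and> w' a b \<le> 1 \<and> w' a b = w' b a"
      using weighted_graph_sym[OF assms(1)] weighted_graph_edge_nonneg[OF assms(1)]
        weighted_graph_edge_le[OF assms(1)] assms(3)[of a b] assms(3)[of b a] by metis
  next
    fix a assume a: "a \<in> V"
    show "0 \<le> x' a" using weighted_graph_nonneg[OF assms(1) a] assms(2)[OF a] by simp
    show "w' a a = 0" using weighted_graph_diag[OF assms(1) a] assms(3)[OF a a] by simp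
  qed (rule weighted_graph_finite[OF assms(1)])
  have "ws x' w' V s (\<lambda>_. 1) = ws x w V s (\<lambda>_. 1)"
    using assms(2,3) by (intro ws_cong) auto
  thus "K_density s (G V x' w') = K_density s (G V x w)"
    using K_density_ws[OF assms(1)] K_density_ws[OF wg'] by simp
  assume kf: "K_free t (G V x w)"
  have cl: "clique_above (G V x w) \<alpha> S" if "clique_above (G V x' w') \<alpha> S" for \<alpha> S
    unfolding clique_above_G
  proof (intro conjI ballI impI)
    show SV: "S \<subseteq> V" using that by (simp add: clique_above_G)
    fix a b assume ab: "a \<in> S" "b \<in> S" "a \<noteq> b"
    have "\<alpha> < w' a b" using that ab by (simp add: clique_above_G)
    thus "\<alpha> < w a b" using assms(3) SV ab by (metis subsetD)
  qed
  show "K_free t (G V x' w')"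
    unfolding K_free_def wgraph.simps
  proof (intro notI, elim exE conjE)
    fix S1 S2 assume S: "S2 \<subseteq> S1" "S1 \<subseteq> V" "1 \<le> card S1" "1 \<le> card S2" "card S1 + card S2 = t"
      "clique_above (G V x' w') 0 S1" "clique_above (G V x' w') (1/2) S2"
    show False using K_freeD[OF kf S(1) _ S(3-5) cl[OF S(6)] cl[OF S(7)]] S(2) by simp
  qed
qed

lemma K_density_single:
  assumes "weighted_graph (G V x w)" "u \<in> V" "1 \<le> s"
  shows "K_density s (G V x w) = fact s * (ws x w (V - {u}) s (\<lambda>_. 1)
      + x u * ws x w (V - {u}) (s - 1) (w u))"
proof -
  have V: "insert u (V - {u}) = V" using assms(2) by blast
  have "finite (V - {u})" using weighted_graph_finite[OF assms(1)] by simp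
  moreover have "sym_nonneg (insert u (V - {u})) w"
    unfolding V by (rule weighted_graph_sym_nonneg[OF assms(1)])
  ultimately show ?thesis
    using ws_insert1[of "V - {u}" u w s x] assms(3) unfolding V K_density_ws[OF assms(1)] by simp
qed

lemma K_density_pair:
  assumes "weighted_graph (G V x w)" "u \<in> V" "v \<in> V" "u \<noteq> v" "2 \<le> s"
  shows "K_density s (G V x w) = fact s * (ws x w (V - {u, v}) s (\<lambda>_. 1)
      + x u * ws x w (V - {u, v}) (s - 1) (w u) + x v * ws x w (V - {u, v}) (s - 1) (w v)
      + x u * x v * w u v * ws x w (V - {u, v}) (s - 2) (\<lambda>t. w u t * w v t))"
proof -
  have V: "insert u (insert v (V - {u, v})) = V" using assms(2,3) by blast
  have "finite (V - {u, v})" using weighted_graph_finite[OF assms(1)] by simp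
  moreover have "sym_nonneg (insert u (insert v (V - {u, v}))) w"
    unfolding V by (rule weighted_graph_sym_nonneg[OF assms(1)])
  ultimately show ?thesis
    using ws_pair[of "V - {u, v}" u v w s x] assms(4,5) unfolding V K_density_ws[OF assms(1)] by simp
qed

text \<open>With \<open>w u v = 0\<close> the bilinear term vanishes, so moving all of
  \<open>x v\<close> to \<open>u\<close>, which has the larger coefficient, loses nothing.\<close>

lemma delete_zero_edge_aux:
  assumes wg: "weighted_graph (G V x w)" and uv: "u \<in> V" "v \<in> V" "u \<noteq> v" and "w u v = 0" "2 \<le> s"
    and le: "ws x w (V - {u, v}) (s - 1) (w v) \<le> ws x w (V - {u, v}) (s - 1) (w u)"
  shows "\<exists>W y. W \<subset> V \<and> weighted_graph (G W y w) \<and> K_density s (G V x w) \<le> K_density s (G W y w)"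
proof (intro exI conjI)
  let ?W = "V - {v}" and ?y = "x(u := x u + x v)" and ?N = "V - {u, v}"
  have N: "?W - {u} = ?N" by blast
  have fin: "finite V" by (rule weighted_graph_finite[OF wg])
  show "?W \<subset> V" using uv by blast
  have "sum x V = x v + (x u + sum x ?N)"
    using fin uv by (simp add: sum.remove[of V v] sum.remove[of "V - {v}" u] Diff_insert2[symmetric] insert_commute)
  moreover have "sum ?y ?W = ?y u + sum ?y ?N"
    using fin uv unfolding N[symmetric] by (intro sum.remove) auto
  moreover have "sum ?y ?N = sum x ?N" by (intro sum.cong) auto
  ultimately have sum1: "sum ?y ?W = 1"
    using weighted_graph_sum[OF wg] by simp
  show wg': "weighted_graph (G ?W ?y w)"
  proof (rule weighted_graph_subset[OF wg _ _ sum1])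
    show "0 \<le> ?y a" if "a \<in> ?W" for a
      using that weighted_graph_nonneg[OF wg] uv by (auto intro: add_nonneg_nonneg)
  qed blast
  have "u \<in> ?W" using uv by blast
  moreover have "ws ?y w ?N k g = ws x w ?N k g" for k g
    by (intro ws_cong) auto
  ultimately have "K_density s (G ?W ?y w)
      = fact s * (ws x w ?N s (\<lambda>_. 1) + (x u + x v) * ws x w ?N (s - 1) (w u))"
    using K_density_single[OF wg', of u s] assms(6) unfolding N by simp
  moreover have "x v * ws x w ?N (s - 1) (w v) \<le> x v * ws x w ?N (s - 1) (w u)"
    using le weighted_graph_nonneg[OF wg uv(2)] by (rule mult_left_mono)
  ultimately show "K_density s (G V x w) \<le> K_density s (G ?W ?y w)"
    unfolding K_density_pair[OF wg uv assms(6)] assms(5) by (simp add: algebra_simps)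
qed

lemma delete_zero_edge:
  assumes wg: "weighted_graph (G V x w)" and uv: "u \<in> V" "v \<in> V" "u \<noteq> v" and "w u v = 0" "2 \<le> s"
  shows "\<exists>W y. W \<subset> V \<and> weighted_graph (G W y w) \<and> K_density s (G V x w) \<le> K_density s (G W y w)"
proof -
  have vu: "w v u = 0" using weighted_graph_sym[OF wg uv(1,2)] assms(5) by simp
  have N: "V - {v, u} = V - {u, v}" by blast
  show ?thesis
    using delete_zero_edge_aux[OF wg uv assms(5,6)]
      delete_zero_edge_aux[OF wg uv(2,1) uv(3)[symmetric] vu assms(6), unfolded N] linear by blast
qed

text \<open>Deletion stops when every pair has positive weight; then a single vertex, as a clique
  above \<open>1/2\<close>, makes the clique bound give \<open>card V + 1 < t\<close>.\<close>

lemma reduce_to_small: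
  assumes "weighted_graph (G V x w)" "K_free t (G V x w)" "2 \<le> s" "2 \<le> t"
  shows "\<exists>W y. weighted_graph (G W y w) \<and> K_free t (G W y w) \<and>
    K_density s (G V x w) \<le> K_density s (G W y w) \<and> card W \<le> t - 2"
  using weighted_graph_finite[OF assms(1)] assms(1,2)
proof (induction V arbitrary: x rule: finite_psubset_induct)
  case (psubset V)
  note wg = psubset.prems(1) and kf = psubset.prems(2)
  show ?case
  proof (cases "\<exists>u\<in>V. \<exists>v\<in>V. u \<noteq> v \<and> w u v = 0")
    case True
    then obtain u v where uv: "u \<in> V" "v \<in> V" "u \<noteq> v" "w u v = 0" by blast
    obtain W y where W: "W \<subset> V" "weighted_graph (G W y w)"
      "K_density s (G V x w) \<le> K_density s (G W y w)"
      using delete_zero_edge[OF wg uv assms(3)] by blast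
    have "K_free t (G W y w)" using K_free_subset[OF kf] W(1) by blast
    from psubset.IH[OF W(1,2) this] W(3) show ?thesis by (meson order_trans)
  next
    case False
    have "clique_above (G V x w) 0 (verts (G V x w))"
      using False weighted_graph_edge_nonneg[OF wg] by (force simp: clique_above_G)
    moreover obtain a where "a \<in> V"
      using weighted_graph_sum[OF wg] by (metis sum.empty zero_neq_one all_not_in_conv)
    hence "clique_above (G V x w) (1/2) {a}" by (simp add: clique_above_G)
    ultimately have "card V + card {a} < t"
      using K_free_clique_bound[OF _ _ kf assms(4), of "{a}"] psubset.hyps by simp
    thus ?thesis using wg kf by (intro exI[of _ V] exI[of _ x]) auto
  qed
qed

text \<open>With vertex weights on the diagonal and edge weights off it, a graph becomes a point of
  a cube, which is compact by Tychonoff's theorem.\<close>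

definition code_graph :: "nat \<Rightarrow> (nat \<times> nat \<Rightarrow> real) \<Rightarrow> nat wgraph" where
  "code_graph n g = G {..<n} (\<lambda>i. g (i, i)) (\<lambda>i j. if i = j then 0 else g (i, j))"

definition codes :: "nat \<Rightarrow> nat \<Rightarrow> (nat \<times> nat \<Rightarrow> real) set" where
  "codes t n = {g. (\<forall>p. g p \<in> {0..1}) \<and> weighted_graph (code_graph n g) \<and> K_free t (code_graph n g)}"

lemma compact_unit_functions: "compact {g :: 'i \<Rightarrow> real. \<forall>p. g p \<in> {0..1}}"
proof -
  have "{g :: 'i \<Rightarrow> real. \<forall>p. g p \<in> {0..1}} = PiE UNIV (\<lambda>_. {0..1})" by auto
  moreover have "compactin (product_topology (\<lambda>_ :: 'i. euclideanreal) UNIV) (PiE UNIV (\<lambda>_. {0..1}))"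
    by (subst compactin_PiE) simp
  ultimately show ?thesis by (simp add: euclidean_product_topology)
qed

lemma open_clique:
  assumes "finite S"
  shows "open {g :: nat \<times> nat \<Rightarrow> real. \<forall>a\<in>S. \<forall>b\<in>S. a \<noteq> b \<longrightarrow> \<alpha> < g (a, b)}"
proof -
  have eq: "{g :: nat \<times> nat \<Rightarrow> real. \<forall>a\<in>S. \<forall>b\<in>S. a \<noteq> b \<longrightarrow> \<alpha> < g (a, b)}
      = (\<Inter>p\<in>{p \<in> S \<times> S. fst p \<noteq> snd p}. {g. \<alpha> < g p})" by auto
  show ?thesis unfolding eq using assms
    by (intro open_INT ballI open_Collect_less continuous_intros) auto
qed

text \<open>Freeness survives limits: each forbidden pair of cliques is described by finitely many
  strict inequalities, an open condition. The other conditions are equations between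
  coordinates.\<close>

lemma compact_codes: "compact (codes t n)"
proof -
  let ?sym = "\<lambda>p. {g :: nat \<times> nat \<Rightarrow> real. g p = g (snd p, fst p)}"
  let ?sum = "{g :: nat \<times> nat \<Rightarrow> real. (\<Sum>i<n. g (i, i)) = 1}"
  let ?cl = "\<lambda>\<alpha> S. {g :: nat \<times> nat \<Rightarrow> real. \<forall>a\<in>S. \<forall>b\<in>S. a \<noteq> b \<longrightarrow> \<alpha> < g (a, b)}"
  let ?bad = "{(S1, S2). S2 \<subseteq> S1 \<and> S1 \<subseteq> {..<n} \<and> 1 \<le> card S1 \<and> 1 \<le> card S2 \<and> card S1 + card S2 = t}"
  have wg: "weighted_graph (code_graph n g) \<longleftrightarrow> g \<in> ?sum \<inter> (\<Inter>p\<in>{..<n} \<times> {..<n}. ?sym p)"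
    if g01: "\<forall>p. g p \<in> {0..1}" for g
  proof
    assume wg: "weighted_graph (code_graph n g)"
    have "g (a, b) = g (b, a)" if "a < n" "b < n" for a b
      using weighted_graph_sym[OF wg[unfolded code_graph_def], of a b] that by (cases "a = b") auto
    moreover have "(\<Sum>i<n. g (i, i)) = 1"
      using weighted_graph_sum[OF wg[unfolded code_graph_def]] by simp
    ultimately show "g \<in> ?sum \<inter> (\<Inter>p\<in>{..<n} \<times> {..<n}. ?sym p)" by auto
  next
    assume g: "g \<in> ?sum \<inter> (\<Inter>p\<in>{..<n} \<times> {..<n}. ?sym p)"
    have sym: "g (a, b) = g (b, a)" if "a < n" "b < n" for a b
      using g that by auto
    have g01': "0 \<le> g p \<and> g p \<le> 1" for p using g01[rule_format, of p] by simp
    show "weighted_graph (code_graph n g)"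
      unfolding code_graph_def
    proof (rule weighted_graphI)
      fix a b assume "a \<in> {..<n}" "b \<in> {..<n}" "a \<noteq> b"
      thus "0 \<le> (if a = b then 0 else g (a, b)) \<and> (if a = b then 0 else g (a, b)) \<le> 1
          \<and> (if a = b then 0 else g (a, b)) = (if b = a then 0 else g (b, a))"
        using sym[of a b] g01' by simp
    qed (use g g01' in auto)
  qed
  have kf: "K_free t (code_graph n g) \<longleftrightarrow> g \<in> (\<Inter>(S1, S2)\<in>?bad. - (?cl 0 S1 \<inter> ?cl (1/2) S2))" for g
  proof -
    have cl: "clique_above (code_graph n g) \<alpha> S \<longleftrightarrow> S \<subseteq> {..<n} \<and> g \<in> ?cl \<alpha> S" for \<alpha> S
      by (auto simp: code_graph_def clique_above_G)
    have "K_free t (code_graph n g) \<longleftrightarrow> (\<forall>S1 S2. (S1, S2) \<in> ?bad \<longrightarrow> \<not> (g \<in> ?cl 0 S1 \<and> g \<in> ?cl (1/2) S2))"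
    proof
      assume kf: "K_free t (code_graph n g)"
      show "\<forall>S1 S2. (S1, S2) \<in> ?bad \<longrightarrow> \<not> (g \<in> ?cl 0 S1 \<and> g \<in> ?cl (1/2) S2)"
      proof (intro allI impI notI, elim conjE)
        fix S1 S2 assume b: "(S1, S2) \<in> ?bad" and g: "g \<in> ?cl 0 S1" "g \<in> ?cl (1/2) S2"
        have S: "S2 \<subseteq> S1" "S1 \<subseteq> {..<n}" "S2 \<subseteq> {..<n}" "1 \<le> card S1" "1 \<le> card S2" "card S1 + card S2 = t"
          using b by auto
        have "verts (code_graph n g) = {..<n}" by (simp add: code_graph_def)
        thus False using K_freeD[OF kf S(1) _ S(4-6)] S(2,3) g unfolding cl by blast
      qed
    next
      assume *: "\<forall>S1 S2. (S1, S2) \<in> ?bad \<longrightarrow> \<not> (g \<in> ?cl 0 S1 \<and> g \<in> ?cl (1/2) S2)"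
      show "K_free t (code_graph n g)"
        unfolding K_free_def
      proof (intro notI, elim exE conjE)
        fix S1 S2 assume S: "S2 \<subseteq> S1" "S1 \<subseteq> verts (code_graph n g)" "1 \<le> card S1" "1 \<le> card S2"
          "card S1 + card S2 = t" "clique_above (code_graph n g) 0 S1" "clique_above (code_graph n g) (1/2) S2"
        have "(S1, S2) \<in> ?bad" using S(1-5) by (simp add: code_graph_def)
        moreover have "g \<in> ?cl 0 S1 \<and> g \<in> ?cl (1/2) S2" using S(6,7) unfolding cl by blast
        ultimately show False using * by blast
      qed
    qed
    thus ?thesis by blast
  qed
  define S where "S = ?sum \<inter> (\<Inter>p\<in>{..<n} \<times> {..<n}. ?sym p)"
  define K where "K = (\<Inter>(S1, S2)\<in>?bad. - (?cl 0 S1 \<inter> ?cl (1/2) S2))"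
  have "codes t n = {g. \<forall>p. g p \<in> {0..1}} \<inter> (S \<inter> K)"
    unfolding codes_def using wg kf unfolding S_def[symmetric] K_def[symmetric] by blast
  moreover have "closed S"
    unfolding S_def
  proof (intro closed_Int closed_INT ballI)
    show "closed ?sum" by (intro closed_Collect_eq continuous_intros) auto
    show "closed (?sym p)" for p by (intro closed_Collect_eq continuous_intros) auto
  qed
  moreover have "closed K"
    unfolding K_def
  proof (intro closed_INT ballI)
    fix q assume q: "q \<in> ?bad"
    obtain S1 S2 where [simp]: "q = (S1, S2)" by (cases q)
    have "finite S1" "finite S2" using q finite_subset[of _ "{..<n}"] by auto
    hence "open (?cl 0 S1 \<inter> ?cl (1/2) S2)" by (intro open_Int open_clique)
    thus "closed (case q of (S1, S2) \<Rightarrow> - (?cl 0 S1 \<inter> ?cl (1/2) S2))"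
      by (simp only: case_prod_conv closed_Compl \<open>q = (S1, S2)\<close>)
  qed
  ultimately show ?thesis
    using compact_Int_closed[OF compact_unit_functions closed_Int] by metis
qed

lemma continuous_K_density: "continuous_on A (\<lambda>g. K_density s (code_graph n g))"
proof -
  have "continuous_on A (\<lambda>g. if i = j then 0 else g (i, j) :: real)" for i j :: nat and A
    by (cases "i = j") (auto intro: continuous_on_subset[OF continuous_on_product_coordinates])
  thus ?thesis
    unfolding K_density_def code_graph_def wgraph.simps
    by (intro continuous_intros) (auto intro: continuous_on_subset[OF continuous_on_product_coordinates])
qed

lemma ex_extremal:
  assumes "2 \<le> s" "3 \<le> t"
  shows "\<exists>R :: nat wgraph. extremal s t R"
proof -
  \<comment> \<open>At most \<open>t - 2\<close> vertices suffice, so a finite union of compact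
    images dominates all densities, and its maximum is the supremum.\<close>
  define D where "D = (\<Union>n\<le>t - 2. (\<lambda>g. K_density s (code_graph n g)) ` codes t n)"
  have "compact D"
    unfolding D_def by (intro compact_UN compact_continuous_image continuous_K_density compact_codes) auto
  have upper: "\<exists>d\<in>D. K_density s R \<le> d" if "weighted_graph R" "K_free t R" for R :: "nat wgraph"
  proof -
    obtain V x w where R: "R = G V x w" by (cases R) auto
    have "2 \<le> t" using assms(2) by simp
    from reduce_to_small[OF that(1)[unfolded R] that(2)[unfolded R] assms(1) this]
    obtain W y where W: "weighted_graph (G W y w)" "K_free t (G W y w)"
      "K_density s R \<le> K_density s (G W y w)" "card W \<le> t - 2"
      unfolding R by blast
    obtain R' :: "nat wgraph" where R': "verts R' = {..<card (verts (G W y w))}" "weighted_graph R'"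
      "K_free t R'" "K_density s R' = K_density s (G W y w)"
      by (rule ex_nat_copy[OF W(1,2), of s])
    obtain V' x' w' where R'_eq: "R' = G V' x' w'" by (cases R') auto
    define m where "m = card W"
    have R'_G: "R' = G {..<m} x' w'" using R'(1) unfolding R'_eq m_def by simp
    note R'' = R'(2,3)[unfolded R'_G]
    \<comment> \<open>The default \<open>0\<close> off the \<open>m\<close> by \<open>m\<close>
      square keeps the code in the unit cube, as \<open>codes\<close> demands of every
      coordinate.\<close>
    define g where "g p = (let (i, j) = p in if i < m \<and> j < m then if i = j then x' i else w' i j else 0)"
      for p :: "nat \<times> nat"
    have "x' i = g (i, i)" if "i \<in> {..<m}" for i using that by (simp add: g_def)
    moreover have "w' i j = (if i = j then 0 else g (i, j))" if "i \<in> {..<m}" "j \<in> {..<m}" for i j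
      using that weighted_graph_diag[OF R''(1) that(1)] by (auto simp: g_def)
    ultimately have cong: "weighted_graph (code_graph m g)" "K_density s (code_graph m g) = K_density s R'"
      "K_free t (code_graph m g)"
      using graph_cong[OF R''(1), of "\<lambda>i. g (i, i)" "\<lambda>i j. if i = j then 0 else g (i, j)"] R''(2)
      unfolding code_graph_def R'_G by blast+
    have "x' i \<le> 1" if "i < m" for i
      using that R''(1) unfolding weighted_graph_def wgraph.simps by blast
    hence "g p \<in> {0..1}" for p
      using weighted_graph_nonneg[OF R''(1)] weighted_graph_edge_nonneg[OF R''(1)]
        weighted_graph_edge_le[OF R''(1)] by (auto simp: g_def split: prod.split)
    hence "g \<in> codes t m" using cong by (simp add: codes_def)
    hence "K_density s (code_graph m g) \<in> D"
      unfolding D_def using W(4) m_def by blast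
    moreover have "K_density s R \<le> K_density s (code_graph m g)"
      using cong(2) R'(4) W(3) by simp
    ultimately show ?thesis by blast
  qed
  have "D \<noteq> {}" using upper K_densities_nonempty[of t s] assms(2) by fastforce
  then obtain d where d: "d \<in> D" "\<And>d'. d' \<in> D \<Longrightarrow> d' \<le> d"
    using compact_attains_sup[OF \<open>compact D\<close>] by blast
  from d(1) obtain n g where ng: "g \<in> codes t n" "d = K_density s (code_graph n g)"
    unfolding D_def by blast
  hence R: "weighted_graph (code_graph n g)" "K_free t (code_graph n g)" by (auto simp: codes_def)
  have "pi_K s t \<le> d"
    unfolding pi_K_def
  proof (rule cSup_least[OF K_densities_nonempty])
    show "t \<noteq> 2" using assms(2) by simp
    fix z assume "z \<in> {K_density s R |R :: nat wgraph. weighted_graph R \<and> K_free t R}"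
    then obtain R :: "nat wgraph" where "z = K_density s R" "weighted_graph R" "K_free t R" by blast
    with upper obtain d' where "d' \<in> D" "z \<le> d'" by blast
    thus "z \<le> d" using d(2) order_trans by blast
  qed
  hence "K_density s (code_graph n g) = pi_K s t"
    using K_density_le_pi_K[OF R, of s] ng(2) by simp
  thus ?thesis using R unfolding extremal_def by blast
qed

section \<open>Numerical inequalities\<close>

text \<open>What remains when the defect \<open>1 - (1/2) ^ q\<close> of a set with
  \<open>q = Suc p\<close> vertices in a part is shared equally among these \<open>q\<close>
  vertices.\<close>

definition psi :: "nat \<Rightarrow> real" where
  "psi p = (1 - (1/2) ^ Suc p) / real (Suc p)"

lemma Suc_le_two_power: "real p + 1 \<le> 2 ^ p"
  by (induction p) auto

lemma two_power_psi: "2 ^ p * psi p = (2 ^ p - 1/2) / (real p + 1)"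
proof -
  have "2 ^ p * (1 - (1/2) ^ Suc p) = (2 :: real) ^ p - 1/2"
    by (simp add: right_diff_distrib power_one_over)
  moreover have "2 ^ p * psi p = 2 ^ p * (1 - (1/2) ^ Suc p) / (real p + 1)"
    by (simp add: psi_def add.commute)
  ultimately show ?thesis by (simp only:)
qed

lemma psi_nonneg: "0 \<le> psi p"
  using power_le_one[of "1/2 :: real" "Suc p"] by (simp add: psi_def)

lemma psi_ge: "(1/2) ^ p \<le> 2 * psi p"
proof -
  have "1 / 2 \<le> 2 ^ p * psi p"
    unfolding two_power_psi using Suc_le_two_power[of p] by (simp add: field_simps)
  thus ?thesis by (simp add: field_simps power_one_over)
qed

text \<open>For \<open>p \<le> k - 2\<close> this is the AM-GM inequality \<open>e + \<theta>\<^sup>2 / e \<ge> 2 \<theta>\<close>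
  with \<open>e = 2 ^ p / 2 ^ l\<close> and \<open>\<theta> = 8 / (1 + \<rho>)\<^sup>2\<close>; the remaining cases have \<open>e \<ge> 2\<close>.\<close>

lemma move_gain_pointwise:
  fixes \<rho> :: real
  assumes \<rho>: "1 \<le> \<rho>" and p: "p \<le> k" and l: "l + 2 \<le> k" and k: "3 \<le> k"
  shows "16 / (1 + \<rho>)\<^sup>2 \<le> 2 ^ p / 2 ^ l + 8 / ((1 + \<rho>) * \<rho>\<^sup>2) * (real (k - p) * psi p * 2 ^ l)"
proof -
  define e :: real where "e = 2 ^ p / 2 ^ l"
  define \<kappa> where "\<kappa> = real (k - p) * (2 ^ p - 1/2) / (real p + 1)"
  define \<theta> where "\<theta> = 8 / (1 + \<rho>)\<^sup>2"
  define A where "A = 8 / ((1 + \<rho>) * \<rho>\<^sup>2)"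
  have e: "0 < e" by (simp add: e_def)
  have A: "0 < A" using \<rho> by (simp add: A_def)
  have \<kappa>0: "0 \<le> \<kappa>" using Suc_le_two_power[of p] by (auto simp: \<kappa>_def intro!: divide_nonneg_nonneg mult_nonneg_nonneg)
  have "real (k - p) * psi p * 2 ^ l = real (k - p) * (2 ^ p * psi p) / e"
    by (simp add: e_def)
  hence X: "real (k - p) * psi p * 2 ^ l = \<kappa> / e"
    unfolding two_power_psi \<kappa>_def by simp
  have "4 \<le> (1 + \<rho>)\<^sup>2" using power_mono[of 2 "1 + \<rho>" 2] \<rho> by simp
  hence "8 / (1 + \<rho>)\<^sup>2 \<le> 8 / 4" by (intro divide_left_mono) auto
  hence \<theta>2: "\<theta> \<le> 2" by (simp add: \<theta>_def)
  have big: ?thesis if "4 \<le> e"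
  proof -
    have "0 \<le> A * (\<kappa> / e)" using A e \<kappa>0 by simp
    thus ?thesis using that \<theta>2 unfolding X e_def[symmetric] A_def[symmetric] \<theta>_def by simp
  qed
  have amgm: ?thesis if "\<theta>\<^sup>2 \<le> A * \<kappa>"
  proof -
    have "0 \<le> (e - \<theta>)\<^sup>2 / e" using e by simp
    also have "(e - \<theta>)\<^sup>2 / e = e - 2 * \<theta> + \<theta>\<^sup>2 / e" using e by (simp add: field_simps power2_eq_square)
    also have "\<theta>\<^sup>2 / e \<le> A * \<kappa> / e" using that e by (intro divide_right_mono) auto
    finally have "2 * \<theta> \<le> e + A * (\<kappa> / e)" by simp
    thus ?thesis unfolding X e_def[symmetric] A_def[symmetric] \<theta>_def by simp
  qed
  consider "p + 2 \<le> k" | "p + 1 = k" | "p = k" using p by linarith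
  thus ?thesis
  proof cases
    case 1
    have \<kappa>: "3/2 \<le> \<kappa>"
    proof (cases "p = 0")
      case True
      thus ?thesis using k by (simp add: \<kappa>_def)
    next
      case False
      have "2 * (2 ^ p - 1/2) \<le> real (k - p) * (2 ^ p - 1/2)"
        using 1 Suc_le_two_power[of p] by (intro mult_right_mono) auto
      moreover have "3/2 * (real p + 1) \<le> 2 * (2 ^ p - 1/2)"
        using Suc_le_two_power[of p] False by (simp add: field_simps)
      ultimately have le: "3/2 * (real p + 1) \<le> real (k - p) * (2 ^ p - 1/2)" by linarith
      have pos: "0 < real p + 1" by simp
      show ?thesis unfolding \<kappa>_def pos_le_divide_eq[OF pos] by (rule le)
    qed
    \<comment> \<open>The condition \<open>\<theta>\<^sup>2 \<le> A * (3/2)\<close> means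
      \<open>8 * \<rho>\<^sup>2 / (1 + \<rho>) ^ 3 \<le> 3/2\<close>; the left side peaks at
      \<open>32/27\<close>, for \<open>\<rho> = 2\<close>.\<close>
    have "16 * \<rho>\<^sup>2 \<le> 3 * (1 + \<rho>) ^ 3"
    proof -
      have "0 \<le> \<rho> * (3 * (\<rho> - 7/6)\<^sup>2 + 59/12) + 3" using \<rho> by simp
      thus ?thesis by (simp add: power2_eq_square power3_eq_cube algebra_simps)
    qed
    hence "64 * (\<rho>\<^sup>2 * (1 + \<rho>)) \<le> 12 * (1 + \<rho>) ^ 4"
      using \<rho> mult_right_mono[of "16 * \<rho>\<^sup>2" "3 * (1 + \<rho>) ^ 3" "4 * (1 + \<rho>)"]
      by (simp add: power4_eq_xxxx power3_eq_cube algebra_simps)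
    hence "\<theta>\<^sup>2 \<le> A * (3/2)"
      using \<rho> by (simp add: \<theta>_def A_def power_divide divide_simps mult_ac)
    also have "\<dots> \<le> A * \<kappa>" using \<kappa> A by (intro mult_left_mono) auto
    finally show ?thesis by (rule amgm)
  next
    case 2
    show ?thesis
    proof (cases "l + 2 = k")
      case True
      hence pl: "p = l + 1" using 2 by simp
      hence e2: "e = 2" by (simp add: e_def)
      \<comment> \<open>AM-GM can just fail here: for \<open>p = 2\<close> the value of
        \<open>\<kappa>\<close> is \<open>7/6\<close>, slightly below \<open>32/27\<close>. But
        \<open>e\<close> is known to be \<open>2\<close>, and the claim becomes a quartic inequality
        in \<open>\<rho>\<close>.\<close>
      have "7/6 \<le> \<kappa>"
      proof -
        obtain q where q: "p = q + 2" using 2 k by (metis add.commute add_le_cancel_right le_Suc_ex numeral_2_eq_2 numeral_3_eq_3 One_nat_def add_Suc_right add_0_right)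
        have "4 * (real q + 1) \<le> 2 ^ p" using Suc_le_two_power[of q] by (simp add: q)
        thus ?thesis using 2 by (simp add: \<kappa>_def q field_simps flip: 2)
      qed
      hence "A * (7/6) / 2 \<le> A * \<kappa> / 2" using A by (intro divide_right_mono mult_left_mono) auto
      moreover have "2 * \<theta> \<le> 2 + A * (7/6) / 2"
      proof -
        let ?r = "\<rho> - 1"
        have "0 \<le> 3 * ?r ^ 4 + 18 * ?r ^ 3 + (15 * (?r - 1/6)\<^sup>2 + 19/12)"
          using \<rho> by simp
        hence poly: "0 \<le> 3 * \<rho> ^ 4 + 6 * \<rho> ^ 3 - 21 * \<rho>\<^sup>2 + 7 * \<rho> + 7"
          by (simp add: power2_eq_square power3_eq_cube power4_eq_xxxx algebra_simps)
        define D where "D = (1 + \<rho>)\<^sup>2 * \<rho>\<^sup>2"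
        have D: "0 < D" using \<rho> by (simp add: D_def)
        have diff: "2 * D + 8 * (1 + \<rho>) * (7/6) / 2 - 2 * (8 * \<rho>\<^sup>2)
            = 2/3 * (3 * \<rho> ^ 4 + 6 * \<rho> ^ 3 - 21 * \<rho>\<^sup>2 + 7 * \<rho> + 7)"
          by (simp add: D_def power2_eq_square power3_eq_cube power4_eq_xxxx field_simps)
        have "0 \<le> 2 * D + 8 * (1 + \<rho>) * (7/6) / 2 - 2 * (8 * \<rho>\<^sup>2)"
          unfolding diff using poly by (rule mult_nonneg_nonneg[rotated]) simp
        hence "2 * (8 * \<rho>\<^sup>2) \<le> 2 * D + 8 * (1 + \<rho>) * (7/6) / 2"
          by (simp only: diff_ge_0_iff_ge)
        hence "2 * (8 * \<rho>\<^sup>2) / D \<le> (2 * D + 8 * (1 + \<rho>) * (7/6) / 2) / D"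
          using D by (intro divide_right_mono) auto
        moreover have "(2 * D + 8 * (1 + \<rho>) * (7/6) / 2) / D = 2 + 8 * (1 + \<rho>) / D * (7/6) / 2"
          using D by (simp add: add_divide_distrib)
        moreover have "\<theta> = 8 * \<rho>\<^sup>2 / D" using \<rho> by (simp add: \<theta>_def D_def)
        moreover have "A = 8 * (1 + \<rho>) / D"
          unfolding A_def D_def using \<rho> by (subst frac_eq_eq) (auto simp: power2_eq_square)
        ultimately show ?thesis by simp
      qed
      ultimately have "2 * \<theta> \<le> e + A * (\<kappa> / e)" by (simp add: e2)
      thus ?thesis unfolding X e_def[symmetric] A_def[symmetric] \<theta>_def by simp
    next
      case False
      hence "l + 2 \<le> p" using 2 l by simp
      hence "(2::real) ^ (l + 2) \<le> 2 ^ p" by (intro power_increasing) auto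
      thus ?thesis by (intro big) (simp add: e_def field_simps)
    qed
  next
    case 3
    hence "(2::real) ^ (l + 2) \<le> 2 ^ p" using l by (intro power_increasing) auto
    thus ?thesis by (intro big) (simp add: e_def field_simps)
  qed
qed

text \<open>Serves the case where the smaller part is a single vertex. There \<open>k = 2\<close>
  can occur, for which the previous inequality fails, for instance at \<open>\<rho> = 2\<close>,
  \<open>p = l = 0\<close>. The constants are tight for \<open>k = 2\<close>,
  \<open>p = 0\<close>.\<close>

lemma move_gain_pointwise_singleton:
  assumes "p \<le> k" "2 \<le> k"
  shows "5/2 \<le> 2 ^ p + 3/2 * (real (k - p) * psi p)"
proof -
  consider "p = 0" | "p = 1" | "2 \<le> p" by linarith
  thus ?thesis
  proof cases
    case 3
    hence "(4::real) \<le> 2 ^ p" using power_increasing[of 2 p "2::real"] by simp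
    moreover have "0 \<le> real (k - p) * psi p" using psi_nonneg by simp
    ultimately show ?thesis by linarith
  qed (use assms in \<open>auto simp: psi_def field_simps\<close>)
qed

lemma singleton_numeric:
  fixes \<rho> :: real
  assumes "1 \<le> \<rho>" "(1 + \<rho>)\<^sup>2 \<le> 8"
  shows "8 / (1 + \<rho>)\<^sup>2 + 3/2 * (\<rho> - 1) < 5/2"
proof -
  define r where "r = 1 + \<rho>"
  have r: "2 \<le> r" "r\<^sup>2 \<le> 8" using assms by (auto simp: r_def)
  have "r\<^sup>2 < (283/100)\<^sup>2" using r(2) by (simp add: power2_eq_square)
  hence r3: "r < 283/100" by (rule power_less_imp_less_base) simp
  \<comment> \<open>After clearing denominators the claim is that the cubic
    \<open>3/2 * r ^ 3 - 11/2 * r\<^sup>2 + 10\<close>, which has the root \<open>2\<close>, stays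
    below \<open>2\<close>. On the range of \<open>r\<close> its quadratic cofactor is at most
    \<open>12 - 5 - 5 = 2\<close>.\<close>
  have "(r - 2) * (3/2 * r\<^sup>2 - 5/2 * r - 5) \<le> (r - 2) * 2"
    using r by (intro mult_left_mono) auto
  also have "\<dots> < 2" using r3 by simp
  finally have "(r - 2) * (3/2 * r\<^sup>2 - 5/2 * r - 5) < 2" .
  moreover have "(r - 2) * (3/2 * r\<^sup>2 - 5/2 * r - 5) = 3/2 * r ^ 3 - 11/2 * r\<^sup>2 + 10"
    by (simp add: power2_eq_square power3_eq_cube field_simps)
  ultimately have "8 + 3/2 * r ^ 3 < 11/2 * r\<^sup>2" by linarith
  hence "8 / r\<^sup>2 + 3/2 * r < 11/2"
    using r(1) by (simp add: field_simps power2_eq_square power3_eq_cube)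
  hence "8 / (1 + \<rho>)\<^sup>2 + 3/2 * (1 + \<rho>) < 11/2" by (simp only: r_def)
  thus ?thesis by argo
qed

section \<open>Extremal graphs with the minimum number of vertices\<close>

lemma sum_two:
  fixes y :: "'a \<Rightarrow> real"
  assumes "finite V" "u \<in> V" "v \<in> V" "u \<noteq> v"
  shows "sum y V = y u + y v + sum y (V - {u, v})"
proof -
  have "sum y V = sum y {u, v} + sum y (V - {u, v})"
    using assms by (subst sum.subset_diff[of "{u, v}"]) auto
  thus ?thesis using assms(4) by simp
qed

text \<open>One-sided derivative test: for positive \<open>D\<close> the quadratic
  \<open>h * D - K * h\<^sup>2\<close> is positive at its maximiser \<open>D / (2 * K)\<close> and
  at every smaller positive \<open>h\<close>.\<close>

lemma interior_max_slope_nonpos: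
  fixes D K q :: real
  assumes "0 < q" "0 < K" and max: "\<And>h. 0 \<le> h \<Longrightarrow> h \<le> q \<Longrightarrow> h * D \<le> K * h\<^sup>2"
  shows "D \<le> 0"
proof (rule ccontr)
  assume D: "\<not> D \<le> 0"
  define h where "h = min q (D / (2 * K))"
  have h: "0 < h" "h \<le> q" "h \<le> D / (2 * K)" using assms(1,2) D by (auto simp: h_def)
  have "h * D \<le> h * (K * h)" using max[of h] h by (simp add: power2_eq_square algebra_simps)
  hence "D \<le> K * h" using h(1) by simp
  moreover have "2 * (K * h) \<le> D" using h(3) assms(2) by (simp add: field_simps)
  ultimately show False using D by linarith
qed

lemma interior_max_zero_slope:
  fixes D K p q :: real
  assumes "0 < p" "0 < q" "0 < K" and max: "\<And>h. - p \<le> h \<Longrightarrow> h \<le> q \<Longrightarrow> h * D \<le> K * h\<^sup>2"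
  shows "D = 0"
proof (rule antisym)
  show "D \<le> 0" by (rule interior_max_slope_nonpos[OF assms(2,3)]) (use assms(1) max in auto)
  have "- D \<le> 0"
  proof (rule interior_max_slope_nonpos[OF assms(1,3)])
    fix h assume "0 \<le> h" "h \<le> p"
    thus "h * - D \<le> K * h\<^sup>2" using max[of "- h"] assms(2) by simp
  qed
  thus "0 \<le> D" by simp
qed

text \<open>The witness has \<open>s\<close> vertices and all edges of weight \<open>1/2\<close>.
  Its cliques above \<open>1/2\<close> are single vertices, so \<open>s + 1 < t\<close> makes it
  free.\<close>

lemma pi_K_pos:
  assumes "1 \<le> s" "s \<le> t - 2"
  shows "0 < pi_K s t"
proof -
  let ?R = "G {..<s} (\<lambda>_. 1 / real s) (\<lambda>a b. if a = b then 0 else 1/2) :: nat wgraph"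
  have wg: "weighted_graph ?R"
    using assms(1) by (intro weighted_graphI) auto
  have "K_free t ?R"
  proof (rule K_freeI; unfold wgraph.simps)
    fix S assume S: "clique_above ?R (1/2) S" "S \<noteq> {}"
    have "a = b" if "a \<in> S" "b \<in> S" for a b
      using S(1) that by (auto simp: clique_above_G split: if_splits)
    hence "S = {SOME a. a \<in> S}" using S(2) by (metis someI_ex ex_in_conv singletonI subset_antisym subsetI singletonD)
    hence "card S = 1" by (metis card_1_singleton_iff One_nat_def)
    thus "card {..<s} + card S < t" using assms by simp
  qed simp
  from K_density_le_pi_K[OF wg this, of s]
  have "fact s * ws (\<lambda>_. 1 / real s) (\<lambda>a b. if a = b then 0 else 1/2) {..<s} s (\<lambda>_. 1) \<le> pi_K s t"
    unfolding K_density_ws[OF wg] .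
  moreover have "0 < ws (\<lambda>_. 1 / real s) (\<lambda>a b. if a = b then 0 else 1/2) {..<s} s (\<lambda>_. 1)"
    using assms(1) by (intro ws_pos) auto
  ultimately show ?thesis
    by (smt (verit) fact_gt_zero mult_pos_pos)
qed

definition merge_isolate :: "('a \<Rightarrow> 'a \<Rightarrow> real) \<Rightarrow> 'a \<Rightarrow> 'a \<Rightarrow> 'a \<Rightarrow> real" where
  "merge_isolate w v a b = (if a = b then 0 else if a = v \<or> b = v then 1 else w a b)"

locale min_extremal_graph =
  fixes s t :: nat and V :: "'a set" and x :: "'a \<Rightarrow> real" and w :: "'a \<Rightarrow> 'a \<Rightarrow> real"
  assumes s3: "3 \<le> s" and st: "s \<le> t - 2" and min_ext: "min_extremal s t (G V x w)"
begin

lemma wg: "weighted_graph (G V x w)" and kf: "K_free t (G V x w)"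
  and density: "K_density s (G V x w) = pi_K s t"
  using min_ext by (auto simp: min_extremal_def extremal_def)

lemma fin: "finite V"
  by (rule weighted_graph_finite[OF wg])

lemma no_better:
  "weighted_graph R \<Longrightarrow> K_free t R \<Longrightarrow> K_density s R \<le> K_density s (G V x w)"
  using K_density_le_pi_K density by metis

text \<open>Minimality excludes ties with smaller graphs. This yields positive vertex and edge
  weights and makes the merging inequality strict.\<close>

lemma fewer_vertices_worse:
  assumes "weighted_graph R" "K_free t R" "card (verts R) < card V"
  shows "K_density s R < K_density s (G V x w)"
proof (rule ccontr)
  assume "\<not> ?thesis"
  hence "K_density s R = pi_K s t"
    using no_better[OF assms(1,2)] density by linarith
  hence "extremal s t R" using assms by (simp add: extremal_def)
  then obtain R' :: "nat wgraph" where "extremal s t R'" "card (verts R') = card (verts R)"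
    by (rule ex_nat_extremal)
  thus False using min_ext assms(3) by (auto simp: min_extremal_def)
qed

lemma s_le_card: "s \<le> card V"
proof (rule ccontr)
  assume *: "\<not> ?thesis"
  have "card T \<noteq> s" if "T \<subseteq> V" for T
    using card_mono[OF fin that] * by linarith
  hence "ws x w V s (\<lambda>_. 1) = 0" unfolding ws_def by (intro sum.neutral) auto
  thus False
    using pi_K_pos[of s t] s3 st density unfolding K_density_ws[OF wg] by simp
qed

lemma x_pos: assumes "v \<in> V" shows "0 < x v"
proof (rule ccontr)
  assume "\<not> ?thesis"
  hence x0: "x v = 0" using weighted_graph_nonneg[OF wg assms] by simp
  have "sum x V = x v + sum x (V - {v})" using fin assms by (rule sum.remove)
  hence wg': "weighted_graph (G (V - {v}) x w)"
    using weighted_graph_sum[OF wg] x0 weighted_graph_nonneg[OF wg]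
    by (intro weighted_graph_subset[OF wg]) auto
  have kf': "K_free t (G (V - {v}) x w)" by (rule K_free_subset[OF kf]) blast
  have "card (V - {v}) < card V" using fin assms by (intro psubset_card_mono) auto
  hence "K_density s (G (V - {v}) x w) < K_density s (G V x w)"
    using fewer_vertices_worse[OF wg' kf'] by simp
  moreover have "K_density s (G V x w) = K_density s (G (V - {v}) x w)"
    using K_density_single[OF wg assms, of s] s3 x0 K_density_ws[OF wg'] by simp
  ultimately show False by simp
qed

lemma w_pos: assumes "u \<in> V" "v \<in> V" "u \<noteq> v" shows "0 < w u v"
proof (rule ccontr)
  assume "\<not> ?thesis"
  hence "w u v = 0" using weighted_graph_edge_nonneg[OF wg assms(1,2)] by simp
  from delete_zero_edge[OF wg assms this, of s] s3 obtain W y where W: "W \<subset> V"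
    "weighted_graph (G W y w)" "K_density s (G V x w) \<le> K_density s (G W y w)" by auto
  have "K_free t (G W y w)" using K_free_subset[OF kf] W(1) by blast
  moreover have "card W < card V" using W(1) fin by (intro psubset_card_mono) auto
  ultimately show False using fewer_vertices_worse[OF W(2)] W(3) by simp
qed

lemma w_sym: "u \<in> V \<Longrightarrow> v \<in> V \<Longrightarrow> w u v = w v u"
  by (rule weighted_graph_sym[OF wg])

lemma clique_bound: "clique_above (G V x w) (1/2) S \<Longrightarrow> S \<noteq> {} \<Longrightarrow> card V + card S < t"
  using K_free_clique_bound[OF _ _ kf, of S] fin w_pos s3 st by (simp add: clique_above_G)

section \<open>Variations at a pair of vertices\<close>

text \<open>Coefficients over the vertices other than \<open>u\<close>, \<open>v\<close>:
  \<open>B u v\<close> belongs to \<open>u\<close> alone and \<open>C\<close> to the pair,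
  \<open>CC\<close> to the pair once \<open>u\<close> copies \<open>v\<close>, and \<open>E\<close>
  to a vertex joined to all others with weight \<open>1\<close>.\<close>

abbreviation B :: "'a \<Rightarrow> 'a \<Rightarrow> real" where "B u v \<equiv> ws x w (V - {u, v}) (s - 1) (w u)"
abbreviation C :: "'a \<Rightarrow> 'a \<Rightarrow> real" where "C u v \<equiv> ws x w (V - {u, v}) (s - 2) (\<lambda>t. w u t * w v t)"
abbreviation CC :: "'a \<Rightarrow> 'a \<Rightarrow> real" where "CC u v \<equiv> ws x w (V - {u, v}) (s - 2) (\<lambda>t. w v t * w v t)"
abbreviation E :: "'a \<Rightarrow> 'a \<Rightarrow> real" where "E u v \<equiv> ws x w (V - {u, v}) (s - 1) (\<lambda>_. 1)"

lemma swap: "V - {v, u} = V - {u, v}" by blast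

lemma C_swap: "C v u = C u v"
  unfolding swap[of u v] by (simp add: mult.commute)

lemma C_pos: assumes "u \<in> V" "v \<in> V" "u \<noteq> v" shows "0 < C u v"
proof (rule ws_pos)
  have "card (V - {u, v}) = card V - 2"
    using assms fin by (subst card_Diff_subset) auto
  thus "s - 2 \<le> card (V - {u, v})" using s_le_card by simp
qed (use fin x_pos w_pos assms in auto)

lemma density_pair:
  assumes "u \<in> V" "v \<in> V" "u \<noteq> v"
  shows "K_density s (G V x w) = fact s * (ws x w (V - {u, v}) s (\<lambda>_. 1)
      + x u * B u v + x v * B v u + x u * x v * w u v * C u v)"
  using K_density_pair[OF wg assms, of s] s3 unfolding swap[of v u] by simp

text \<open>Moving weight \<open>h\<close> from \<open>v\<close> to \<open>u\<close> changes the
  density by a quadratic in \<open>h\<close> with negative leading coefficient; \<open>h = 0\<close>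
  is an interior maximum because both weights are positive.\<close>

lemma lagrange:
  assumes uv: "u \<in> V" "v \<in> V" "u \<noteq> v"
  shows "B u v + w u v * C u v * x v = B v u + w u v * C u v * x u"
proof -
  let ?N = "V - {u, v}" and ?K = "w u v * C u v"
  have K: "0 < ?K" using w_pos[OF uv] C_pos[OF uv] by simp
  have "B u v - B v u + ?K * (x v - x u) = 0"
  proof (rule interior_max_zero_slope[OF x_pos[OF uv(1)] x_pos[OF uv(2)] K])
    fix h assume h: "- x u \<le> h" "h \<le> x v"
    let ?y = "x(u := x u + h, v := x v - h)"
    have "sum ?y ?N = sum x ?N" by (intro sum.cong) auto
    hence "sum ?y V = 1"
      using sum_two[OF fin uv, of ?y] sum_two[OF fin uv, of x] uv(3) weighted_graph_sum[OF wg] by simp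
    hence wg': "weighted_graph (G V ?y w)"
      using h weighted_graph_nonneg[OF wg] by (intro weighted_graph_subset[OF wg]) auto
    have kf': "K_free t (G V ?y w)" by (rule K_free_subset[OF kf]) simp
    have ws': "ws ?y w ?N k g = ws x w ?N k g" for k g
      by (intro ws_cong) auto
    have "K_density s (G V ?y w) = fact s * (ws x w ?N s (\<lambda>_. 1)
        + (x u + h) * B u v + (x v - h) * B v u + (x u + h) * (x v - h) * w u v * C u v)"
      using K_density_pair[OF wg' uv, of s] s3 uv(3) unfolding ws' swap[of v u] by simp
    with no_better[OF wg' kf'] density_pair[OF uv]
    have "fact s * (ws x w ?N s (\<lambda>_. 1)
        + (x u + h) * B u v + (x v - h) * B v u + (x u + h) * (x v - h) * w u v * C u v)
      \<le> fact s * (ws x w ?N s (\<lambda>_. 1) + x u * B u v + x v * B v u + x u * x v * w u v * C u v)"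
      by simp
    hence "(x u + h) * B u v + (x v - h) * B v u + (x u + h) * (x v - h) * w u v * C u v
        \<le> x u * B u v + x v * B v u + x u * x v * w u v * C u v"
      by (simp add: mult_le_cancel_left)
    thus "h * (B u v - B v u + ?K * (x v - x u)) \<le> ?K * h\<^sup>2"
      by (simp add: algebra_simps power2_eq_square)
  qed
  thus ?thesis by (simp add: algebra_simps)
qed

text \<open>Eliminating \<open>B u v\<close> by the Lagrange condition makes the first two terms
  coincide with those of the graph in which \<open>u\<close> is a clone of \<open>v\<close>, so only
  quadratic terms remain to be compared.\<close>

lemma density_pair':
  assumes uv: "u \<in> V" "v \<in> V" "u \<noteq> v"
  shows "K_density s (G V x w) = fact s * (ws x w (V - {u, v}) s (\<lambda>_. 1)
      + (x u + x v) * B v u + w u v * C u v * (x u)\<^sup>2)"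
proof -
  have Bu: "B u v = B v u + w u v * C u v * (x u - x v)"
    using lagrange[OF uv] by (simp add: algebra_simps)
  show ?thesis
    unfolding density_pair[OF uv] Bu by (simp add: algebra_simps power2_eq_square)
qed

lemma
  assumes uv: "u \<in> V" "v \<in> V" "u \<noteq> v" and ab: "0 \<le> a" "0 \<le> b" "a + b = x u + x v"
  shows weighted_graph_clone: "weighted_graph (G V (x(u := a, v := b)) (blow (id(u := v)) w))"
    and K_free_clone: "K_free t (G V (x(u := a, v := b)) (blow (id(u := v)) w))"
    and K_density_clone: "K_density s (G V (x(u := a, v := b)) (blow (id(u := v)) w))
      = fact s * (ws x w (V - {u, v}) s (\<lambda>_. 1) + (x u + x v) * B v u + a * b / 2 * CC u v)"
proof -
  let ?y = "x(u := a, v := b)" and ?f = "id(u := v)" and ?N = "V - {u, v}"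
  let ?w = "blow ?f w"
  have im: "?f ` V \<subseteq> V" using uv by auto
  have "sum ?y ?N = sum x ?N" by (intro sum.cong) auto
  hence "sum ?y V = 1"
    using sum_two[OF fin uv, of ?y] sum_two[OF fin uv, of x] uv(3) weighted_graph_sum[OF wg] ab(3) by simp
  thus wg': "weighted_graph (G V ?y ?w)"
    using ab weighted_graph_nonneg[OF wg] by (intro weighted_graph_blow[OF wg fin im]) auto
  show "K_free t (G V ?y ?w)"
    by (rule K_free_blow[OF fin im clique_bound])
  have 1: "ws ?y ?w ?N k g = ws x w ?N k g'" if "\<And>t. t \<in> ?N \<Longrightarrow> g t = g' t" for k g g'
    by (intro ws_cong that) (auto simp: blow_def)
  have g: "?w u t = w v t" "?w v t = w v t" if "t \<in> ?N" for t
    using that uv(3) by (auto simp: blow_def)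
  have "ws ?y ?w ?N s (\<lambda>_. 1) = ws x w ?N s (\<lambda>_. 1)" by (rule 1) simp
  moreover have "ws ?y ?w ?N (s - 1) (?w u) = B v u" unfolding swap[of v u] by (rule 1) (rule g)
  moreover have "ws ?y ?w ?N (s - 1) (?w v) = B v u" unfolding swap[of v u] by (rule 1) (rule g)
  moreover have "ws ?y ?w ?N (s - 2) (\<lambda>t. ?w u t * ?w v t) = CC u v" by (rule 1) (simp only: g)
  moreover have "?w u v = 1/2" using uv(3) by (simp add: blow_def)
  moreover have "?y u = a" "?y v = b" using uv(3) by auto
  moreover have "K_density s (G V ?y ?w) = fact s * (ws ?y ?w ?N s (\<lambda>_. 1)
      + ?y u * ws ?y ?w ?N (s - 1) (?w u) + ?y v * ws ?y ?w ?N (s - 1) (?w v)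
      + ?y u * ?y v * ?w u v * ws ?y ?w ?N (s - 2) (\<lambda>t. ?w u t * ?w v t))"
    using s3 by (intro K_density_pair[OF wg' uv]) simp
  ultimately show "K_density s (G V ?y ?w)
      = fact s * (ws x w ?N s (\<lambda>_. 1) + (x u + x v) * B v u + a * b / 2 * CC u v)"
    using ab(3) by (simp only:) (simp add: algebra_simps flip: ab(3))
qed

text \<open>The density of the clone depends on the split only through \<open>a * b\<close>, so the
  equal split is best. It gives a quarter of the squared sum, and halving by the edge weight
  produces the \<open>8\<close>.\<close>

lemma clone_bound:
  assumes uv: "u \<in> V" "v \<in> V" "u \<noteq> v"
  shows "(x u + x v)\<^sup>2 * CC u v \<le> 8 * (w u v * C u v * (x u)\<^sup>2)"
proof -
  let ?h = "(x u + x v) / 2"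
  have h: "0 \<le> ?h" "0 \<le> ?h" "?h + ?h = x u + x v" using x_pos[OF uv(1)] x_pos[OF uv(2)] by auto
  have "K_density s (G V (x(u := ?h, v := ?h)) (blow (id(u := v)) w)) \<le> K_density s (G V x w)"
    by (rule no_better[OF weighted_graph_clone[OF uv h] K_free_clone[OF uv h]])
  hence "?h * ?h / 2 * CC u v \<le> w u v * C u v * (x u)\<^sup>2"
    unfolding K_density_clone[OF uv h] density_pair'[OF uv] by (simp add: mult_le_cancel_left)
  thus ?thesis by (simp add: power2_eq_square field_simps)
qed

text \<open>Dropping \<open>u\<close> frees one unit of the budget, and the full edges at
  \<open>v\<close> enlarge a clique above \<open>1/2\<close> by at most \<open>v\<close> itself.
  Strictness comes from having fewer vertices.\<close>

lemma merge_bound: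
  assumes uv: "u \<in> V" "v \<in> V" "u \<noteq> v"
  shows "(x u + x v) * (E u v - B v u) < w u v * C u v * (x u)\<^sup>2"
proof -
  let ?W = "V - {u}" and ?y = "x(v := x u + x v)" and ?w = "merge_isolate w v" and ?N = "V - {u, v}"
  have N: "?W - {v} = ?N" by blast
  have vW: "v \<in> ?W" using uv by blast
  have "sum ?y ?W = ?y v + sum ?y ?N"
    using fin vW unfolding N[symmetric] by (intro sum.remove) auto
  moreover have "sum ?y ?N = sum x ?N" by (intro sum.cong) auto
  ultimately have sum1: "sum ?y ?W = 1"
    using sum_two[OF fin uv, of x] weighted_graph_sum[OF wg] by simp
  have wg': "weighted_graph (G ?W ?y ?w)"
  proof (rule weighted_graphI)
    fix a b assume "a \<in> ?W" "b \<in> ?W" "a \<noteq> b"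
    thus "0 \<le> ?w a b \<and> ?w a b \<le> 1 \<and> ?w a b = ?w b a"
      using w_sym[of a b] weighted_graph_edge_nonneg[OF wg, of a b] weighted_graph_edge_le[OF wg, of a b]
      by (simp add: merge_isolate_def)
  next
    fix a assume "a \<in> ?W"
    thus "0 \<le> ?y a" using x_pos uv by (auto intro!: less_imp_le add_pos_pos)
  qed (use fin sum1 in \<open>auto simp: merge_isolate_def\<close>)
  have cW: "card ?W < card V" "card ?W + 1 \<le> card V"
    using card_Suc_Diff1[OF fin uv(1)] by simp_all
  have kf': "K_free t (G ?W ?y ?w)"
  proof (rule K_freeI; unfold wgraph.simps)
    fix S assume S: "clique_above (G ?W ?y ?w) (1/2) S" "S \<noteq> {}"
    have finS: "finite S" using S(1) fin finite_subset[of S V] by (auto simp: clique_above_G)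
    have cl: "clique_above (G V x w) (1/2) (S - {v})"
      using S(1) by (fastforce simp: clique_above_G merge_isolate_def)
    \<comment> \<open>Covers \<open>S = {v}\<close>, where no nonempty clique of the old graph is
      left for the clique bound.\<close>
    have "card V + 1 < t"
    proof -
      have "clique_above (G V x w) (1/2) {u}" using uv(1) by (simp add: clique_above_G)
      from clique_bound[OF this] show ?thesis by simp
    qed
    hence "card V + card (S - {v}) < t"
    proof (cases "S - {v} = {}")
      case True
      show ?thesis using \<open>card V + 1 < t\<close> unfolding True by simp
    qed (rule clique_bound[OF cl])
    moreover have "card S \<le> card (S - {v}) + 1" using card_Suc_Diff1[OF finS, of v] by (cases "v \<in> S") auto
    ultimately show "card ?W + card S < t" using cW(2) by linarith
  qed (use fin in simp)
  have 1: "ws ?y ?w ?N k g = ws x w ?N k g'" if "\<And>t. t \<in> ?N \<Longrightarrow> g t = g' t" for k g g'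
    by (intro ws_cong that) (auto simp: merge_isolate_def)
  have "K_density s (G ?W ?y ?w) = fact s * (ws ?y ?w ?N s (\<lambda>_. 1) + ?y v * ws ?y ?w ?N (s - 1) (?w v))"
    using K_density_single[OF wg' vW, of s] s3 unfolding N by simp
  also have "ws ?y ?w ?N s (\<lambda>_. 1) = ws x w ?N s (\<lambda>_. 1)" by (rule 1) simp
  also have "ws ?y ?w ?N (s - 1) (?w v) = E u v" by (rule 1) (auto simp: merge_isolate_def)
  finally have "fact s * (ws x w ?N s (\<lambda>_. 1) + (x u + x v) * E u v) < K_density s (G V x w)"
    using fewer_vertices_worse[OF wg' kf'] cW(1) by (simp del: fun_upd_apply add: fun_upd_same)
  hence "(x u + x v) * E u v < (x u + x v) * B v u + w u v * C u v * (x u)\<^sup>2"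
    unfolding density_pair'[OF uv] by (simp add: mult_less_cancel_left)
  thus ?thesis by (simp add: algebra_simps)
qed

text \<open>Freeness sees only the thresholds \<open>0\<close> and \<open>1/2\<close>. Rounding up
  to \<open>1/2\<close>, or to \<open>1\<close> if the weight already exceeds \<open>1/2\<close>,
  creates no new clique above \<open>1/2\<close> but raises the density, as \<open>C u v\<close> is
  positive.\<close>

lemma half_or_one:
  assumes uv: "u \<in> V" "v \<in> V" "u \<noteq> v"
  shows "w u v = 1/2 \<or> w u v = 1"
proof (rule ccontr)
  assume *: "\<not> ?thesis"
  define c :: real where "c = (if w u v < 1/2 then 1/2 else 1)"
  let ?N = "V - {u, v}"
  define w' where "w' a b = (if {a, b} = {u, v} then c else w a b)" for a b
  have c: "w u v < c" "0 \<le> c" "c \<le> 1" "1/2 < c \<Longrightarrow> 1/2 < w u v"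
    using * weighted_graph_edge_le[OF wg uv(1,2)] by (auto simp: c_def split: if_splits)
  have wg': "weighted_graph (G V x w')"
  proof (rule weighted_graphI)
    fix a b assume "a \<in> V" "b \<in> V" "a \<noteq> b"
    thus "0 \<le> w' a b \<and> w' a b \<le> 1 \<and> w' a b = w' b a"
      using w_sym[of a b] weighted_graph_edge_nonneg[OF wg, of a b] weighted_graph_edge_le[OF wg, of a b] c
      by (simp add: w'_def insert_commute)
  next
    fix a assume "a \<in> V"
    moreover have "w' a a = w a a" using uv(3) by (auto simp: w'_def doubleton_eq_iff)
    ultimately show "w' a a = 0" using weighted_graph_diag[OF wg] by simp
  qed (use fin weighted_graph_sum[OF wg] weighted_graph_nonneg[OF wg] in auto)
  have kf': "K_free t (G V x w')"
  proof (rule K_freeI; unfold wgraph.simps)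
    fix S assume S: "clique_above (G V x w') (1/2) S" "S \<noteq> {}"
    have "clique_above (G V x w) (1/2) S"
      unfolding clique_above_G
    proof (intro conjI ballI impI)
      show "S \<subseteq> V" using S(1) by (simp add: clique_above_G)
      fix a b assume ab: "a \<in> S" "b \<in> S" "a \<noteq> b"
      hence gt: "1/2 < w' a b" using S(1) by (simp add: clique_above_G)
      show "1/2 < w a b"
      proof (cases "{a, b} = {u, v}")
        case True
        hence "1/2 < w u v" using gt c(4) by (simp add: w'_def)
        thus ?thesis using True w_sym[OF uv(1,2)] by (auto simp: doubleton_eq_iff)
      qed (use gt in \<open>simp add: w'_def\<close>)
    qed
    thus "card V + card S < t" using clique_bound S(2) by blast
  qed (rule fin)
  have 1: "ws x w' ?N k g = ws x w ?N k g'" if "\<And>t. t \<in> ?N \<Longrightarrow> g t = g' t" for k g g'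
    by (intro ws_cong that) (auto simp: w'_def doubleton_eq_iff)
  have g: "w' u t = w u t" "w' v t = w v t" if "t \<in> ?N" for t
    using that by (auto simp: w'_def doubleton_eq_iff)
  have "ws x w' ?N s (\<lambda>_. 1) = ws x w ?N s (\<lambda>_. 1)" by (rule 1) simp
  moreover have "ws x w' ?N (s - 1) (w' u) = B u v" by (rule 1) (rule g)
  moreover have "ws x w' ?N (s - 1) (w' v) = B v u" unfolding swap[of v u] by (rule 1) (rule g)
  moreover have "ws x w' ?N (s - 2) (\<lambda>t. w' u t * w' v t) = C u v" by (rule 1) (simp only: g)
  moreover have "w' u v = c" by (simp add: w'_def)
  moreover have "K_density s (G V x w') = fact s * (ws x w' ?N s (\<lambda>_. 1)
      + x u * ws x w' ?N (s - 1) (w' u) + x v * ws x w' ?N (s - 1) (w' v)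
      + x u * x v * w' u v * ws x w' ?N (s - 2) (\<lambda>t. w' u t * w' v t))"
    using s3 by (intro K_density_pair[OF wg' uv]) simp
  ultimately have "fact s * (ws x w ?N s (\<lambda>_. 1) + x u * B u v + x v * B v u + x u * x v * c * C u v)
      \<le> K_density s (G V x w)"
    using no_better[OF wg' kf'] by simp
  hence "x u * x v * c * C u v \<le> x u * x v * w u v * C u v"
    unfolding density_pair[OF uv] by (simp add: mult_le_cancel_left)
  moreover have "x u * x v * w u v * C u v < x u * x v * c * C u v"
    using x_pos[OF uv(1)] x_pos[OF uv(2)] C_pos[OF uv] c(1)
    by (intro mult_strict_right_mono mult_strict_left_mono) auto
  ultimately show False by simp
qed

section \<open>Pairs of weight one half\<close>

text \<open>Cloning in both directions bounds the second moments \<open>CC u v\<close> and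
  \<open>CC v u\<close> by the mixed moment \<open>C u v\<close>. Added with factors
  \<open>(x v)\<^sup>2\<close> and \<open>(x u)\<^sup>2\<close>, the bounds show that the sum of
  squares \<open>Q\<close>, up to a positive factor, is at most a negative multiple of
  \<open>(x u - x v)\<^sup>2\<close>; so both vanish.\<close>

lemma half_twins:
  assumes uv: "u \<in> V" "v \<in> V" "u \<noteq> v" and half: "w u v = 1/2"
  shows "x u = x v" and "T \<subseteq> V - {u, v} \<Longrightarrow> card T = s - 2 \<Longrightarrow> prod (w u) T = prod (w v) T"
proof -
  let ?N = "V - {u, v}"
  let ?K = "{T. T \<subseteq> ?N \<and> card T = s - 2}"
  let ?p = "prod (w u)" and ?q = "prod (w v)"
  define Q where "Q = (\<Sum>T\<in>?K. cw x w T * (x u * ?p T - x v * ?q T)\<^sup>2)"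
  have fK: "finite ?K" by (rule finite_subset[of _ "Pow V"]) (use fin in auto)
  have cw: "0 < cw x w T" if "T \<in> ?K" for T
    using that by (intro cw_pos x_pos w_pos) auto
  have C: "C u v = (\<Sum>T\<in>?K. cw x w T * (?p T * ?q T))"
    by (simp add: ws_def prod.distrib)
  have CC: "CC u v = (\<Sum>T\<in>?K. cw x w T * (?q T * ?q T))"
    by (simp add: ws_def prod.distrib)
  have CC': "CC v u = (\<Sum>T\<in>?K. cw x w T * (?p T * ?p T))"
    unfolding swap[of v u] by (simp add: ws_def prod.distrib)
  have Q: "Q = (x u)\<^sup>2 * CC v u + (x v)\<^sup>2 * CC u v - 2 * x u * x v * C u v"
    unfolding Q_def C CC CC' sum_distrib_left sum.distrib[symmetric] sum_subtractf[symmetric]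
    by (intro sum.cong refl) (simp add: power2_eq_square algebra_simps)
  have b1: "(x u + x v)\<^sup>2 * CC u v \<le> 4 * C u v * (x u)\<^sup>2"
    using clone_bound[OF uv] half by (simp add: mult_ac)
  have b2: "(x u + x v)\<^sup>2 * CC v u \<le> 4 * C u v * (x v)\<^sup>2"
  proof -
    have "w v u = 1/2" using half w_sym[OF uv(1,2)] by simp
    from clone_bound[OF uv(2,1) uv(3)[symmetric], unfolded this C_swap]
    show ?thesis by (simp add: mult_ac add.commute)
  qed
  have "(x u + x v)\<^sup>2 * Q = (x u)\<^sup>2 * ((x u + x v)\<^sup>2 * CC v u) + (x v)\<^sup>2 * ((x u + x v)\<^sup>2 * CC u v)
      - 2 * x u * x v * C u v * (x u + x v)\<^sup>2"
    unfolding Q by (simp add: algebra_simps)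
  also have "\<dots> \<le> (x u)\<^sup>2 * (4 * C u v * (x v)\<^sup>2) + (x v)\<^sup>2 * (4 * C u v * (x u)\<^sup>2)
      - 2 * x u * x v * C u v * (x u + x v)\<^sup>2"
    using b1 b2 by (intro diff_right_mono add_mono mult_left_mono) auto
  also have "\<dots> = - (2 * x u * x v * C u v * (x u - x v)\<^sup>2)"
    by (simp add: algebra_simps power2_eq_square)
  finally have le: "(x u + x v)\<^sup>2 * Q \<le> - (2 * x u * x v * C u v * (x u - x v)\<^sup>2)" .
  have pos: "0 < 2 * x u * x v * C u v"
    using x_pos[OF uv(1)] x_pos[OF uv(2)] C_pos[OF uv] by simp
  have Q0: "0 \<le> Q"
    unfolding Q_def using cw by (intro sum_nonneg mult_nonneg_nonneg) (auto intro: less_imp_le)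
  hence "0 \<le> (x u + x v)\<^sup>2 * Q" by simp
  with le have "2 * x u * x v * C u v * (x u - x v)\<^sup>2 \<le> 2 * x u * x v * C u v * 0" by linarith
  hence "(x u - x v)\<^sup>2 \<le> 0" using pos by (rule mult_left_le_imp_le)
  thus eq: "x u = x v" by simp
  assume T: "T \<subseteq> ?N" "card T = s - 2"
  have "0 < (x u + x v)\<^sup>2" using x_pos[OF uv(1)] x_pos[OF uv(2)] by simp
  moreover have "(x u + x v)\<^sup>2 * Q \<le> (x u + x v)\<^sup>2 * 0" using le eq by simp
  ultimately have "Q \<le> 0" by (rule mult_left_le_imp_le[rotated])
  hence "Q = 0" using Q0 by simp
  have nn: "0 \<le> cw x w S * (x u * ?p S - x v * ?q S)\<^sup>2" if "S \<in> ?K" for S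
    using cw[OF that] by simp
  have "\<forall>S\<in>?K. cw x w S * (x u * ?p S - x v * ?q S)\<^sup>2 = 0"
    by (rule iffD1[OF sum_nonneg_eq_0_iff[OF fK nn] \<open>Q = 0\<close>[unfolded Q_def]])
  moreover have TK: "T \<in> ?K" using T by simp
  ultimately have "cw x w T * (x u * ?p T - x v * ?q T)\<^sup>2 = 0" by (rule bspec)
  hence "x u * ?p T - x v * ?q T = 0" using cw[OF TK] by simp
  thus "?p T = ?q T" using eq x_pos[OF uv(2)] by simp
qed

text \<open>For twins the clone bound is an equality, so the cloned graph is again extremal on the
  same vertices, and everything proved in the locale applies to it.\<close>

lemma clone_min_extremal:
  assumes uv: "u \<in> V" "v \<in> V" "u \<noteq> v" and half: "w u v = 1/2"
  shows "min_extremal_graph s t V x (blow (id(u := v)) w)"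
proof
  let ?w = "blow (id(u := v)) w"
  note tw = half_twins[OF assms]
  have h: "0 \<le> x u" "0 \<le> x v" "x u + x v = x u + x v" using x_pos[OF uv(1)] x_pos[OF uv(2)] by auto
  have eq: "x(u := x u, v := x v) = x" by simp
  have "CC u v = C u v"
    unfolding ws_def
  proof (rule sum.cong[OF refl])
    fix T assume "T \<in> {T. T \<subseteq> V - {u, v} \<and> card T = s - 2}"
    thus "cw x w T * (\<Prod>t\<in>T. w v t * w v t) = cw x w T * (\<Prod>t\<in>T. w u t * w v t)"
      using tw(2)[of T] by (simp add: prod.distrib)
  qed
  hence "K_density s (G V x ?w) = K_density s (G V x w)"
    using K_density_clone[OF uv h] density_pair'[OF uv] half tw(1)
    unfolding eq by (simp add: power2_eq_square)
  hence "extremal s t (G V x ?w)"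
    using weighted_graph_clone[OF uv h] K_free_clone[OF uv h] density unfolding eq extremal_def by simp
  thus "min_extremal s t (G V x ?w)"
    using min_ext unfolding min_extremal_def by simp
qed (rule s3 st)+

text \<open>If \<open>uv\<close> and \<open>vz\<close> had weight \<open>1/2\<close> but \<open>uz\<close> weight \<open>1\<close>, replacing \<open>u\<close> by a clone of \<open>v\<close>
  would give another extremal graph, in which \<open>v\<close> and \<open>z\<close> would not be twins.\<close>

lemma half_trans:
  assumes V: "u \<in> V" "v \<in> V" "z \<in> V" and ne: "u \<noteq> v" "v \<noteq> z" "u \<noteq> z"
    and half: "w u v = 1/2" "w v z = 1/2"
  shows "w u z = 1/2"
proof (rule ccontr)
  assume "w u z \<noteq> 1/2"
  hence one: "w z u = 1" using half_or_one[OF V(1,3) ne(3)] w_sym[OF V(1,3)] by simp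
  let ?w = "blow (id(u := v)) w"
  interpret R': min_extremal_graph s t V x ?w
    by (rule clone_min_extremal[OF V(1,2) ne(1) half(1)])
  have "card (V - {u, v, z}) = card V - 3"
    using V ne by (subst card_Diff_subset) auto
  hence "s - 3 \<le> card (V - {u, v, z})" using s_le_card by simp
  \<comment> \<open>Twins are known to agree only in products over \<open>s - 2\<close> vertices, so
    \<open>u\<close> is completed by \<open>s - 3\<close> others; this is where
    \<open>3 \<le> s\<close> enters. Applied to \<open>v\<close> and \<open>z\<close>, the original
    graph makes the product of \<open>v\<close> over \<open>T\<close> twice that of
    \<open>z\<close>, while the cloned graph makes them equal.\<close>
  then obtain T where T: "T \<subseteq> V - {u, v, z}" "card T = s - 3" "finite T"
    by (rule obtain_subset_with_card_n)
  have uT: "u \<notin> T" using T by auto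
  have U: "insert u T \<subseteq> V - {v, z}" "card (insert u T) = s - 2"
    using T(1) V ne T(2,3) uT s3 by auto
  have "?w v z = 1/2" using half ne by (simp add: blow_def)
  from half_twins(2)[OF V(2,3) ne(2) half(2) U] R'.half_twins(2)[OF V(2,3) ne(2) this U]
  have *: "w v u * prod (w v) T = w z u * prod (w z) T" "?w v u * prod (?w v) T = ?w z u * prod (?w z) T"
    using T(3) uT by simp_all
  have "prod (?w v) T = prod (w v) T" "prod (?w z) T = prod (w z) T"
    using T ne by (auto intro!: prod.cong simp: blow_def)
  moreover have "?w v u = 1/2" "?w z u = 1/2"
    using half ne w_sym[OF V(2,3)] by (auto simp: blow_def)
  ultimately have "1/2 * prod (w v) T = 1/2 * prod (w z) T" using *(2) by (simp only:)
  moreover have "w v u = 1/2" using half w_sym[OF V(1,2)] by simp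
  hence "1/2 * prod (w v) T = 1 * prod (w z) T" using *(1) one by (simp only:)
  ultimately have "prod (w z) T = 0" by simp
  moreover have "0 < prod (w z) T" using T V ne by (intro prod_pos) (auto intro!: w_pos)
  ultimately show False by simp
qed

section \<open>The partition and its number of parts\<close>

definition half_rel :: "('a \<times> 'a) set" where
  "half_rel = {(u, v). u \<in> V \<and> v \<in> V \<and> (u = v \<or> w u v = 1/2)}"

definition parts :: "'a set set" where
  "parts = V // half_rel"

lemma equiv_half_rel: "equiv V half_rel"
proof (rule equivI)
  show "half_rel \<subseteq> V \<times> V" by (auto simp: half_rel_def)
  show "refl_on V half_rel" by (auto simp: half_rel_def refl_on_def)
  show "sym half_rel" using w_sym by (auto simp: half_rel_def sym_def)
  show "trans half_rel"
  proof (rule transI)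
    fix u v z assume "(u, v) \<in> half_rel" "(v, z) \<in> half_rel"
    thus "(u, z) \<in> half_rel"
      using half_trans[of u v z] unfolding half_rel_def by blast
  qed
qed

lemma partition_parts: "partition_on V parts"
  unfolding parts_def by (rule partition_on_quotient[OF equiv_half_rel])

lemma same_part_iff:
  assumes "u \<in> V" "v \<in> V"
  shows "(\<exists>P\<in>parts. u \<in> P \<and> v \<in> P) \<longleftrightarrow> u = v \<or> w u v = 1/2"
proof
  assume "\<exists>P\<in>parts. u \<in> P \<and> v \<in> P"
  hence "(u, v) \<in> half_rel"
    unfolding parts_def using in_quotient_imp_in_rel[OF equiv_half_rel] by blast
  thus "u = v \<or> w u v = 1/2" by (simp add: half_rel_def)
next
  assume "u = v \<or> w u v = 1/2"
  hence "(u, v) \<in> half_rel" using assms by (simp add: half_rel_def)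
  hence "v \<in> half_rel `` {u}" by simp
  moreover have "u \<in> half_rel `` {u}" using assms(1) by (simp add: half_rel_def)
  moreover have "half_rel `` {u} \<in> parts" unfolding parts_def using assms(1) by (rule quotientI)
  ultimately show "\<exists>P\<in>parts. u \<in> P \<and> v \<in> P" by blast
qed

lemma edge_weight:
  assumes "u \<in> V" "v \<in> V" "u \<noteq> v"
  shows "w u v = (if \<exists>P\<in>parts. u \<in> P \<and> v \<in> P then 1/2 else 1)"
  using half_or_one[OF assms] same_part_iff[OF assms(1,2)] assms(3) by auto

lemma finite_parts: "finite parts"
  using partition_parts fin by (rule finite_elements[rotated])

lemma clique_le_parts:
  assumes "clique_above (G V x w) (1/2) S"
  shows "card S \<le> card parts"
proof (rule card_inj_on_le[of "\<lambda>v. half_rel `` {v}"])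
  have SV: "S \<subseteq> V" using assms by (simp add: clique_above_G)
  show "(\<lambda>v. half_rel `` {v}) ` S \<subseteq> parts"
    unfolding parts_def using SV by (auto intro: quotientI)
  show "inj_on (\<lambda>v. half_rel `` {v}) S"
  proof (rule inj_onI)
    fix a b assume ab: "a \<in> S" "b \<in> S" "half_rel `` {a} = half_rel `` {b}"
    hence "(a, b) \<in> half_rel" using eq_equiv_class[OF ab(3) equiv_half_rel] SV by blast
    moreover have "a \<noteq> b \<Longrightarrow> 1/2 < w a b" using assms ab by (simp add: clique_above_G)
    ultimately show "a = b" unfolding half_rel_def by force
  qed
qed (rule finite_parts)

text \<open>A choice of one vertex from each part is a clique above \<open>1/2\<close>, to which the
  clique bound applies.\<close>

lemma card_parts_less: "card V + card parts < t"
proof -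
  define r where "r P = (SOME v. v \<in> P)" for P :: "'a set"
  have r: "r P \<in> P" if "P \<in> parts" for P
    using that partition_parts unfolding r_def by (metis partition_onD3 someI_ex ex_in_conv)
  have PV: "P \<subseteq> V" if "P \<in> parts" for P
    using that partition_onD1[OF partition_parts] by blast
  have disj: "P = Q" if "P \<in> parts" "Q \<in> parts" "u \<in> P" "u \<in> Q" for P Q u
    using partition_onD2[OF partition_parts] that by (auto simp: disjoint_def)
  have inj: "inj_on r parts"
  proof (rule inj_onI)
    fix P Q assume "P \<in> parts" "Q \<in> parts" "r P = r Q"
    thus "P = Q" using disj[of P Q "r P"] r[of P] r[of Q] by simp
  qed
  have "clique_above (G V x w) (1/2) (r ` parts)"
    unfolding clique_above_G
  proof (intro conjI ballI impI)
    show "r ` parts \<subseteq> V" using r PV by blast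
    fix a b assume "a \<in> r ` parts" "b \<in> r ` parts" and ab: "a \<noteq> b"
    then obtain P Q where P: "P \<in> parts" "a = r P" and Q: "Q \<in> parts" "b = r Q" by blast
    have aV: "a \<in> V" "b \<in> V" using P Q r PV by auto
    have "\<not> (\<exists>M\<in>parts. a \<in> M \<and> b \<in> M)"
    proof
      assume "\<exists>M\<in>parts. a \<in> M \<and> b \<in> M"
      then obtain M where "M \<in> parts" "a \<in> M" "b \<in> M" by blast
      hence "P = M" "Q = M" using disj P Q r by blast+
      thus False using P Q ab by simp
    qed
    hence "w a b = 1" using edge_weight[OF aV ab] by simp
    thus "1/2 < w a b" by simp
  qed
  moreover have "parts \<noteq> {}"
  proof
    assume "parts = {}"
    hence "V = {}" using partition_onD1[OF partition_parts] by simp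
    thus False using s_le_card s3 by simp
  qed
  ultimately have "card V + card (r ` parts) < t" using clique_bound by blast
  thus ?thesis by (simp add: card_image[OF inj])
qed

text \<open>With a unit of the budget left, a vertex could be split into two halves joined with
  weight \<open>1/2\<close>. The terms linear in its weight are unchanged, and the new pair adds a
  positive term.\<close>

lemma card_parts: "card parts + card V = t - 1"
proof (rule ccontr)
  assume "\<not> ?thesis"
  hence lt: "card V + 1 + card parts < t" using card_parts_less by linarith
  obtain u where u: "u \<in> V" using s_le_card s3 by (cases "V = {}") auto
  let ?N = "V - {u}"
  \<comment> \<open>\<open>None\<close> is the new vertex: the type \<open>'a\<close> may have no
    element outside \<open>V\<close>.\<close>
  define f :: "'a option \<Rightarrow> 'a" where "f = case_option u id"
  define V' where "V' = insert None (Some ` V)"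
  define y where "y = case_option (x u / 2) (x(u := x u / 2))"
  let ?w = "blow f w"
  have f: "f None = u" "f (Some a) = a" for a by (auto simp: f_def)
  have y: "y None = x u / 2" "y (Some a) = (x(u := x u / 2)) a" for a by (auto simp: y_def)
  have im: "f ` V' \<subseteq> V" using u by (auto simp: V'_def f)
  have finV': "finite V'" using fin by (simp add: V'_def)
  have cardV': "card V' = card V + 1"
    unfolding V'_def using fin by (subst card_insert_disjoint) (auto simp: card_image)
  have "sum y V' = x u / 2 + sum (x(u := x u / 2)) V"
    unfolding V'_def using fin by (simp add: sum.reindex y)
  also have "sum (x(u := x u / 2)) V = x u / 2 + sum (x(u := x u / 2)) ?N"
    using fin u by (subst sum.remove[of V u]) auto
  also have "sum (x(u := x u / 2)) ?N = sum x ?N" by (intro sum.cong) auto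
  finally have sum1: "sum y V' = 1"
    using sum.remove[OF fin u, of x] weighted_graph_sum[OF wg] by simp
  have wg': "weighted_graph (G V' y ?w)"
  proof (rule weighted_graph_blow[OF wg finV' im _ sum1])
    show "0 \<le> y v" if "v \<in> V'" for v
      using that weighted_graph_nonneg[OF wg] u by (auto simp: V'_def y)
  qed
  have kf': "K_free t (G V' y ?w)"
  proof (rule K_free_blow[OF finV' im])
    fix S assume "clique_above (G V x w) (1/2) S"
    hence "card S \<le> card parts" by (rule clique_le_parts)
    thus "card V' + card S < t" using cardV' lt by linarith
  qed
  have uv: "None \<in> V'" "Some u \<in> V'" "None \<noteq> Some u" using u by (auto simp: V'_def)
  have N: "V' - {None, Some u} = Some ` ?N" by (auto simp: V'_def)
  have 1: "ws y ?w (Some ` ?N) k g = ws x w ?N k g'" if "\<And>t. t \<in> ?N \<Longrightarrow> g (Some t) = g' t" for k g g'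
  proof -
    have "ws y ?w (Some ` ?N) k g = ws (\<lambda>a. y (Some a)) (\<lambda>a b. ?w (Some a) (Some b)) ?N k (\<lambda>a. g (Some a))"
      by (rule ws_image) simp
    also have "\<dots> = ws x w ?N k g'"
      by (rule ws_cong) (use that in \<open>simp_all add: y blow_def f\<close>)
    finally show ?thesis .
  qed
  have g: "?w None (Some t) = w u t" "?w (Some u) (Some t) = w u t" if "t \<in> ?N" for t
    using that by (auto simp: blow_def f)
  have "ws y ?w (Some ` ?N) s (\<lambda>_. 1) = ws x w ?N s (\<lambda>_. 1)" by (rule 1) simp
  moreover have "ws y ?w (Some ` ?N) (s - 1) (?w None) = ws x w ?N (s - 1) (w u)" by (rule 1) (rule g)
  moreover have "ws y ?w (Some ` ?N) (s - 1) (?w (Some u)) = ws x w ?N (s - 1) (w u)" by (rule 1) (rule g)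
  moreover have "ws y ?w (Some ` ?N) (s - 2) (\<lambda>t. ?w None t * ?w (Some u) t)
      = ws x w ?N (s - 2) (\<lambda>t. w u t * w u t)" by (rule 1) (simp only: g)
  moreover have "?w None (Some u) = 1/2" by (simp add: blow_def f)
  moreover have "K_density s (G V' y ?w) = fact s * (ws y ?w (Some ` ?N) s (\<lambda>_. 1)
      + y None * ws y ?w (Some ` ?N) (s - 1) (?w None) + y (Some u) * ws y ?w (Some ` ?N) (s - 1) (?w (Some u))
      + y None * y (Some u) * ?w None (Some u) * ws y ?w (Some ` ?N) (s - 2) (\<lambda>t. ?w None t * ?w (Some u) t))"
    unfolding N[symmetric] using s3 by (intro K_density_pair[OF wg' uv]) simp
  ultimately have "K_density s (G V' y ?w) = fact s * (ws x w ?N s (\<lambda>_. 1) + x u * ws x w ?N (s - 1) (w u)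
      + (x u / 2 * (x u / 2) * (1/2)) * ws x w ?N (s - 2) (\<lambda>t. w u t * w u t))"
    by (simp only: y fun_upd_same) (simp add: algebra_simps)
  moreover have "K_density s (G V x w) = fact s * (ws x w ?N s (\<lambda>_. 1) + x u * ws x w ?N (s - 1) (w u))"
    using K_density_single[OF wg u, of s] s3 by simp
  moreover have "0 < ws x w ?N (s - 2) (\<lambda>t. w u t * w u t)"
  proof (rule ws_pos)
    show "s - 2 \<le> card ?N" using s_le_card fin u by simp
  qed (use fin x_pos w_pos u in auto)
  hence "0 < (x u / 2 * (x u / 2) * (1/2)) * ws x w ?N (s - 2) (\<lambda>t. w u t * w u t)"
    using x_pos[OF u] by simp
  ultimately have "K_density s (G V x w) < K_density s (G V' y ?w)"
    by (simp add: mult_less_cancel_left not_le)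
  thus False using no_better[OF wg' kf'] by simp
qed

section \<open>Sizes and weights of the parts\<close>


abbreviation ksub :: "'a set \<Rightarrow> nat \<Rightarrow> 'a set set" where
  "ksub N k \<equiv> {T. T \<subseteq> N \<and> card T = k}"

lemma finite_ksub: "finite (ksub N k)" if "N \<subseteq> V"
  by (rule finite_subset[of _ "Pow V"]) (use that fin in auto)

lemma part_subset: "P \<in> parts \<Longrightarrow> P \<subseteq> V"
  using partition_onD1[OF partition_parts] by blast

lemma finite_part: "P \<in> parts \<Longrightarrow> finite P"
  using part_subset fin by (blast intro: finite_subset)

lemma parts_disjoint: "P \<in> parts \<Longrightarrow> R \<in> parts \<Longrightarrow> P \<noteq> R \<Longrightarrow> P \<inter> R = {}"
  using partition_onD2[OF partition_parts] by (simp add: disjoint_def)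

lemma edge_in_part:
  assumes "P \<in> parts" "u \<in> P" "v \<in> V" "u \<noteq> v"
  shows "w u v = (if v \<in> P then 1/2 else 1)"
proof -
  have "(\<exists>Q\<in>parts. u \<in> Q \<and> v \<in> Q) \<longleftrightarrow> v \<in> P"
  proof
    assume "\<exists>Q\<in>parts. u \<in> Q \<and> v \<in> Q"
    then obtain Q where Q: "Q \<in> parts" "u \<in> Q" "v \<in> Q" by blast
    have "Q = P" using parts_disjoint[OF Q(1) assms(1)] Q(2) assms(2) by blast
    thus "v \<in> P" using Q by simp
  qed (use assms in blast)
  moreover have "u \<in> V" using part_subset assms(1,2) by blast
  ultimately show ?thesis using edge_weight[OF _ assms(3,4)] by simp
qed

lemma same_weight:
  assumes "P \<in> parts" "u \<in> P" "v \<in> P"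
  shows "x u = x v"
proof (cases "u = v")
  case False
  have V: "u \<in> V" "v \<in> V" using part_subset assms by blast+
  show ?thesis
    by (rule half_twins(1)[OF V False]) (use edge_in_part[OF assms(1,2) V(2) False] assms(3) in simp)
qed simp

lemma prod_edge_part:
  assumes "P \<in> parts" "u \<in> P" "T \<subseteq> V" "u \<notin> T"
  shows "prod (w u) T = (1/2) ^ card (T \<inter> P)"
proof -
  have fT: "finite T" using assms(3) fin by (rule finite_subset)
  have "prod (w u) T = (\<Prod>t\<in>T. if t \<in> P then 1/2 else 1)"
  proof (rule prod.cong[OF refl])
    fix t assume "t \<in> T"
    thus "w u t = (if t \<in> P then 1/2 else 1)"
      using assms by (intro edge_in_part) auto
  qed
  also have "\<dots> = (\<Prod>t\<in>T \<inter> P. 1/2)"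
    by (rule prod.inter_restrict[OF fT, symmetric])
  finally show ?thesis by simp
qed

lemma cw_insert_part:
  assumes "P \<in> parts" "r \<in> P" "T \<subseteq> V" "r \<notin> T"
  shows "cw x w (insert r T) = x r * (1/2) ^ card (T \<inter> P) * cw x w T"
proof -
  have "finite T" using assms(3) fin by (rule finite_subset)
  moreover have "sym_nonneg (insert r T) w"
    by (rule sym_nonneg_subset[OF weighted_graph_sym_nonneg[OF wg]]) (use assms part_subset in blast)
  ultimately show ?thesis
    using cw_insert[of T r w x] assms(4) prod_edge_part[OF assms] by simp
qed

text \<open>Double counting of pairs \<open>(T, r)\<close> with \<open>r \<in> T \<inter> P\<close>.\<close>

lemma sum_remove_part_vertex:
  fixes \<phi> :: "nat \<Rightarrow> nat \<Rightarrow> real"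
  assumes P: "P \<in> parts" and u: "u \<in> P" and N: "N \<subseteq> V" and R: "R \<inter> P = {}"
    and \<phi>: "\<And>l. \<phi> 0 l = 0"
  shows "(\<Sum>T\<in>ksub N (Suc j). cw x w T * \<phi> (card (T \<inter> P)) (card (T \<inter> R)))
    = (\<Sum>T\<in>ksub N j. cw x w T * (x u * (1/2) ^ card (T \<inter> P) * real (card (N \<inter> P) - card (T \<inter> P))
        * (\<phi> (Suc (card (T \<inter> P))) (card (T \<inter> R)) / real (Suc (card (T \<inter> P))))))"
proof -
  \<comment> \<open>Division by \<open>card (T \<inter> P)\<close> spreads the term of
    \<open>T\<close> evenly over the vertices \<open>r\<close>. Sets disjoint from \<open>P\<close>
    get no \<open>r\<close>, which is harmless because \<open>\<phi>\<close> vanishes at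
    \<open>0\<close>.\<close>
  define h where "h T = cw x w T * (\<phi> (card (T \<inter> P)) (card (T \<inter> R)) / real (card (T \<inter> P)))" for T
  have finT: "finite T" if "T \<subseteq> N" for T using that N fin by (meson finite_subset)
  have "(\<Sum>T\<in>ksub N (Suc j). cw x w T * \<phi> (card (T \<inter> P)) (card (T \<inter> R)))
      = (\<Sum>T\<in>ksub N (Suc j). \<Sum>r\<in>T \<inter> P. h T)"
  proof (rule sum.cong[OF refl])
    fix T assume "T \<in> ksub N (Suc j)"
    show "cw x w T * \<phi> (card (T \<inter> P)) (card (T \<inter> R)) = (\<Sum>r\<in>T \<inter> P. h T)"
      by (cases "card (T \<inter> P) = 0") (simp_all add: h_def \<phi>)
  qed
  also have "\<dots> = (\<Sum>(T, r)\<in>Sigma (ksub N (Suc j)) (\<lambda>T. T \<inter> P). h T)"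
    using finite_ksub[OF N] finT by (intro sum.Sigma) auto
  also have "\<dots> = (\<Sum>(T, r)\<in>Sigma (ksub N j) (\<lambda>T. (N \<inter> P) - T). h (insert r T))"
  proof (rule sum.reindex_bij_witness[of _ "\<lambda>(T, r). (insert r T, r)" "\<lambda>(T, r). (T - {r}, r)"])
    fix a assume a: "a \<in> Sigma (ksub N (Suc j)) (\<lambda>T. T \<inter> P)"
    then obtain T r where Tr: "a = (T, r)" "T \<subseteq> N" "card T = Suc j" "r \<in> T" "r \<in> P" by auto
    show "(case case a of (T, r) \<Rightarrow> (T - {r}, r) of (T, r) \<Rightarrow> (insert r T, r)) = a"
      using Tr(4) by (simp add: Tr(1) insert_absorb)
    show "(case a of (T, r) \<Rightarrow> (T - {r}, r)) \<in> Sigma (ksub N j) (\<lambda>T. (N \<inter> P) - T)"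
      using Tr finT[OF Tr(2)] by auto
    show "(case case a of (T, r) \<Rightarrow> (T - {r}, r) of (T, r) \<Rightarrow> h (insert r T)) = (case a of (T, r) \<Rightarrow> h T)"
      using Tr(4) by (simp add: Tr(1) insert_absorb)
  next
    fix b assume b: "b \<in> Sigma (ksub N j) (\<lambda>T. (N \<inter> P) - T)"
    then obtain T r where Tr: "b = (T, r)" "T \<subseteq> N" "card T = j" "r \<notin> T" "r \<in> N" "r \<in> P" by auto
    show "(case case b of (T, r) \<Rightarrow> (insert r T, r) of (T, r) \<Rightarrow> (T - {r}, r)) = b"
      using Tr(4) by (simp add: Tr(1))
    show "(case b of (T, r) \<Rightarrow> (insert r T, r)) \<in> Sigma (ksub N (Suc j)) (\<lambda>T. T \<inter> P)"
      using Tr finT[OF Tr(2)] by auto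
  qed
  also have "\<dots> = (\<Sum>T\<in>ksub N j. \<Sum>r\<in>(N \<inter> P) - T. h (insert r T))"
    using finite_ksub[OF N] finT[of N] by (intro sum.Sigma[symmetric]) auto
  also have "\<dots> = (\<Sum>T\<in>ksub N j. cw x w T * (x u * (1/2) ^ card (T \<inter> P) * real (card (N \<inter> P) - card (T \<inter> P))
        * (\<phi> (Suc (card (T \<inter> P))) (card (T \<inter> R)) / real (Suc (card (T \<inter> P))))))"
  proof (rule sum.cong[OF refl])
    fix T assume "T \<in> ksub N j"
    hence T: "T \<subseteq> N" "finite T" using finT by auto
    let ?c = "x u * (1/2) ^ card (T \<inter> P) * cw x w T * (\<phi> (Suc (card (T \<inter> P))) (card (T \<inter> R)) / real (Suc (card (T \<inter> P))))"
    have "h (insert r T) = ?c" if r: "r \<in> (N \<inter> P) - T" for r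
    proof -
      have "card (insert r T \<inter> P) = Suc (card (T \<inter> P))"
        using r T(2) by (simp add: Int_insert_left)
      moreover have "insert r T \<inter> R = T \<inter> R" using r R by blast
      moreover have "cw x w (insert r T) = x r * (1/2) ^ card (T \<inter> P) * cw x w T"
        using r T(1) N by (intro cw_insert_part[OF P]) auto
      moreover have "x r = x u" using same_weight[OF P] r u by blast
      ultimately show ?thesis by (simp add: h_def)
    qed
    hence "(\<Sum>r\<in>(N \<inter> P) - T. h (insert r T)) = (\<Sum>r\<in>(N \<inter> P) - T. ?c)"
      by (rule sum.cong[OF refl])
    also have "\<dots> = real (card ((N \<inter> P) - T)) * ?c" by (simp only: sum_constant)
    also have "card ((N \<inter> P) - T) = card (N \<inter> P) - card (T \<inter> P)"
    proof -
      have eq: "(N \<inter> P) - T = (N \<inter> P) - (T \<inter> P)" by blast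
      show ?thesis unfolding eq using T by (intro card_Diff_subset) auto
    qed
    finally show "(\<Sum>r\<in>(N \<inter> P) - T. h (insert r T)) = cw x w T * (x u * (1/2) ^ card (T \<inter> P)
        * real (card (N \<inter> P) - card (T \<inter> P))
        * (\<phi> (Suc (card (T \<inter> P))) (card (T \<inter> R)) / real (Suc (card (T \<inter> P)))))"
      by (simp add: mult_ac)
  qed
  finally show ?thesis .
qed

section \<open>Larger parts have lighter vertices\<close>

text \<open>Sorting sets by their intersections with two parts allows a profile
  \<open>(k, l)\<close> to be compared with its mirror image \<open>(l, k)\<close>.\<close>

definition level :: "'a set \<Rightarrow> 'a set \<Rightarrow> 'a set \<Rightarrow> nat \<Rightarrow> nat \<Rightarrow> nat \<Rightarrow> real" where
  "level N P R k l j = (\<Sum>T\<in>ksub N j. cw x w T * (if card (T \<inter> P) = k \<and> card (T \<inter> R) = l then 1 else 0))"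

lemma level_nonneg: "N \<subseteq> V \<Longrightarrow> 0 \<le> level N P R k l j"
  unfolding level_def
  by (intro sum_nonneg mult_nonneg_nonneg cw_nonneg)
    (auto intro!: weighted_graph_nonneg[OF wg] weighted_graph_edge_nonneg[OF wg])

lemma level_swap: "level N R P l k j = level N P R k l j"
  unfolding level_def by (intro sum.cong refl) (auto simp: conj_commute)

lemma level_Suc_0: "N \<subseteq> V \<Longrightarrow> level N P R (Suc k) l 0 = 0"
  unfolding level_def
proof (intro sum.neutral ballI)
  fix T assume "N \<subseteq> V" "T \<in> ksub N 0"
  hence "T = {}" using fin by (auto dest: finite_subset)
  thus "cw x w T * (if card (T \<inter> P) = Suc k \<and> card (T \<inter> R) = l then 1 else 0) = 0" by simp
qed

lemma level_Suc:
  assumes P: "P \<in> parts" and u: "u \<in> P" and N: "N \<subseteq> V" and R: "R \<inter> P = {}"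
  shows "level N P R (Suc k) l (Suc j)
    = x u * (1/2) ^ k * real (card (N \<inter> P) - k) / real (Suc k) * level N P R k l j"
proof -
  have "level N P R (Suc k) l (Suc j) = (\<Sum>T\<in>ksub N j. cw x w T * (x u * (1/2) ^ card (T \<inter> P) * real (card (N \<inter> P) - card (T \<inter> P))
        * ((if Suc (card (T \<inter> P)) = Suc k \<and> card (T \<inter> R) = l then 1 else 0) / real (Suc (card (T \<inter> P))))))"
    unfolding level_def
    by (rule sum_remove_part_vertex[OF P u N R, of "\<lambda>a b. if a = Suc k \<and> b = l then 1 else 0"]) simp
  also have "\<dots> = x u * (1/2) ^ k * real (card (N \<inter> P) - k) / real (Suc k) * level N P R k l j"
    unfolding level_def sum_distrib_left by (intro sum.cong refl) auto
  finally show ?thesis .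
qed

text \<open>Peeling one vertex off the part with the surplus multiplies the level by a factor that
  grows with vertex weight and part size. After \<open>d\<close> peelings both profiles are
  \<open>(l, l)\<close>.\<close>

lemma level_le:
  assumes P: "P \<in> parts" "u \<in> P" and R: "R \<in> parts" "v \<in> R" and ne: "P \<noteq> R" and N: "N \<subseteq> V"
    and card: "card (N \<inter> R) \<le> card (N \<inter> P)" and weight: "x v \<le> x u"
  shows "level N P R l (l + d) j \<le> level N P R (l + d) l j"
proof (induction d arbitrary: j)
  case (Suc d)
  have disj: "R \<inter> P = {}" "P \<inter> R = {}" using parts_disjoint[OF P(1) R(1) ne] by auto
  show ?case
  proof (cases j)
    case 0
    thus ?thesis using level_Suc_0[OF N, of R P "l + d" l] level_Suc_0[OF N, of P R "l + d" l]
      by (simp add: level_swap[of N R P])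
  next
    case (Suc j')
    let ?c = "\<lambda>a n. a * (1/2) ^ (l + d) * real (n - (l + d)) / real (Suc (l + d))"
    have "level N P R l (l + Suc d) j = ?c (x v) (card (N \<inter> R)) * level N P R l (l + d) j'"
      using level_Suc[OF R N disj(2), of "l + d" l j'] by (simp add: Suc level_swap[of N R P])
    also have "\<dots> \<le> ?c (x u) (card (N \<inter> P)) * level N P R (l + d) l j'"
    proof (rule mult_mono[OF _ Suc.IH])
      have "0 \<le> x u" "0 \<le> x v" using x_pos part_subset P R by (meson less_imp_le subsetD)+
      thus "?c (x v) (card (N \<inter> R)) \<le> ?c (x u) (card (N \<inter> P))" "0 \<le> ?c (x u) (card (N \<inter> P))"
        using weight card by (auto intro!: divide_right_mono mult_mono)
    qed (rule level_nonneg[OF N])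
    also have "\<dots> = level N P R (l + Suc d) l j"
      using level_Suc[OF P N disj(1), of "l + d" l j'] by (simp add: Suc)
    finally show ?thesis .
  qed
qed simp

text \<open>Adding the sum to its transpose turns the terms into
  \<open>(f l - f k) * (a k l - a l k)\<close>, products of two numbers that never have opposite
  signs.\<close>

lemma sum_antisym_nonneg:
  fixes f :: "nat \<Rightarrow> real" and a :: "nat \<Rightarrow> nat \<Rightarrow> real"
  assumes dec: "\<And>k l. l \<le> k \<Longrightarrow> f k \<le> f l" and a: "\<And>k l. l \<le> k \<Longrightarrow> a l k \<le> a k l"
  shows "0 \<le> (\<Sum>k\<le>M. \<Sum>l\<le>M. (f l - f k) * a k l)"
proof -
  let ?S = "\<Sum>k\<le>M. \<Sum>l\<le>M. (f l - f k) * a k l"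
  have "?S = (\<Sum>k\<le>M. \<Sum>l\<le>M. (f k - f l) * a l k)" by (rule sum.swap)
  hence "?S + ?S = ?S + (\<Sum>k\<le>M. \<Sum>l\<le>M. (f k - f l) * a l k)" by (rule arg_cong)
  also have "\<dots> = (\<Sum>k\<le>M. \<Sum>l\<le>M. (f l - f k) * a k l + (f k - f l) * a l k)"
    by (simp only: sum.distrib)
  also have "\<dots> = (\<Sum>k\<le>M. \<Sum>l\<le>M. (f l - f k) * (a k l - a l k))"
    by (intro sum.cong refl) (simp add: algebra_simps)
  finally have "?S + ?S = (\<Sum>k\<le>M. \<Sum>l\<le>M. (f l - f k) * (a k l - a l k))" .
  moreover have "0 \<le> (f l - f k) * (a k l - a l k)" for k l
    using dec[of l k] dec[of k l] a[of l k] a[of k l]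
    by (cases "l \<le> k") (auto intro: mult_nonneg_nonneg mult_nonpos_nonpos)
  hence "0 \<le> (\<Sum>k\<le>M. \<Sum>l\<le>M. (f l - f k) * (a k l - a l k))" by (intro sum_nonneg)
  ultimately show ?thesis by linarith
qed

text \<open>If the larger part were also the heavier one, sets would tend to meet it more often, and
  the factors \<open>1/2\<close> would force \<open>B u v \<le> B v u\<close>. The Lagrange
  condition, however, gives the heavier vertex the larger coefficient.\<close>

lemma larger_part_lighter:
  assumes P: "P \<in> parts" "u \<in> P" and R: "R \<in> parts" "v \<in> R" and card: "card R \<le> card P"
  shows "x u \<le> x v"
proof (cases "P = R")
  case True
  thus ?thesis using same_weight[OF P, of v] R(2) by simp
next
  case False
  note disj = parts_disjoint[OF P(1) R(1) False]
  have uv: "u \<in> V" "v \<in> V" "u \<noteq> v"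
    using subsetD[OF part_subset[OF P(1)] P(2)] subsetD[OF part_subset[OF R(1)] R(2)] P(2) R(2) disj by auto
  let ?N = "V - {u, v}"
  have NV: "?N \<subseteq> V" by blast
  show ?thesis
  proof (rule ccontr)
    assume "\<not> ?thesis"
    hence lt: "x v < x u" by simp
    have NP: "?N \<inter> P = P - {u}" "?N \<inter> R = R - {v}"
      using part_subset[OF P(1)] part_subset[OF R(1)] P(2) R(2) disj by blast+
    have cN: "card (?N \<inter> R) \<le> card (?N \<inter> P)" unfolding NP using card P R by simp
    have le: "level ?N P R l k j \<le> level ?N P R k l j" if "l \<le> k" for k l j
      using level_le[OF P R False NV cN less_imp_le[OF lt], of l "k - l" j] that by simp
    let ?f = "\<lambda>k. (1/2 :: real) ^ k"
    have "B v u - B u v = (\<Sum>T\<in>ksub ?N (s - 1). cw x w T * (?f (card (T \<inter> R)) - ?f (card (T \<inter> P))))"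
    proof -
      have "prod (w u) T = ?f (card (T \<inter> P))" "prod (w v) T = ?f (card (T \<inter> R))" if "T \<in> ksub ?N (s - 1)" for T
        using that by (auto intro!: prod_edge_part P R)
      thus ?thesis
        unfolding ws_def swap[of v u] sum_subtractf[symmetric]
        by (intro sum.cong refl) (simp add: algebra_simps)
    qed
    also have "\<dots> = (\<Sum>q\<in>{..card V} \<times> {..card V}. \<Sum>T | T \<in> ksub ?N (s - 1) \<and> (card (T \<inter> P), card (T \<inter> R)) = q.
        cw x w T * (?f (card (T \<inter> R)) - ?f (card (T \<inter> P))))"
    proof (rule sum.group[symmetric])
      show "finite (ksub ?N (s - 1))" by (rule finite_ksub[OF NV])
      show "(\<lambda>T. (card (T \<inter> P), card (T \<inter> R))) ` ksub ?N (s - 1) \<subseteq> {..card V} \<times> {..card V}"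
        using fin by (auto intro!: card_mono)
    qed simp
    also have "\<dots> = (\<Sum>(k, l)\<in>{..card V} \<times> {..card V}. (?f l - ?f k) * level ?N P R k l (s - 1))"
    proof (rule sum.cong[OF refl])
      fix q assume "q \<in> {..card V} \<times> {..card V}"
      obtain k l where q: "q = (k, l)" by (cases q)
      have "(\<Sum>T | T \<in> ksub ?N (s - 1) \<and> (card (T \<inter> P), card (T \<inter> R)) = q.
          cw x w T * (?f (card (T \<inter> R)) - ?f (card (T \<inter> P))))
        = (\<Sum>T\<in>ksub ?N (s - 1). if (card (T \<inter> P), card (T \<inter> R)) = q
          then cw x w T * (?f (card (T \<inter> R)) - ?f (card (T \<inter> P))) else 0)"
        by (rule sum.inter_filter[OF finite_ksub[OF NV]])
      also have "\<dots> = (?f l - ?f k) * level ?N P R k l (s - 1)"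
        unfolding level_def sum_distrib_left q by (intro sum.cong refl) auto
      finally show "(\<Sum>T | T \<in> ksub ?N (s - 1) \<and> (card (T \<inter> P), card (T \<inter> R)) = q.
          cw x w T * (?f (card (T \<inter> R)) - ?f (card (T \<inter> P))))
        = (case q of (k, l) \<Rightarrow> (?f l - ?f k) * level ?N P R k l (s - 1))" by (simp add: q)
    qed
    also have "\<dots> = (\<Sum>k\<le>card V. \<Sum>l\<le>card V. (?f l - ?f k) * level ?N P R k l (s - 1))"
      by (rule sum.cartesian_product[symmetric])
    also have "0 \<le> \<dots>"
      by (rule sum_antisym_nonneg[OF _ le]) (auto intro: power_decreasing)
    finally have "B u v \<le> B v u" by simp
    moreover have "0 < w u v * C u v * (x u - x v)"
      using w_pos[OF uv] C_pos[OF uv] lt by simp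
    ultimately show False using lagrange[OF uv] by (simp add: algebra_simps)
  qed
qed

section \<open>Bounds on the sizes of the parts\<close>

text \<open>Brings the merging inequality to \<open>(s-2)\<close>-sets, where \<open>C u v\<close>
  lives. The double counting applies because the defect \<open>1 - (1/2) ^ k\<close> vanishes at
  \<open>k = 0\<close>.\<close>

lemma E_minus_B:
  assumes P: "P \<in> parts" "u \<in> P"
  shows "E u v - B u v = x u * (\<Sum>T\<in>ksub (V - {u, v}) (s - 2). cw x w T *
    ((1/2) ^ card (T \<inter> P) * real (card ((V - {u, v}) \<inter> P) - card (T \<inter> P)) * psi (card (T \<inter> P))))"
proof -
  let ?N = "V - {u, v}"
  have s: "s - 1 = Suc (s - 2)" using s3 by simp
  have "E u v - B u v = (\<Sum>T\<in>ksub ?N (Suc (s - 2)). cw x w T * (1 - (1/2) ^ card (T \<inter> P)))"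
    unfolding ws_def sum_subtractf[symmetric] s
  proof (rule sum.cong[OF refl])
    fix T assume "T \<in> ksub ?N (Suc (s - 2))"
    hence "prod (w u) T = (1/2) ^ card (T \<inter> P)" by (intro prod_edge_part P) auto
    thus "cw x w T * (\<Prod>t\<in>T. 1) - cw x w T * prod (w u) T = cw x w T * (1 - (1/2) ^ card (T \<inter> P))"
      by (simp add: algebra_simps)
  qed
  also have "\<dots> = (\<Sum>T\<in>ksub ?N (s - 2). cw x w T * (x u * (1/2) ^ card (T \<inter> P) * real (card (?N \<inter> P) - card (T \<inter> P))
        * ((1 - (1/2) ^ Suc (card (T \<inter> P))) / real (Suc (card (T \<inter> P))))))"
    by (rule sum_remove_part_vertex[OF P, of ?N "{}" "\<lambda>k l. 1 - (1/2) ^ k"]) auto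
  finally show ?thesis unfolding psi_def sum_distrib_left by (simp add: mult_ac)
qed

lemma sum_ge_two_terms:
  fixes f :: "'b \<Rightarrow> real"
  assumes "finite A" "a \<in> A" "b \<in> A" "a \<noteq> b" "\<And>c. c \<in> A \<Longrightarrow> c \<noteq> a \<Longrightarrow> 0 \<le> f c"
  shows "f a + f b \<le> sum f A"
proof -
  have "0 \<le> sum f (A - {a, b})" using assms(5) by (intro sum_nonneg) auto
  thus ?thesis using sum_two[OF assms(1-4), of f] by linarith
qed

text \<open>A part with at least \<open>s\<close> vertices is improved by merging two of its vertices \<open>u\<close>, \<open>v\<close> and making
  the result a part of its own, unless it has exactly \<open>s\<close> vertices and is the only part.\<close>

lemma large_part_merge:
  assumes P: "P \<in> parts" "u \<in> P" "v \<in> P" "u \<noteq> v"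
  defines "k \<equiv> card P - 2"
  defines "g \<equiv> \<lambda>T. cw x w T * ((1/2) ^ card (T \<inter> P) *
    (4 * (real (k - card (T \<inter> P)) * psi (card (T \<inter> P))) - (1/2) ^ card (T \<inter> P)))"
  shows "sum g (ksub (V - {u, v}) (s - 2)) < 0"
    and "T \<subseteq> V \<Longrightarrow> card (T \<inter> P) < k \<Longrightarrow> cw x w T * (1/4) ^ card (T \<inter> P) \<le> g T"
proof -
  let ?N = "V - {u, v}"
  let ?p = "\<lambda>T. card (T \<inter> P)"
  have V: "u \<in> V" "v \<in> V" using part_subset[OF P(1)] P(2,3) by auto
  have half: "w u v = 1/2" using edge_in_part[OF P(1,2) V(2) P(4)] P(3) by simp
  have xeq: "x v = x u" by (rule same_weight[OF P(1,3,2)])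
  have "?N \<inter> P = P - {u, v}" using part_subset[OF P(1)] by blast
  hence cN: "card (?N \<inter> P) = k" using P finite_part[OF P(1)] by (simp add: k_def card_Diff_subset)
  have xu: "0 < x u" by (rule x_pos[OF V(1)])
  let ?S = "\<Sum>T\<in>ksub ?N (s - 2). cw x w T * ((1/2) ^ ?p T * real (k - ?p T) * psi (?p T))"
  have "E u v - B v u = x u * ?S"
    using E_minus_B[OF P(1,3), of u] unfolding swap[of v u] cN xeq by simp
  \<comment> \<open>The later factor \<open>4\<close> is \<open>2\<close> from the doubled weight
    \<open>x u + x u\<close> times \<open>2\<close> from the edge weight \<open>1/2\<close>.\<close>
  with merge_bound[OF V P(4)] have "(x u + x u) * (x u * ?S) < 1/2 * C u v * (x u)\<^sup>2"
    unfolding half xeq by simp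
  hence "(x u)\<^sup>2 * (4 * ?S) < (x u)\<^sup>2 * C u v" by (simp add: power2_eq_square algebra_simps)
  hence lt: "4 * ?S < C u v" using xu by (simp add: mult_less_cancel_left_pos)
  have "C u v = (\<Sum>T\<in>ksub ?N (s - 2). cw x w T * ((1/2) ^ ?p T * (1/2) ^ ?p T))"
    unfolding ws_def
  proof (rule sum.cong[OF refl])
    fix T assume T: "T \<in> ksub ?N (s - 2)"
    have "prod (w u) T = (1/2) ^ ?p T" "prod (w v) T = (1/2) ^ ?p T"
      using T by (auto intro!: prod_edge_part P)
    thus "cw x w T * (\<Prod>t\<in>T. w u t * w v t) = cw x w T * ((1/2) ^ ?p T * (1/2) ^ ?p T)"
      by (simp add: prod.distrib)
  qed
  moreover have "sum g (ksub ?N (s - 2)) = 4 * ?S - (\<Sum>T\<in>ksub ?N (s - 2). cw x w T * ((1/2) ^ ?p T * (1/2) ^ ?p T))"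
    unfolding g_def sum_distrib_left sum_subtractf[symmetric]
    by (intro sum.cong refl) (simp add: algebra_simps)
  ultimately show "sum g (ksub ?N (s - 2)) < 0" using lt by simp
  assume T: "T \<subseteq> V" "?p T < k"
  have "psi (?p T) \<le> real (k - ?p T) * psi (?p T)"
    using mult_right_mono[of 1 "real (k - ?p T)" "psi (?p T)"] T(2) psi_nonneg by simp
  hence "(1/2) ^ ?p T \<le> 4 * (real (k - ?p T) * psi (?p T)) - (1/2) ^ ?p T"
    using psi_ge[of "?p T"] by linarith
  hence "(1/2) ^ ?p T * (1/2) ^ ?p T \<le> (1/2) ^ ?p T * (4 * (real (k - ?p T) * psi (?p T)) - (1/2) ^ ?p T)"
    by (intro mult_left_mono) auto
  moreover have "0 \<le> cw x w T"
    using T(1) by (intro cw_nonneg weighted_graph_nonneg[OF wg] weighted_graph_edge_nonneg[OF wg]) auto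
  ultimately show "cw x w T * (1/4) ^ ?p T \<le> g T"
    unfolding g_def by (intro mult_left_mono) (simp_all flip: power_mult_distrib)
qed

lemma cw_nonneg_V: "T \<subseteq> V \<Longrightarrow> 0 \<le> cw x w T"
  by (intro cw_nonneg weighted_graph_nonneg[OF wg] weighted_graph_edge_nonneg[OF wg]) auto

text \<open>If \<open>card P > s\<close>, a set of \<open>s - 2\<close> vertices cannot exhaust the
  \<open>card P - 2\<close> vertices of \<open>P\<close> other than \<open>u\<close>,
  \<open>v\<close>, so no term of the negative sum is negative.\<close>

lemma card_part_le:
  assumes P: "P \<in> parts"
  shows "card P \<le> s"
proof (rule ccontr)
  assume gt: "\<not> card P \<le> s"
  obtain U where U: "U \<subseteq> P" "card U = 2"
    using obtain_subset_with_card_n[of 2 P] gt s3 by (metis nat_le_linear le_trans numeral_le_iff semiring_norm(69) semiring_norm(72))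
  obtain u v where uv: "u \<in> P" "v \<in> P" "u \<noteq> v" using U by (auto simp: card_2_iff)
  note m = large_part_merge[OF P uv]
  have "0 \<le> sum (\<lambda>T. cw x w T * ((1/2) ^ card (T \<inter> P) *
      (4 * (real (card P - 2 - card (T \<inter> P)) * psi (card (T \<inter> P))) - (1/2) ^ card (T \<inter> P)))) (ksub (V - {u, v}) (s - 2))"
  proof (rule sum_nonneg)
    fix T assume T: "T \<in> ksub (V - {u, v}) (s - 2)"
    hence TV: "T \<subseteq> V" "finite T" using fin by (auto intro: finite_subset)
    have "card (T \<inter> P) \<le> card T" using TV by (intro card_mono) auto
    hence "card (T \<inter> P) < card P - 2" using T gt s3 by simp
    from m(2)[OF TV(1) this] cw_nonneg_V[OF TV(1)]
    show "0 \<le> cw x w T * ((1/2) ^ card (T \<inter> P) *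
      (4 * (real (card P - 2 - card (T \<inter> P)) * psi (card (T \<inter> P))) - (1/2) ^ card (T \<inter> P)))"
      by (meson mult_nonneg_nonneg order_trans zero_le_divide_1_iff zero_le_numeral zero_le_power)
  qed
  thus False using m(1) by simp
qed

text \<open>Only \<open>T0 = P - {u, v}\<close> exhausts \<open>P\<close> and contributes a negative
  term. Exchanging one of its vertices \<open>r\<close> for a vertex \<open>z\<close> of another
  part gives \<open>T1\<close>, whose term compensates because \<open>z\<close> is at least as heavy
  as \<open>r\<close>.\<close>

lemma card_part_eq_s:
  assumes P: "P \<in> parts" and card: "card P = s"
  shows "parts = {P}"
proof (rule ccontr)
  assume "parts \<noteq> {P}"
  then obtain Q where Q: "Q \<in> parts" "Q \<noteq> P" using P by blast
  obtain z where z: "z \<in> Q" using Q(1) partition_onD3[OF partition_parts] by (metis ex_in_conv)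
  have disj: "Q \<inter> P = {}" by (rule parts_disjoint[OF Q(1) P Q(2)])
  have finP: "finite P" by (rule finite_part[OF P])
  obtain U where "U \<subseteq> P" "card U = 3"
    using obtain_subset_with_card_n[of 3 P] card s3 by blast
  then obtain u v r where uvr: "u \<in> P" "v \<in> P" "u \<noteq> v" "r \<in> P" "u \<noteq> r" "v \<noteq> r"
    by (auto simp: card_3_iff)
  let ?N = "V - {u, v}"
  define g where "g T = cw x w T * ((1/2) ^ card (T \<inter> P) *
      (4 * (real (card P - 2 - card (T \<inter> P)) * psi (card (T \<inter> P))) - (1/2) ^ card (T \<inter> P)))" for T
  have neg: "sum g (ksub ?N (s - 2)) < 0"
    using large_part_merge(1)[OF P uvr(1-3)] unfolding g_def .
  have ge: "cw x w T * (1/4) ^ card (T \<inter> P) \<le> g T" if "T \<subseteq> V" "card (T \<inter> P) < s - 2" for T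
    using large_part_merge(2)[OF P uvr(1-3) that(1)] that(2) card unfolding g_def by simp
  define T0 where "T0 = P - {u, v}"
  define S where "S = T0 - {r}"
  define T1 where "T1 = insert z S"
  have PV: "P \<subseteq> V" by (rule part_subset[OF P])
  have zV: "z \<in> V" using part_subset[OF Q(1)] z by blast
  have zP: "z \<notin> P" using disj z by blast
  have cT0: "card T0 = s - 2" using uvr finP card by (simp add: T0_def card_Diff_subset)
  have rT0: "r \<in> T0" using uvr by (simp add: T0_def)
  have finT0: "finite T0" using finP by (simp add: T0_def)
  have cS: "card S = s - 3" using cT0 rT0 finT0 by (simp add: S_def)
  have SP: "S \<subseteq> P" "S \<subseteq> V" "finite S" using PV finT0 by (auto simp: S_def T0_def)
  have T0_ins: "T0 = insert r S" using rT0 by (auto simp: S_def)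
  have zS: "z \<notin> S" using SP zP by blast
  have rS: "r \<notin> S" by (simp add: S_def)
  have mem: "T0 \<in> ksub ?N (s - 2)" "T1 \<in> ksub ?N (s - 2)"
    using cT0 cS PV zV zP uvr SP zS s3 by (auto simp: T0_def T1_def S_def)
  have "T0 \<noteq> T1" using zP unfolding T1_def T0_def by blast
  moreover have "0 \<le> g T" if T: "T \<in> ksub ?N (s - 2)" "T \<noteq> T0" for T
  proof -
    have TV: "T \<subseteq> V" "finite T" using T fin by (auto intro: finite_subset)
    have "card (T \<inter> P) < s - 2"
    proof (rule ccontr)
      assume "\<not> ?thesis"
      hence "T \<inter> P = T" using T(1) TV(2) by (intro card_seteq) auto
      hence "T \<subseteq> T0" using T(1) by (auto simp: T0_def)
      hence "T = T0" using T(1) cT0 finT0 by (intro card_subset_eq) auto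
      thus False using T(2) by simp
    qed
    from ge[OF TV(1) this] cw_nonneg_V[OF TV(1)] show ?thesis
      by (meson mult_nonneg_nonneg order_trans zero_le_divide_1_iff zero_le_numeral zero_le_power)
  qed
  ultimately have le: "g T0 + g T1 \<le> sum g (ksub ?N (s - 2))"
    using mem by (intro sum_ge_two_terms finite_ksub) auto
  define c where "c = cw x w S"
  have c: "0 \<le> c" unfolding c_def by (rule cw_nonneg_V[OF SP(2)])
  have int: "T0 \<inter> P = T0" "T1 \<inter> P = S" "S \<inter> P = S" "S \<inter> Q = {}"
    using zP SP disj by (auto simp: T0_def T1_def)
  have "cw x w T0 = x r * (1/2) ^ (s - 3) * c"
    unfolding T0_ins c_def using cw_insert_part[OF P uvr(4) SP(2) rS] int(3) cS by simp
  hence g0: "g T0 = - (x r * c * (1/2) ^ (s - 3) * (1/4) ^ (s - 2))"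
    unfolding g_def int cT0 card by (simp add: mult_ac flip: power_mult_distrib)
  have cw1: "cw x w T1 = x z * c"
    unfolding T1_def c_def using cw_insert_part[OF Q(1) z SP(2) zS] int(4) by simp
  have "card (T1 \<inter> P) < s - 2" unfolding int cS using s3 by simp
  from ge[OF _ this] have g1: "x z * c * (1/4) ^ (s - 3) \<le> g T1"
    unfolding int cS cw1 using SP(2) zV by (simp add: T1_def)
  have rz: "x r \<le> x z"
    using larger_part_lighter[OF P uvr(4) Q(1) z] card_part_le[OF Q(1)] card by simp
  have "(1/2 :: real) ^ (s - 3) * (1/4) ^ (s - 2) \<le> 1 * (1/4) ^ (s - 3)"
    by (intro mult_mono power_decreasing) (auto simp: power_le_one)
  hence "x r * c * ((1/2) ^ (s - 3) * (1/4) ^ (s - 2)) \<le> x z * c * (1/4) ^ (s - 3)"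
    using rz c x_pos[of r] x_pos[OF zV] PV uvr(4) by (intro mult_mono) (auto intro!: mult_nonneg_nonneg less_imp_le)
  hence "0 \<le> g T0 + g T1" using g0 g1 by (simp add: mult.assoc)
  thus False using le neg by linarith
qed

text \<open>The averages are taken with respect to the weights \<open>M\<close>, whose total is \<open>C u v\<close>: cloning bounds the average
  of \<open>e\<close>, merging and the Lagrange condition bound the average of \<open>X\<close>.\<close>

lemma part_sizes:
  assumes P: "P \<in> parts" and R: "R \<in> parts"
  shows "card P \<le> card R + 1"
proof (rule ccontr)
  assume "\<not> ?thesis"
  hence gap: "card R + 2 \<le> card P" by simp
  hence ne: "P \<noteq> R" by auto
  obtain u v where u: "u \<in> P" and v: "v \<in> R"
    using P R partition_onD3[OF partition_parts] by (metis ex_in_conv)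
  note disj = parts_disjoint[OF P R ne]
  have uv: "u \<in> V" "v \<in> V" "u \<noteq> v"
    using part_subset[OF P] part_subset[OF R] u v disj by auto
  let ?N = "V - {u, v}"
  let ?K = "ksub ?N (s - 2)"
  let ?p = "\<lambda>T. card (T \<inter> P)" and ?l = "\<lambda>T. card (T \<inter> R)"
  \<comment> \<open>The vertices of \<open>P\<close> and \<open>R\<close> left besides
    \<open>u\<close> and \<open>v\<close>; the assumed gap of two survives as
    \<open>m + 2 \<le> k\<close>.\<close>
  define k where "k = card P - 1"
  define m where "m = card R - 1"
  have cR: "1 \<le> card R" using v finite_part[OF R] by (auto simp: Suc_le_eq card_gt_0_iff)
  have km: "m + 2 \<le> k" using gap cR by (simp add: k_def m_def)
  have NP: "?N \<inter> P = P - {u}" "?N \<inter> R = R - {v}"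
    using part_subset[OF P] part_subset[OF R] u v disj by blast+
  have cN: "card (?N \<inter> P) = k" "card (?N \<inter> R) = m"
    unfolding NP k_def m_def using u v finite_part P R by simp_all
  define y where "y = x u"
  define z where "z = x v"
  have y: "0 < y" and z: "0 < z" unfolding y_def z_def using x_pos uv by auto
  have yz: "y \<le> z" unfolding y_def z_def
    using larger_part_lighter[OF P u R v] gap by simp
  define \<rho> where "\<rho> = z / y"
  have \<rho>: "1 \<le> \<rho>" using y yz by (simp add: \<rho>_def)
  have z_eq: "z = \<rho> * y" using y by (simp add: \<rho>_def)
  have one: "w u v = 1" using edge_in_part[OF P u uv(2,3)] disj v by auto
  \<comment> \<open>With the integrand of \<open>C u v\<close> as measure, \<open>e\<close> and
    \<open>X\<close> are the quotients by it of the integrands of \<open>CC u v\<close> and of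
    \<open>(E u v - B u v) / y\<close>.\<close>
  define M where "M T = cw x w T * ((1/2) ^ ?p T * (1/2) ^ ?l T)" for T
  define e where "e T = (2::real) ^ ?p T / 2 ^ ?l T" for T
  define X where "X T = real (k - ?p T) * psi (?p T) * 2 ^ ?l T" for T
  have pu: "prod (w u) T = (1/2) ^ ?p T" and pv: "prod (w v) T = (1/2) ^ ?l T" if "T \<in> ?K" for T
    using that by (auto intro!: prod_edge_part P R u v)
  have C: "C u v = sum M ?K"
    unfolding ws_def M_def by (intro sum.cong refl) (simp add: prod.distrib pu pv)
  have CC: "CC u v = (\<Sum>T\<in>?K. M T * e T)"
    unfolding ws_def M_def e_def
    by (intro sum.cong refl) (simp add: prod.distrib pv field_simps power_one_over)
  have EB: "E u v - B u v = y * (\<Sum>T\<in>?K. M T * X T)"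
    unfolding E_minus_B[OF P u] y_def cN M_def X_def
    by (intro arg_cong[of _ _ "(*) (x u)"] sum.cong refl) (simp add: field_simps power_one_over)
  have M0: "0 \<le> M T" if "T \<in> ?K" for T
    unfolding M_def using that by (intro mult_nonneg_nonneg cw_nonneg_V) auto
  have pk: "?p T \<le> k" and lm: "?l T \<le> m" if "T \<in> ?K" for T
  proof -
    have "T \<inter> P \<subseteq> ?N \<inter> P" "T \<inter> R \<subseteq> ?N \<inter> R" using that by auto
    thus "?p T \<le> k" "?l T \<le> m" unfolding cN[symmetric] using fin by (auto intro!: card_mono)
  qed
  have Cpos: "0 < C u v" by (rule C_pos[OF uv])
  have lag: "B v u - B u v = (z - y) * C u v"
    using lagrange[OF uv] one by (simp add: y_def z_def algebra_simps)
  define \<theta> where "\<theta> = 8 / (1 + \<rho>)\<^sup>2"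
  have "(y + z)\<^sup>2 * CC u v \<le> 8 * (C u v * y\<^sup>2)"
    using clone_bound[OF uv] one by (simp add: y_def z_def)
  hence "y\<^sup>2 * ((1 + \<rho>)\<^sup>2 * CC u v) \<le> y\<^sup>2 * (8 * C u v)"
    unfolding z_eq by (simp add: power2_eq_square algebra_simps)
  hence "(1 + \<rho>)\<^sup>2 * CC u v \<le> 8 * C u v"
    using y by (simp add: mult_le_cancel_left_pos)
  hence a: "(\<Sum>T\<in>?K. M T * e T) \<le> \<theta> * C u v"
    using \<rho> unfolding CC \<theta>_def by (simp add: field_simps)
  have sumX: "y * (\<Sum>T\<in>?K. M T * X T) = E u v - B v u + (z - y) * C u v"
    using EB lag by simp
  show False
  proof (cases "m = 0")
    case True
    \<comment> \<open>All edges at the only vertex of a part already have weight \<open>1\<close>.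
      So the average of \<open>X\<close> is known exactly instead of being bounded by
      merging.\<close>
    have "E u v - B v u = 0"
    proof -
      have "card ((V - {v, u}) \<inter> R) = 0" unfolding swap[of v u] using cN True by simp
      thus ?thesis using E_minus_B[OF R v, of u] unfolding swap[of v u] by simp
    qed
    hence "y * (\<Sum>T\<in>?K. M T * X T) = y * ((\<rho> - 1) * C u v)"
      using sumX unfolding z_eq by (simp add: algebra_simps)
    hence b: "(\<Sum>T\<in>?K. M T * X T) = (\<rho> - 1) * C u v" using y by simp
    have l0: "?l T = 0" if "T \<in> ?K" for T using lm[OF that] True by simp
    have "1 * C u v \<le> (\<Sum>T\<in>?K. M T * e T)"
      unfolding C sum_distrib_left
    proof (rule sum_mono)
      fix T assume T: "T \<in> ?K"
      have "1 \<le> e T" unfolding e_def l0[OF T] by simp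
      thus "1 * M T \<le> M T * e T" using M0[OF T] mult_left_mono[of 1 "e T" "M T"] by simp
    qed
    with a have "1 * C u v \<le> \<theta> * C u v" by linarith
    hence "1 \<le> \<theta>" using Cpos by (simp only: mult_le_cancel_right_pos)
    hence "(1 + \<rho>)\<^sup>2 \<le> 8" using \<rho> by (simp add: \<theta>_def field_simps)
    from singleton_numeric[OF \<rho> this] have num: "\<theta> + 3/2 * (\<rho> - 1) < 5/2" by (simp add: \<theta>_def)
    have "5/2 * C u v \<le> (\<Sum>T\<in>?K. M T * e T + 3/2 * (M T * X T))"
      unfolding C sum_distrib_left
    proof (rule sum_mono)
      fix T assume T: "T \<in> ?K"
      have "5/2 \<le> e T + 3/2 * X T"
        using move_gain_pointwise_singleton[OF pk[OF T]] km l0[OF T] by (simp add: e_def X_def)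
      from mult_left_mono[OF this M0[OF T]]
      show "5/2 * M T \<le> M T * e T + 3/2 * (M T * X T)" by (simp add: algebra_simps)
    qed
    also have "\<dots> = (\<Sum>T\<in>?K. M T * e T) + 3/2 * ((\<rho> - 1) * C u v)"
      unfolding b[symmetric] by (simp add: sum.distrib sum_distrib_left)
    also have "\<dots> \<le> \<theta> * C u v + 3/2 * ((\<rho> - 1) * C u v)" using a by (rule add_right_mono)
    also have "\<dots> = (\<theta> + 3/2 * (\<rho> - 1)) * C u v" by (simp only: distrib_right mult.assoc)
    also have "\<dots> < 5/2 * C u v" using num Cpos by (rule mult_strict_right_mono)
    finally show False by simp
  next
    case False
    hence k3: "3 \<le> k" using km by simp
    \<comment> \<open>\<open>A\<close> is chosen as \<open>\<theta> / \<xi>\<close>: the averages of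
      \<open>e\<close> and of \<open>A * X\<close> are then bounded by \<open>\<theta>\<close> each,
      the second strictly, against the pointwise lower bound \<open>2 * \<theta>\<close> for their
      sum.\<close>
    define A where "A = 8 / ((1 + \<rho>) * \<rho>\<^sup>2)"
    define \<xi> where "\<xi> = \<rho>\<^sup>2 / (1 + \<rho>)"
    have A: "0 < A" using \<rho> by (simp add: A_def)
    have "A * \<xi> = \<theta>" using \<rho> by (simp add: A_def \<xi>_def \<theta>_def power2_eq_square)
    have "(y + z) * (E u v - B v u) < C u v * y\<^sup>2"
      using merge_bound[OF uv] one by (simp add: y_def z_def)
    moreover have "(y + z) * (y * (\<Sum>T\<in>?K. M T * X T))
        = (y + z) * (E u v - B v u) + (z\<^sup>2 - y\<^sup>2) * C u v"
      unfolding sumX by (simp add: power2_eq_square algebra_simps)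
    ultimately have "(y + z) * (y * (\<Sum>T\<in>?K. M T * X T)) < z\<^sup>2 * C u v"
      by (simp add: algebra_simps)
    hence "y\<^sup>2 * ((1 + \<rho>) * (\<Sum>T\<in>?K. M T * X T)) < y\<^sup>2 * (\<rho>\<^sup>2 * C u v)"
      unfolding z_eq by (simp add: power2_eq_square algebra_simps)
    hence "(1 + \<rho>) * (\<Sum>T\<in>?K. M T * X T) < \<rho>\<^sup>2 * C u v"
      using y by (simp add: mult_less_cancel_left_pos)
    hence b: "(\<Sum>T\<in>?K. M T * X T) < \<xi> * C u v"
      using \<rho> by (simp add: \<xi>_def field_simps)
    have "2 * \<theta> * C u v \<le> (\<Sum>T\<in>?K. M T * e T + A * (M T * X T))"
      unfolding C sum_distrib_left
    proof (rule sum_mono)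
      fix T assume T: "T \<in> ?K"
      have "2 * \<theta> \<le> e T + A * X T"
        using move_gain_pointwise[OF \<rho> pk[OF T], of "?l T"] lm[OF T] km k3
        by (simp add: \<theta>_def e_def A_def X_def)
      from mult_left_mono[OF this M0[OF T]]
      show "2 * \<theta> * M T \<le> M T * e T + A * (M T * X T)" by (simp add: algebra_simps)
    qed
    also have "\<dots> = (\<Sum>T\<in>?K. M T * e T) + A * (\<Sum>T\<in>?K. M T * X T)"
      by (simp add: sum.distrib sum_distrib_left)
    also have "\<dots> < \<theta> * C u v + A * (\<xi> * C u v)"
      using a mult_strict_left_mono[OF b A] by linarith
    also have "\<dots> = 2 * \<theta> * C u v" using \<open>A * \<xi> = \<theta>\<close> by (simp add: mult.assoc[symmetric])
    finally show False by simp
  qed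
qed

lemma A1_to_A5: "A1_to_A5 s t (G V x w)"
  unfolding A1_to_A5_def
proof (intro conjI exI[of _ parts])
  show "condA1 (G V x w)"
    using half_or_one by (simp add: condA1_def)
  show "condA2 s t (G V x w) parts"
    unfolding condA2_def wgraph.simps
  proof (intro conjI ballI impI)
    show "partition_on V parts" by (rule partition_parts)
    show "x v = x v'" if "P \<in> parts" "v \<in> P" "v' \<in> P" for P v v'
      by (rule same_weight[OF that])
    show "w v v' = (if \<exists>P\<in>parts. v \<in> P \<and> v' \<in> P then 1/2 else 1)"
      if "v \<in> V" "v' \<in> V" "v \<noteq> v'" for v v'
      by (rule edge_weight[OF that])
    show "s \<le> card V" by (rule s_le_card)
    show "card parts + card V = t - 1" by (rule card_parts)
  qed
  show "condA3 parts"
    unfolding condA3_def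
  proof (intro ballI)
    fix P R assume "P \<in> parts" "R \<in> parts"
    thus "\<bar>int (card P) - int (card R)\<bar> \<le> 1"
      using part_sizes[of P R] part_sizes[of R P] by linarith
  qed
  show "condA4 (G V x w) parts"
    unfolding condA4_def wgraph.simps
  proof (intro conjI ballI impI)
    show "x v \<le> x v'" if "P \<in> parts" "R \<in> parts" "card R \<le> card P" "v \<in> P" "v' \<in> R" for P R v v'
      by (rule larger_part_lighter[OF that(1,4,2,5,3)])
    fix P R v v' assume PR: "P \<in> parts" "R \<in> parts" "card P = card R" "v \<in> P \<union> R" "v' \<in> P \<union> R"
    then obtain S S' where S: "S \<in> {P, R}" "S' \<in> {P, R}" "v \<in> S" "v' \<in> S'" by blast
    hence "S \<in> parts" "S' \<in> parts" "card S = card S'" using PR(1-3) by auto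
    thus "x v = x v'"
      using larger_part_lighter[of S v S' v'] larger_part_lighter[of S' v' S v] S(3,4) by simp
  qed
  show "condA5 s parts"
  proof (cases "\<exists>P\<in>parts. card P = s")
    case True
    then obtain P where "P \<in> parts" "card P = s" by blast
    thus ?thesis using card_part_eq_s[of P] by (simp add: condA5_def)
  next
    case False
    have le: "card P \<le> s - 1" if "P \<in> parts" for P
      using card_part_le[OF that] False that by (metis Suc_pred' diff_Suc_1 le_neq_implies_less less_Suc_eq_le not_gr_zero less_zeroE)
    have "card parts \<noteq> 0"
    proof
      assume "card parts = 0"
      hence "V = {}" using finite_parts partition_onD1[OF partition_parts] by simp
      thus False using s_le_card s3 by simp
    qed
    \<comment> \<open>A single part would be all of \<open>V\<close>, which has at least
      \<open>s\<close> vertices.\<close>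
    moreover have "card parts \<noteq> 1"
    proof
      assume "card parts = 1"
      then obtain P where P: "parts = {P}" by (auto simp: card_1_singleton_iff)
      hence "V = P" using partition_onD1[OF partition_parts] by simp
      thus False using le[of P] P s_le_card s3 by simp
    qed
    ultimately have "2 \<le> card parts" by linarith
    thus ?thesis using le by (simp add: condA5_def)
  qed
qed

end

lemma min_extremal_A1_to_A5:
  assumes "3 \<le> s" "s \<le> t - 2" "min_extremal s t R"
  shows "A1_to_A5 s t R"
proof -
  obtain V x w where R: "R = G V x w" by (cases R) auto
  interpret min_extremal_graph s t V x w
    using assms unfolding R by unfold_locales
  show ?thesis unfolding R by (rule A1_to_A5)
qed

theorem theorem3p1:
  fixes s t :: nat
  assumes "3 \<le> s" and "s \<le> t - 2"
  shows "(\<exists>R :: nat wgraph. extremal s t R \<and> A1_to_A5 s t R) \<and>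
         (\<forall>R :: 'a wgraph. min_extremal s t R \<longrightarrow> A1_to_A5 s t R)"
proof
  have "\<exists>R :: nat wgraph. extremal s t R"
    using assms by (intro ex_extremal) auto
  then obtain R :: "nat wgraph" where R: "extremal s t R"
    and least: "\<And>R' :: nat wgraph. extremal s t R' \<Longrightarrow> card (verts R) \<le> card (verts R')"
    using ex_has_least_nat[of "extremal s t" _ "\<lambda>R :: nat wgraph. card (verts R)"] by blast
  hence "min_extremal s t R" by (simp add: min_extremal_def)
  thus "\<exists>R :: nat wgraph. extremal s t R \<and> A1_to_A5 s t R"
    using R min_extremal_A1_to_A5[OF assms] by blast
  show "\<forall>R :: 'a wgraph. min_extremal s t R \<longrightarrow> A1_to_A5 s t R"
    using min_extremal_A1_to_A5[OF assms] by blast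
qed

end
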